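(* Let $0<\alpha\le1$, $0<D<\infty$, and let $\delta>0$, $F=[F_1,F_2]$ with $F_1<0<1<F_2$ be such that $\mathcal D=\mathcal D(\alpha,D,\delta,F)$ is nonempty. Let $j_n\to\infty$ as $n\to\infty$ satisfy $j_n2^{j_n}=o(n/(\log n)^2)$, and let $f_n(y)=\frac{2^{j_n}}n\sum_{i=1}^nK(2^{j_n}y,2^{j_n}X_i)$ be the Haar wavelet density estimator, where $K(x,y)=\sum_{k\in\mathbb Z}1_{[0,1)}(x-k)1_{[0,1)}(y-k)$ and $X_1,\dots,X_n$ are i.i.d. with density $f$. Let $A_n=A(j_n)$, $B_n=B(j_n)$ with $$A(l)=[2(\log2)l]^{1/2},\qquad B(l)=A(l)-\frac{\log l+\log(\pi\log2)}{2A(l)}.$$ Then, for all $x\in\mathbb R$, as $n\to\infty$, $$\sup_{f\in\mathcal D}\left|\Pr\nolimits_f\left\{A_n\left(\sqrt{n2^{-j_n}}\sup_{y\in[0,1]}\left|\frac{f_n(y)-Ef_n(y)}{\sqrt{f(y)}}\right|-B_n\right)\le x\right\}-e^{-e^{-x}}\right|\to0.$$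
   Context: $\Pr_f$ is the product probability under which the $X_i$ are i.i.d. with density $f$. $\mathcal D(\alpha,D,\delta,F)$ is the set of $f:\mathbb R\to\mathbb R$ with $\int f=1$, $f\ge0$ on $\mathbb R$, $f\ge\delta$ on $F$, $\|f\|_{\alpha,\infty}\le D$. Here $\|f\|_{\alpha,\infty}=\sup_k|\alpha_k(f)|+\sup_{l\ge0,k}2^{l(\alpha+1/2)}|\beta_{lk}(f)|$ for bounded continuous $f$, with $\alpha_k(f)=\int f(x)\varphi(x-k)dx$, $\beta_{lk}(f)=\int f(x)2^{l/2}\psi(2^lx-k)dx$ for a fixed scaling function $\varphi$ and associated wavelet $\psi$ with $\varphi$ $s$-regular, $s>\alpha$ ($s$ times weakly differentiable, all derivatives up to order $s$ decaying exponentially); for $0<\alpha<1$ this norm is equivalent to the Hölder norm $\|f\|_\infty+\sup_{x\ne y}|f(x)-f(y)|/|x-y|^\alpha$, and for $\alpha=1$ it is equivalent to the Zygmund norm. *)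

theory Defs
  imports "HOL-Probability.Probability" "HOL-Library.Landau_Symbols"
begin

section \<open>The space $L^2$ of the real line\<close>

text \<open>Elements are Borel representatives; equality of classes is almost-everywhere equality.\<close>

definition L2 :: "(real \<Rightarrow> real) set" where
  "L2 = {f. f \<in> borel_measurable borel \<and> integrable lborel (\<lambda>x. (f x)\<^sup>2)}"

definition orthonormal_L2 :: "('i \<Rightarrow> real \<Rightarrow> real) \<Rightarrow> bool" where
  "orthonormal_L2 e \<longleftrightarrow> (\<forall>i. e i \<in> L2) \<and>
     (\<forall>i j. (LINT x|lborel. e i x * e j x) = (if i = j then 1 else 0))"

text \<open>The functions \<open>\<Sum>i. c i * e i\<close> with square-summable \<open>c\<close>, the series
  converging unconditionally in $L^2$.\<close>

definition l2_combinations :: "('i \<Rightarrow> real \<Rightarrow> real) \<Rightarrow> (real \<Rightarrow> real) set" where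
  "l2_combinations e = {f \<in> L2. \<exists>c. (\<lambda>i. (c i)\<^sup>2) summable_on UNIV \<and>
     ((\<lambda>I. LINT x|lborel. (f x - (\<Sum>i\<in>I. c i * e i x))\<^sup>2) \<longlongrightarrow> 0) (finite_subsets_at_top UNIV)}"

definition orthonormal_basis_L2 :: "('i \<Rightarrow> real \<Rightarrow> real) \<Rightarrow> bool" where
  "orthonormal_basis_L2 e \<longleftrightarrow> orthonormal_L2 e \<and> l2_combinations e = L2"


section \<open>Scaling functions and wavelets\<close>

definition translates :: "(real \<Rightarrow> real) \<Rightarrow> int \<Rightarrow> real \<Rightarrow> real" where
  "translates \<phi> k x = \<phi> (x - of_int k)"

definition wavelet_dilates :: "(real \<Rightarrow> real) \<Rightarrow> nat \<times> int \<Rightarrow> real \<Rightarrow> real" where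
  "wavelet_dilates \<psi> = (\<lambda>(l, k) x. 2 powr (real l / 2) * \<psi> (2 ^ l * x - of_int k))"

definition resolution_space :: "(real \<Rightarrow> real) \<Rightarrow> nat \<Rightarrow> (real \<Rightarrow> real) set" where
  "resolution_space \<phi> j = {(\<lambda>x. f (2 ^ j * x)) | f. f \<in> l2_combinations (translates \<phi>)}"

definition scaling_function :: "(real \<Rightarrow> real) \<Rightarrow> bool" where
  "scaling_function \<phi> \<longleftrightarrow> orthonormal_L2 (translates \<phi>) \<and>
     (\<forall>j. resolution_space \<phi> j \<subseteq> resolution_space \<phi> (Suc j)) \<and>
     (\<forall>g\<in>L2. \<forall>\<epsilon>>0. \<exists>j. \<exists>h\<in>resolution_space \<phi> j. (LINT x|lborel. (g x - h x)\<^sup>2) < \<epsilon>)"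

text \<open>Integrability of \<open>\<psi>\<close> is what makes the wavelet coefficients of a bounded function
  well defined. It holds for the standard choice
  \<open>\<psi>(x) = \<Sum>k. (-1)^k * h (1 - k) * sqrt 2 * \<phi> (2 * x - k)\<close>, with
  \<open>h k = \<integral> \<phi>(x) * sqrt 2 * \<phi> (2 * x - k) dx\<close>, whenever \<open>\<phi>\<close> decays exponentially.\<close>

definition associated_wavelet :: "(real \<Rightarrow> real) \<Rightarrow> (real \<Rightarrow> real) \<Rightarrow> bool" where
  "associated_wavelet \<phi> \<psi> \<longleftrightarrow> integrable lborel \<psi> \<and>
     orthonormal_basis_L2 (case_sum (translates \<phi>) (wavelet_dilates \<psi>))"

definition test_function :: "(real \<Rightarrow> real) \<Rightarrow> bool" where
  "test_function h \<longleftrightarrow> (\<forall>m x. ((deriv ^^ m) h) differentiable (at x)) \<and>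
     (\<exists>R. \<forall>x. \<bar>x\<bar> > R \<longrightarrow> h x = 0)"

definition locally_integrable :: "(real \<Rightarrow> real) \<Rightarrow> bool" where
  "locally_integrable g \<longleftrightarrow> (\<forall>a b. set_integrable lborel {a..b} g)"

definition weak_derivative :: "nat \<Rightarrow> (real \<Rightarrow> real) \<Rightarrow> (real \<Rightarrow> real) \<Rightarrow> bool" where
  "weak_derivative m f g \<longleftrightarrow> locally_integrable f \<and> locally_integrable g \<and>
     (\<forall>h. test_function h \<longrightarrow>
        (LINT x|lborel. f x * (deriv ^^ m) h x) = (-1) ^ m * (LINT x|lborel. g x * h x))"

definition exponentially_decaying :: "(real \<Rightarrow> real) \<Rightarrow> bool" where
  "exponentially_decaying g \<longleftrightarrow>
     (\<exists>C>0. \<exists>\<gamma>>0. AE x in lborel. \<bar>g x\<bar> \<le> C * exp (- \<gamma> * \<bar>x\<bar>))"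

definition s_regular :: "nat \<Rightarrow> (real \<Rightarrow> real) \<Rightarrow> bool" where
  "s_regular s \<phi> \<longleftrightarrow> (\<forall>m\<le>s. \<exists>g. weak_derivative m \<phi> g \<and> exponentially_decaying g)"


section \<open>The class of densities\<close>

definition scaling_coeff :: "(real \<Rightarrow> real) \<Rightarrow> (real \<Rightarrow> real) \<Rightarrow> int \<Rightarrow> real" where
  "scaling_coeff \<phi> f k = (LINT x|lborel. f x * \<phi> (x - of_int k))"

definition wavelet_coeff :: "(real \<Rightarrow> real) \<Rightarrow> (real \<Rightarrow> real) \<Rightarrow> nat \<Rightarrow> int \<Rightarrow> real" where
  "wavelet_coeff \<psi> f l k =
     (LINT x|lborel. f x * (2 powr (real l / 2) * \<psi> (2 ^ l * x - of_int k)))"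

text \<open>Values in the extended reals, so that functions outside the space have norm \<open>\<infinity>\<close>.\<close>

definition wavelet_norm ::
  "(real \<Rightarrow> real) \<Rightarrow> (real \<Rightarrow> real) \<Rightarrow> real \<Rightarrow> (real \<Rightarrow> real) \<Rightarrow> ennreal" where
  "wavelet_norm \<phi> \<psi> \<alpha> f =
     (SUP k. ennreal \<bar>scaling_coeff \<phi> f k\<bar>) +
     (SUP (l, k). ennreal (2 powr (real l * (\<alpha> + 1/2)) * \<bar>wavelet_coeff \<psi> f l k\<bar>))"

definition density_class ::
  "(real \<Rightarrow> real) \<Rightarrow> (real \<Rightarrow> real) \<Rightarrow> real \<Rightarrow> real \<Rightarrow> real \<Rightarrow> real set \<Rightarrow> (real \<Rightarrow> real) set" where
  "density_class \<phi> \<psi> \<alpha> D \<delta> F = {f. continuous_on UNIV f \<and> bounded (range f) \<and>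
     has_bochner_integral lborel f 1 \<and> (\<forall>x. 0 \<le> f x) \<and> (\<forall>x\<in>F. \<delta> \<le> f x) \<and>
     wavelet_norm \<phi> \<psi> \<alpha> f \<le> ennreal D}"


section \<open>The Haar wavelet density estimator\<close>

definition haar_kernel :: "real \<Rightarrow> real \<Rightarrow> real" where
  "haar_kernel x y = (\<Sum>\<^sub>\<infinity>k::int. indicator {0..<1} (x - of_int k) * indicator {0..<1} (y - of_int k))"

text \<open>A sample point \<open>\<omega>\<close> is a realization of the sequence $X_1, X_2, \ldots$, that is, \<open>X i = \<omega> i\<close>;
  the coordinate at index 0 is not used.\<close>

definition sample_measure :: "(real \<Rightarrow> real) \<Rightarrow> (nat \<Rightarrow> real) measure" where
  "sample_measure f = PiM UNIV (\<lambda>_. density lborel (\<lambda>x. ennreal (f x)))"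

definition haar_estimator :: "nat \<Rightarrow> nat \<Rightarrow> (nat \<Rightarrow> real) \<Rightarrow> real \<Rightarrow> real" where
  "haar_estimator j n \<omega> y = 2 ^ j / real n * (\<Sum>i=1..n. haar_kernel (2 ^ j * y) (2 ^ j * \<omega> i))"

definition mean_haar_estimator :: "(real \<Rightarrow> real) \<Rightarrow> nat \<Rightarrow> nat \<Rightarrow> real \<Rightarrow> real" where
  "mean_haar_estimator f j n y = (LINT \<omega>|sample_measure f. haar_estimator j n \<omega> y)"

definition A_norming :: "real \<Rightarrow> real" where
  "A_norming l = sqrt (2 * ln 2 * l)"

definition B_norming :: "real \<Rightarrow> real" where
  "B_norming l = A_norming l - (ln l + ln (pi * ln 2)) / (2 * A_norming l)"

end

theory Submission
  imports Defs "HOL-Real_Asymp.Real_Asymp"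
begin

text \<open>
The Haar estimator is constant on the dyadic intervals of length $2^{-J}$, so over $[0,1]$ the
normalised supremum is a maximum over $2^J+1$ bins: it is at most \<open>u\<close> exactly when every bin
count \<open>N\<close> with mean \<open>np\<close> satisfies \<open>\<bar>N - np\<bar> \<le> w\<close>, where $w$ is close to $u\sqrt{np}$
(\<open>sup_deviation_event\<close>). With $u = B + x/A$ and a standard normal $Z$ one has
$2^J \Pr(|Z| > u) \to e^{-x}$, so if the counts were independent and normal the limit would be
$(1-e^{-x}/2^J)^{2^J} \to e^{-e^{-x}}$. Three things have to be justified, uniformly over the class.

\<^item> \<^bold>\<open>The threshold.\<close> The argument needs $w = u\sqrt{np}\,(1+o(1/J))$, hence a modulus of continuity
for the densities that is $o(1/J)$ at distance $2^{-J}$. It comes from the bounds on the wavelet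
coefficients (\<open>density_class_modulus\<close>): expand \<open>f\<close> in the wavelet basis and pair it with the
derivative of a smooth version of the indicator of \<open>[x,y]\<close>, which is a smooth version of a
difference of point masses. A level $l$ contributes at most a constant times
$2^{-l\alpha}\min(1, 2^{l-J})$.

\<^item> \<^bold>\<open>The tails.\<close> Counts are binomial with small success probability, and the level \<open>u\<close> grows like
$\sqrt J$, so a central limit theorem is too weak. Stirling's formula gives each binomial
probability at distance $v\sqrt\lambda$ from the mean up to a factor \<open>1 + o(1)\<close> as long as
$v^3/\sqrt\lambda \to 0$, and beyond the level the probabilities decrease almost geometrically
(\<open>binomial_two_sided_tail\<close>). The condition on the resolution levels is what makes
$u^6$ negligible against the bin means $n2^{-J}$ (\<open>growth_condition\<close>).

\<^item> \<^bold>\<open>The dependence.\<close> Reveal the bins from left to right. Given the points in the bins \<open>< k\<close>, the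
count of bin \<open>k\<close> is again binomial, with the number of remaining points as its size. As long as
every partial sum of counts is within $\sqrt{Jn}$ of its mean, the conditional mean differs from
\<open>np\<close> too little to matter, so the conditional exceedance probability is $e^{-x}(1+o(1))/2^J$ whatever
happened before, and the product formula follows up to the probability that some partial sum is
atypical (\<open>sequential_occupancy\<close>). Hoeffding's inequality makes the latter at most
$(2^J+1)\cdot 2e^{-2J}$.

Uniformity over the class costs nothing extra in the second point: the tail asymptotics hold along every
sequence of parameters in the relevant range, hence uniformly (\<open>uniform_limit_by_sequences\<close>).
\<close>

section \<open>Smooth test functions\<close>

definition smooth :: "(real \<Rightarrow> real) \<Rightarrow> bool" where
  "smooth f \<longleftrightarrow> (\<forall>m x. ((deriv ^^ m) f) differentiable (at x))"

text \<open>A class of functions closed under differentiation consists of smooth functions. This avoids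
  formulas for higher derivatives.\<close>

lemma smooth_coinduct:
  assumes "X f" and step: "\<And>f. X f \<Longrightarrow> \<exists>g. X g \<and> (\<forall>x. (f has_real_derivative g x) (at x))"
  shows "smooth f"
  unfolding smooth_def
proof (intro allI)
  fix m x
  have "X ((deriv ^^ m) f)"
  proof (induction m)
    case (Suc m)
    from step[OF Suc] obtain g where "X g" "\<forall>x. ((deriv ^^ m) f has_real_derivative g x) (at x)" by blast
    moreover from this have "deriv ((deriv ^^ m) f) = g" by (auto intro: DERIV_imp_deriv)
    ultimately show ?case by simp
  qed (use assms in simp)
  from step[OF this] show "((deriv ^^ m) f) differentiable (at x)" by (auto simp: real_differentiable_def)
qed

lemma smooth_deriv: "smooth f \<Longrightarrow> smooth (deriv f)"
  unfolding smooth_def by (metis (no_types, lifting) comp_apply funpow_Suc_right)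

lemma smooth_has_deriv: "smooth f \<Longrightarrow> (f has_real_derivative deriv f x) (at x)"
proof -
  assume "smooth f"
  then have "((deriv ^^ 0) f) differentiable (at x)" unfolding smooth_def by blast
  then show ?thesis by (simp add: DERIV_deriv_iff_real_differentiable)
qed

lemma smooth_affine: "smooth f \<Longrightarrow> smooth (\<lambda>x. f (a * x + c))"
proof (rule smooth_coinduct[where X = "\<lambda>h. \<exists>k g. smooth g \<and> h = (\<lambda>x. k * g (a * x + c))"])
  assume "smooth f"
  then show "\<exists>k g. smooth g \<and> (\<lambda>x. f (a * x + c)) = (\<lambda>x. k * g (a * x + c))" by (intro exI[of _ 1] exI[of _ f]) auto
next
  fix h assume "\<exists>k g. smooth g \<and> h = (\<lambda>x. k * g (a * x + c))"
  then obtain k g where g: "smooth g" "h = (\<lambda>x. k * g (a * x + c))" by blast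
  have "(h has_real_derivative (k * a) * deriv g (a * x + c)) (at x)" for x
    unfolding g(2) by (rule derivative_eq_intros DERIV_chain'[where f = "\<lambda>x. a * x + c"] smooth_has_deriv[OF g(1)] refl | simp)+
  moreover have "smooth (deriv g)" using g(1) by (rule smooth_deriv)
  ultimately show "\<exists>h'. (\<exists>k g. smooth g \<and> h' = (\<lambda>x. k * g (a * x + c))) \<and> (\<forall>x. (h has_real_derivative h' x) (at x))"
    by (intro exI[of _ "\<lambda>x. (k * a) * deriv g (a * x + c)"]) blast
qed

lemma smooth_diff: "smooth f \<Longrightarrow> smooth g \<Longrightarrow> smooth (\<lambda>x. f x - g x)"
proof (rule smooth_coinduct[where X = "\<lambda>h. \<exists>f g. smooth f \<and> smooth g \<and> h = (\<lambda>x. f x - g x)"])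
  fix h assume "\<exists>f g. smooth f \<and> smooth g \<and> h = (\<lambda>x. f x - g x)"
  then obtain f g where fg: "smooth f" "smooth g" "h = (\<lambda>x. f x - g x)" by blast
  have "(h has_real_derivative deriv f x - deriv g x) (at x)" for x
    unfolding fg(3) by (intro DERIV_diff smooth_has_deriv fg)
  then show "\<exists>h'. (\<exists>f g. smooth f \<and> smooth g \<and> h' = (\<lambda>x. f x - g x)) \<and> (\<forall>x. (h has_real_derivative h' x) (at x))"
    using fg smooth_deriv by (intro exI[of _ "\<lambda>x. deriv f x - deriv g x"]) blast
qed blast

text \<open>For \<open>p = 1\<close> and \<open>k = 0\<close> this is the classical bump function $e^{-1/(t(1-t))}$ on $(0,1)$.
  The polynomial and the negative power of $t(1-t)$ close the family under differentiation.\<close>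

definition bump :: "real poly \<Rightarrow> nat \<Rightarrow> real \<Rightarrow> real" where
  "bump p k t = (if 0 < t \<and> t < 1 then poly p t * exp (- (1 / (t * (1 - t)))) / (t * (1 - t)) ^ k else 0)"

text \<open>The numerator of the derivative when the exponent of the denominator is raised by 2. The
  polynomial \<open>[:0, 1, -1:]\<close> is $t(1-t)$ and \<open>[:1, -2:]\<close> is its derivative.\<close>

definition bump_step :: "real poly \<Rightarrow> nat \<Rightarrow> real poly" where
  "bump_step p k = pderiv p * [:0, 1, -1:] ^ 2 - smult (real k) (p * [:1, -2:] * [:0, 1, -1:]) + p * [:1, -2:]"

lemma power_exp_bound: "\<exists>C. \<forall>s\<ge>0. s ^ k * exp (- s) \<le> (C :: real)"
proof (intro exI allI impI)
  fix s :: real assume s: "s \<ge> 0"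
  have "(1 + s / real (Suc k)) ^ Suc k \<le> exp s"
    using exp_ge_one_plus_x_over_n_power_n[of "Suc k" s] s by simp
  moreover have "(s / real (Suc k)) ^ k \<le> (1 + s / real (Suc k)) ^ k" using s by (intro power_mono) auto
  moreover have "(1 + s / real (Suc k)) ^ k \<le> (1 + s / real (Suc k)) ^ Suc k" using s by (intro power_increasing) auto
  ultimately have "(s / real (Suc k)) ^ k \<le> exp s" by linarith
  then have "s ^ k \<le> real (Suc k) ^ k * exp s" by (simp add: power_divide field_simps del: of_nat_Suc)
  then show "s ^ k * exp (- s) \<le> real (Suc k) ^ k" by (simp add: exp_minus field_simps del: of_nat_Suc)
qed

text \<open>The exponential beats every power of $1/(t(1-t))$, so members of the family vanish to second
  order at both end points; this is why they are differentiable there.\<close>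

lemma bump_bound: "\<exists>C. \<forall>t. \<bar>bump p k t\<bar> \<le> C * t\<^sup>2 \<and> \<bar>bump p k t\<bar> \<le> C * (1 - t)\<^sup>2"
proof -
  obtain C1 :: real where C1: "\<And>s. s \<ge> 0 \<Longrightarrow> s ^ (k + 2) * exp (- s) \<le> C1" using power_exp_bound by blast
  have "compact ((\<lambda>t. poly p t) ` {0..1})" by (intro compact_continuous_image) (auto intro!: continuous_intros)
  then have "bounded ((\<lambda>t. poly p t) ` {0..1})" by (rule compact_imp_bounded)
  then obtain C2 where "\<forall>x\<in>(\<lambda>t. poly p t) ` {0..1}. norm x \<le> C2"
    unfolding bounded_iff by blast
  then have C2: "\<bar>poly p t\<bar> \<le> C2" if "t \<in> {0..1}" for t using that by simp
  have C1p: "C1 \<ge> 0" using C1[of 0] by simp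
  have C2p: "C2 \<ge> 0" using C2[of 0] by force
  have *: "\<bar>bump p k t\<bar> \<le> C2 * C1 * (t * (1 - t))\<^sup>2" if t: "0 < t" "t < 1" for t
  proof -
    define s where "s = 1 / (t * (1 - t))"
    have w: "t * (1 - t) > 0" using t by simp
    have s: "s > 0" "t * (1 - t) = 1 / s" using w by (auto simp: s_def)
    have "bump p k t = poly p t * (s ^ (k + 2) * exp (- s)) * (t * (1 - t))\<^sup>2"
      using t w s(1) unfolding bump_def s(2) by (simp add: power_divide field_simps power2_eq_square)
    also have "\<bar>\<dots>\<bar> = \<bar>poly p t\<bar> * (s ^ (k + 2) * exp (- s)) * (t * (1 - t))\<^sup>2" using s by (simp add: abs_mult)
    also have "\<dots> \<le> C2 * C1 * (t * (1 - t))\<^sup>2"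
      using s C1[of s] C2[of t] t C2p by (intro mult_right_mono mult_mono) auto
    finally show ?thesis .
  qed
  have "\<bar>bump p k t\<bar> \<le> C2 * C1 * t\<^sup>2 \<and> \<bar>bump p k t\<bar> \<le> C2 * C1 * (1 - t)\<^sup>2" for t
  proof (cases "0 < t \<and> t < 1")
    case True
    have "(t * (1 - t))\<^sup>2 \<le> t\<^sup>2" "(t * (1 - t))\<^sup>2 \<le> (1 - t)\<^sup>2"
      using True by (auto intro!: power_mono simp: mult_left_le mult_left_le_one_le)
    then have "C2 * C1 * (t * (1 - t))\<^sup>2 \<le> C2 * C1 * t\<^sup>2" "C2 * C1 * (t * (1 - t))\<^sup>2 \<le> C2 * C1 * (1 - t)\<^sup>2"
      using C1p C2p by (auto intro!: mult_left_mono)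
    then show ?thesis using *[of t] True by linarith
  next
    case False
    then have "bump p k t = 0" unfolding bump_def by (rule if_not_P)
    then show ?thesis using C1p C2p by simp
  qed
  then show ?thesis by blast
qed

lemma flat_zero_derivative:
  fixes h :: "real \<Rightarrow> real"
  assumes "\<And>t. \<bar>h t\<bar> \<le> C * (t - a)\<^sup>2"
  shows "(h has_real_derivative 0) (at a)"
proof -
  have ha: "h a = 0" using assms[of a] by simp
  have "((\<lambda>t. (h t - h a) / (t - a)) \<longlongrightarrow> 0) (at a)"
  proof (rule Lim_null_comparison)
    show "\<forall>\<^sub>F t in at a. norm ((h t - h a) / (t - a)) \<le> C * \<bar>t - a\<bar>"
      unfolding eventually_at_filter
    proof (intro always_eventually allI impI)
      fix t :: real assume "t \<noteq> a"
      then have "\<bar>h t\<bar> / \<bar>t - a\<bar> \<le> C * (t - a)\<^sup>2 / \<bar>t - a\<bar>" using assms by (intro divide_right_mono) auto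
      also have "\<dots> = C * \<bar>t - a\<bar>" using \<open>t \<noteq> a\<close> by (simp add: power2_eq_square field_simps abs_mult_self_eq)
      finally show "norm ((h t - h a) / (t - a)) \<le> C * \<bar>t - a\<bar>" by (simp add: ha abs_divide)
    qed
    have "((\<lambda>t. C * \<bar>t - a\<bar>) \<longlongrightarrow> C * \<bar>a - a\<bar>) (at a)" by (intro tendsto_intros)
    then show "((\<lambda>t. C * \<bar>t - a\<bar>) \<longlongrightarrow> 0) (at a)" by simp
  qed
  then show ?thesis by (simp add: has_field_derivative_iff)
qed

lemma inverse_exp_quotient_derivative:
  fixes P W :: "real \<Rightarrow> real"
  assumes "(P has_real_derivative P') (at t)" "(W has_real_derivative W') (at t)" "W t = w" "w \<noteq> 0"
  shows "((\<lambda>t. P t * exp (- (1 / W t)) / W t ^ k) has_real_derivative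
        ((P' * exp (- (1 / w)) + P t * (exp (- (1 / w)) * (W' / w\<^sup>2))) * w ^ k
          - P t * exp (- (1 / w)) * (real k * w ^ (k - 1) * W')) / (w ^ k)\<^sup>2) (at t)"
  using assms by (auto intro!: derivative_eq_intros simp: power2_eq_square field_simps)

lemma bump_derivative: "(bump p k has_real_derivative bump (bump_step p k) (k + 2) t) (at t)"
proof -
  consider "0 < t" "t < 1" | "t = 0" | "t = 1" | "t < 0 \<or> t > 1" by linarith
  then show ?thesis
  proof cases
    case 1
    define w where "w = t * (1 - t)"
    have w: "w > 0" using 1 by (simp add: w_def)
    have wne: "t * (1 - t) \<noteq> 0" using 1 by simp
    have "((\<lambda>t. poly p t * exp (- (1 / (t * (1 - t)))) / (t * (1 - t)) ^ k) has_real_derivative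
        ((poly (pderiv p) t * exp (- (1 / w)) + poly p t * (exp (- (1 / w)) * ((1 - 2 * t) / w\<^sup>2))) * w ^ k
          - poly p t * exp (- (1 / w)) * (real k * w ^ (k - 1) * (1 - 2 * t))) / (w ^ k)\<^sup>2) (at t)"
      by (rule inverse_exp_quotient_derivative)
        (use w in \<open>auto intro!: derivative_eq_intros poly_DERIV simp: w_def algebra_simps\<close>)
    also have "((poly (pderiv p) t * exp (- (1 / w)) + poly p t * (exp (- (1 / w)) * ((1 - 2 * t) / w\<^sup>2))) * w ^ k
          - poly p t * exp (- (1 / w)) * (real k * w ^ (k - 1) * (1 - 2 * t))) / (w ^ k)\<^sup>2
       = bump (bump_step p k) (k + 2) t"
    proof -
      have st: "poly (bump_step p k) t = poly (pderiv p) t * w\<^sup>2 - real k * (poly p t * (1 - 2 * t) * w) + poly p t * (1 - 2 * t)"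
        by (simp add: bump_step_def w_def algebra_simps)
      show ?thesis
        using 1 w unfolding bump_def st w_def[symmetric]
        by (cases k) (simp_all add: divide_simps power2_eq_square algebra_simps)
    qed
    finally have "((\<lambda>t. poly p t * exp (- (1 / (t * (1 - t)))) / (t * (1 - t)) ^ k) has_real_derivative bump (bump_step p k) (k + 2) t) (at t)" .
    then show ?thesis
    proof (rule has_field_derivative_transform_within_open[where S = "{0<..<1}"])
      show "t \<in> {0<..<1}" using 1 by simp
      show "poly p x * exp (- (1 / (x * (1 - x)))) / (x * (1 - x)) ^ k = bump p k x" if "x \<in> {0<..<1}" for x
        using that by (simp add: bump_def)
    qed auto
  next
    case 2
    obtain C where "\<And>t. \<bar>bump p k t\<bar> \<le> C * t\<^sup>2" using bump_bound by blast
    then have "(bump p k has_real_derivative 0) (at 0)" by (intro flat_zero_derivative[where C = C]) simp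
    then show ?thesis using 2 by (simp add: bump_def)
  next
    case 3
    obtain C where "\<And>t. \<bar>bump p k t\<bar> \<le> C * (1 - t)\<^sup>2" using bump_bound by blast
    then have "(bump p k has_real_derivative 0) (at 1)" by (intro flat_zero_derivative[where C = C]) (simp add: power2_commute)
    then show ?thesis using 3 by (simp add: bump_def)
  next
    case 4
    have "((\<lambda>_. 0) has_real_derivative 0) (at t)" by simp
    then have "(bump p k has_real_derivative 0) (at t)"
    proof (rule has_field_derivative_transform_within_open[where S = "{..<0} \<union> {1<..}"])
      show "t \<in> {..<0} \<union> {1<..}" using 4 by auto
    qed (auto simp: bump_def)
    then show ?thesis using 4 by (auto simp: bump_def)
  qed
qed

lemma smooth_bump: "smooth (bump p k)"
  by (rule smooth_coinduct[where X = "\<lambda>h. \<exists>p k. h = bump p k"]) (use bump_derivative in blast)+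

text \<open>The step is the normalised antiderivative of the bump function, so its derivative is a
  smooth probability density on $[0,1]$.\<close>

lemma smooth_step_exists:
  obtains S :: "real \<Rightarrow> real" where "smooth S" "\<And>t. t \<le> 0 \<Longrightarrow> S t = 0" "\<And>t. t \<ge> 1 \<Longrightarrow> S t = 1"
    "mono S" "\<And>t. deriv S t \<ge> 0" "\<And>t. t \<notin> {0..1} \<Longrightarrow> deriv S t = 0"
proof -
  define b where "b = bump 1 0"
  have bder: "(b has_real_derivative bump (bump_step 1 0) 2 t) (at t)" for t
    using bump_derivative[of 1 0 t] by (simp add: b_def numeral_2_eq_2)
  have bcont: "isCont b t" for t using bder by (rule DERIV_isCont)
  have bnn: "b t \<ge> 0" for t by (simp add: b_def bump_def)
  obtain F where F: "\<And>t. (F has_real_derivative b t) (at t)"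
  proof -
    have "\<exists>F. \<forall>x::real. - \<infinity> < ereal x \<longrightarrow> ereal x < \<infinity> \<longrightarrow> (F has_vector_derivative b x) (at x)"
      by (rule einterval_antiderivative) (simp_all add: bcont)
    then obtain F where "\<And>x. (F has_vector_derivative b x) (at x)" by auto
    then show ?thesis by (intro that) (simp only: has_real_derivative_iff_has_vector_derivative)
  qed
  have mF: "F s \<le> F t" if "s \<le> t" for s t
  proof (rule DERIV_nonneg_imp_nondecreasing[OF that])
    show "\<exists>y. (F has_real_derivative y) (at x) \<and> 0 \<le> y" for x using F[of x] bnn[of x] by blast
  qed
  have F01: "F 0 < F 1"
  proof (rule DERIV_pos_imp_increasing_open[of 0 1 F])
    show "\<exists>y. (F has_real_derivative y) (at x) \<and> 0 < y" if "0 < x" "x < 1" for x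
      using that by (intro exI[of _ "b x"] conjI F) (simp add: b_def bump_def)
    show "continuous_on {0..1} F" by (intro continuous_at_imp_continuous_on ballI DERIV_isCont[OF F])
  qed simp
  have F0: "F t = F 0" if "t \<le> 0" for t
  proof (rule antisym)
    show "F t \<le> F 0" using mF that by simp
    have "- F t \<le> - F 0"
    proof (rule DERIV_nonneg_imp_nondecreasing[OF that, where f = "\<lambda>x. - F x"])
      fix x :: real assume "t \<le> x" "x \<le> 0"
      then have "b x = 0" by (simp add: b_def bump_def)
      then show "\<exists>y. ((\<lambda>x. - F x) has_real_derivative y) (at x) \<and> 0 \<le> y"
        using DERIV_minus[OF F[of x]] by (intro exI[of _ 0]) simp
    qed
    then show "F 0 \<le> F t" by simp
  qed
  have F1: "F t = F 1" if "t \<ge> 1" for t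
  proof (rule antisym)
    show "F 1 \<le> F t" using mF that by simp
    have "- F 1 \<le> - F t"
    proof (rule DERIV_nonneg_imp_nondecreasing[OF that, where f = "\<lambda>x. - F x"])
      fix x :: real assume "1 \<le> x" "x \<le> t"
      then have "b x = 0" by (simp add: b_def bump_def)
      then show "\<exists>y. ((\<lambda>x. - F x) has_real_derivative y) (at x) \<and> 0 \<le> y"
        using DERIV_minus[OF F[of x]] by (intro exI[of _ 0]) simp
    qed
    then show "F t \<le> F 1" by simp
  qed
  define c where "c = F 1 - F 0"
  have c: "c > 0" using F01 by (simp add: c_def)
  define S where "S = (\<lambda>t. (F t - F 0) / c)"
  have S: "(S has_real_derivative bump [:1 / c:] 0 t) (at t)" for t
  proof -
    have "((\<lambda>t. (F t - F 0) / c) has_real_derivative b t / c) (at t)"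
      using c by (auto intro!: derivative_eq_intros F)
    moreover have "b t / c = bump [:1 / c:] 0 t" by (simp add: b_def bump_def)
    ultimately show ?thesis by (simp add: S_def)
  qed
  then have dS: "deriv S = bump [:1 / c:] 0" by (auto intro: DERIV_imp_deriv)
  have smS: "smooth S"
  proof (rule smooth_coinduct[where X = "\<lambda>h. h = S \<or> smooth h"])
    fix h assume "h = S \<or> smooth h"
    then show "\<exists>g. (g = S \<or> smooth g) \<and> (\<forall>x. (h has_real_derivative g x) (at x))"
      using S smooth_bump smooth_has_deriv smooth_deriv by blast
  qed simp
  have mS: "mono S" unfolding S_def using c mF by (intro monoI divide_right_mono) auto
  show ?thesis
  proof (rule that[OF smS _ _ mS])
    show "S t = 0" if "t \<le> 0" for t using F0[OF that] by (simp add: S_def)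
    show "S t = 1" if "t \<ge> 1" for t unfolding S_def F1[OF that] using c by (simp add: c_def)
    show "deriv S t \<ge> 0" for t unfolding dS using c by (simp add: bump_def)
    show "deriv S t = 0" if "t \<notin> {0..1}" for t unfolding dS using that by (auto simp: bump_def)
  qed
qed

text \<open>The positive and the negative part are densities of two finite measures that agree on all
  half-lines, so the measures coincide, and densities are unique almost everywhere.\<close>

lemma AE_zero_of_tail_integrals:
  fixes u :: "real \<Rightarrow> real"
  assumes u: "integrable lborel u" and tail: "\<And>x. (LINT t|lborel. u t * indicator {x<..} t) = 0"
  shows "AE t in lborel. u t = 0"
proof -
  have [measurable]: "u \<in> borel_measurable borel" using u by simp
  have fin: "(\<integral>\<^sup>+t. ennreal (u t * indicator {x<..} t) \<partial>lborel) < \<infinity>" "(\<integral>\<^sup>+t. ennreal (- (u t * indicator {x<..} t)) \<partial>lborel) < \<infinity>" for x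
  proof -
    have "integrable lborel (\<lambda>t. u t * indicator {x<..} t)" using u by (intro integrable_real_mult_indicator) auto
    then show "(\<integral>\<^sup>+t. ennreal (u t * indicator {x<..} t) \<partial>lborel) < \<infinity>" "(\<integral>\<^sup>+t. ennreal (- (u t * indicator {x<..} t)) \<partial>lborel) < \<infinity>"
      by (auto simp: real_integrable_def top.not_eq_extremum)
  qed
  have eq: "(\<integral>\<^sup>+t. ennreal (u t * indicator {x<..} t) \<partial>lborel) = (\<integral>\<^sup>+t. ennreal (- (u t * indicator {x<..} t)) \<partial>lborel)" for x
  proof -
    have "integrable lborel (\<lambda>t. u t * indicator {x<..} t)" using u by (intro integrable_real_mult_indicator) auto
    then have "enn2real (\<integral>\<^sup>+t. ennreal (u t * indicator {x<..} t) \<partial>lborel) = enn2real (\<integral>\<^sup>+t. ennreal (- (u t * indicator {x<..} t)) \<partial>lborel)"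
      using tail[of x] by (simp add: real_lebesgue_integral_def)
    then show ?thesis using fin[of x] by (metis ennreal_enn2real infinity_ennreal_def)
  qed
  have em: "emeasure (density lborel (\<lambda>t. ennreal (v t))) {x<..} = (\<integral>\<^sup>+t. ennreal (v t * indicator {x<..} t) \<partial>lborel)"
    if [measurable]: "v \<in> borel_measurable borel" for v :: "real \<Rightarrow> real" and x
    by (subst emeasure_density) (auto intro!: nn_integral_cong split: split_indicator)
  have "density lborel (\<lambda>t. ennreal (u t)) = density lborel (\<lambda>t. ennreal (- u t))"
    by (rule measure_eqI_lessThan) (use fin eq in \<open>simp_all add: em\<close>)
  then have "AE t in lborel. ennreal (u t) = ennreal (- u t)"
    by (subst (asm) sigma_finite_measure.density_unique_iff[OF sigma_finite_lborel]) auto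
  then show ?thesis
  proof eventually_elim
    case (elim t)
    show ?case
    proof (cases "u t \<ge> 0")
      case True
      then have "ennreal (u t) = 0" using elim by (simp add: ennreal_neg)
      then show ?thesis using True by simp
    next
      case False
      then have "ennreal (- u t) = 0" using elim by (simp add: ennreal_neg)
      then show ?thesis using False by simp
    qed
  qed
qed

definition smooth_step :: "real \<Rightarrow> real" where
  "smooth_step = (SOME S. smooth S \<and> (\<forall>t\<le>0. S t = 0) \<and> (\<forall>t\<ge>1. S t = 1) \<and> mono S \<and> (\<forall>t. deriv S t \<ge> 0) \<and> (\<forall>t. t \<notin> {0..1} \<longrightarrow> deriv S t = 0))"

lemma smooth_step_props:
  "smooth smooth_step" "\<And>t. t \<le> 0 \<Longrightarrow> smooth_step t = 0" "\<And>t. t \<ge> 1 \<Longrightarrow> smooth_step t = 1"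
  "mono smooth_step" "\<And>t. deriv smooth_step t \<ge> 0" "\<And>t. t \<notin> {0..1} \<Longrightarrow> deriv smooth_step t = 0"
proof -
  have "\<exists>S. smooth S \<and> (\<forall>t\<le>0. S t = 0) \<and> (\<forall>t\<ge>1. S t = 1) \<and> mono S \<and> (\<forall>t. deriv S t \<ge> 0) \<and> (\<forall>t. t \<notin> {0..1} \<longrightarrow> deriv S t = 0)"
    using smooth_step_exists by metis
  then have "smooth smooth_step \<and> (\<forall>t\<le>0. smooth_step t = 0) \<and> (\<forall>t\<ge>1. smooth_step t = 1) \<and> mono smooth_step \<and> (\<forall>t. deriv smooth_step t \<ge> 0) \<and> (\<forall>t. t \<notin> {0..1} \<longrightarrow> deriv smooth_step t = 0)"
    unfolding smooth_step_def by (rule someI_ex)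
  then show "smooth smooth_step" "\<And>t. t \<le> 0 \<Longrightarrow> smooth_step t = 0" "\<And>t. t \<ge> 1 \<Longrightarrow> smooth_step t = 1"
    "mono smooth_step" "\<And>t. deriv smooth_step t \<ge> 0" "\<And>t. t \<notin> {0..1} \<Longrightarrow> deriv smooth_step t = 0"
    by blast+
qed

lemma smooth_step_range: "0 \<le> smooth_step t" "smooth_step t \<le> 1"
proof -
  have "smooth_step (min t 0) \<le> smooth_step t" "smooth_step t \<le> smooth_step (max t 1)"
    by (rule monoD[OF smooth_step_props(4)]; simp)+
  moreover have "smooth_step (min t 0) = 0" "smooth_step (max t 1) = 1"
    by (rule smooth_step_props; simp)+
  ultimately show "0 \<le> smooth_step t" "smooth_step t \<le> 1" by simp_all
qed

lemma smooth_measurable: "smooth f \<Longrightarrow> f \<in> borel_measurable borel"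
  by (intro borel_measurable_continuous_onI continuous_at_imp_continuous_on ballI DERIV_isCont[OF smooth_has_deriv])

lemma smooth_step_measurable [measurable]: "smooth_step \<in> borel_measurable borel" "deriv smooth_step \<in> borel_measurable borel"
  by (intro smooth_measurable smooth_deriv smooth_step_props)+

lemma smooth_step_mass:
  "integrable lborel (deriv smooth_step)" "(LINT t|lborel. deriv smooth_step t) = 1"
proof -
  have "has_bochner_integral lborel (\<lambda>x. deriv smooth_step x * indicator {0..1} x) (smooth_step 1 - smooth_step 0)"
    by (rule has_bochner_integral_FTC_Icc_nonneg)
       (auto intro: smooth_step_props(5) smooth_has_deriv[OF smooth_step_props(1)])
  moreover have "(\<lambda>x. deriv smooth_step x * indicator {0..1} x) = deriv smooth_step"
    using smooth_step_props(6) by (auto simp: fun_eq_iff split: split_indicator)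
  ultimately have "has_bochner_integral lborel (deriv smooth_step) 1"
    using smooth_step_props(2)[of 0] smooth_step_props(3)[of 1] by simp
  then show "integrable lborel (deriv smooth_step)" "(LINT t|lborel. deriv smooth_step t) = 1"
    by (auto simp: has_bochner_integral_iff)
qed

text \<open>A smooth version of the indicator of \<open>[x, y]\<close>, rising on \<open>[x, x + \<epsilon>]\<close> and falling on
  \<open>[y, y + \<epsilon>]\<close>. Its derivative is a difference of two probability densities concentrated near \<open>x\<close>
  and near \<open>y\<close>.\<close>

definition smooth_box :: "real \<Rightarrow> real \<Rightarrow> real \<Rightarrow> real \<Rightarrow> real" where
  "smooth_box x y \<epsilon> t = smooth_step ((t - x) / \<epsilon>) - smooth_step ((t - y) / \<epsilon>)"

lemma test_function_iff: "test_function h \<longleftrightarrow> smooth h \<and> (\<exists>R. \<forall>x. \<bar>x\<bar> > R \<longrightarrow> h x = 0)"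
  by (simp add: test_function_def smooth_def)

lemma smooth_rescaled_step: "smooth (\<lambda>t. smooth_step ((t - x) / \<epsilon>))"
proof -
  have "smooth (\<lambda>t. smooth_step ((1 / \<epsilon>) * t + (- x / \<epsilon>)))" by (rule smooth_affine[OF smooth_step_props(1)])
  then show ?thesis by (simp add: diff_divide_distrib)
qed

context
  fixes x y \<epsilon> :: real assumes xy: "x \<le> y" and \<epsilon>: "\<epsilon> > 0"
begin

lemma smooth_box_outside: "t \<notin> {x..y + \<epsilon>} \<Longrightarrow> smooth_box x y \<epsilon> t = 0"
proof -
  assume "t \<notin> {x..y + \<epsilon>}"
  then consider "t < x" | "t > y + \<epsilon>" by fastforce
  then show ?thesis
  proof cases
    case 1
    then have "(t - x) / \<epsilon> \<le> 0" "(t - y) / \<epsilon> \<le> 0" using xy \<epsilon> by (auto simp: divide_le_0_iff)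
    then show ?thesis by (simp add: smooth_box_def smooth_step_props)
  next
    case 2
    then have "(t - x) / \<epsilon> \<ge> 1" "(t - y) / \<epsilon> \<ge> 1" using xy \<epsilon> by (auto simp: pos_le_divide_eq)
    then show ?thesis by (simp add: smooth_box_def smooth_step_props)
  qed
qed

lemma smooth_box_range: "0 \<le> smooth_box x y \<epsilon> t" "smooth_box x y \<epsilon> t \<le> 1"
proof -
  have "(t - y) / \<epsilon> \<le> (t - x) / \<epsilon>" using xy \<epsilon> by (intro divide_right_mono) auto
  then have "smooth_step ((t - y) / \<epsilon>) \<le> smooth_step ((t - x) / \<epsilon>)" using smooth_step_props(4) by (rule monoD[rotated])
  then show "0 \<le> smooth_box x y \<epsilon> t" "smooth_box x y \<epsilon> t \<le> 1"
    using smooth_step_range[of "(t - x) / \<epsilon>"] smooth_step_range[of "(t - y) / \<epsilon>"] by (auto simp: smooth_box_def)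
qed

lemma smooth_box_test: "test_function (smooth_box x y \<epsilon>)"
  unfolding test_function_iff
proof
  show "smooth (smooth_box x y \<epsilon>)"
    unfolding smooth_box_def[abs_def] by (intro smooth_diff smooth_rescaled_step)
  have "\<forall>t. \<bar>t\<bar> > \<bar>x\<bar> + \<bar>y\<bar> + \<epsilon> \<longrightarrow> smooth_box x y \<epsilon> t = 0"
    using \<epsilon> by (intro allI impI smooth_box_outside) auto
  then show "\<exists>R. \<forall>t. \<bar>t\<bar> > R \<longrightarrow> smooth_box x y \<epsilon> t = 0" by blast
qed

lemma smooth_box_measurable [measurable]: "smooth_box x y \<epsilon> \<in> borel_measurable borel"
  unfolding smooth_box_def[abs_def] by measurable

lemma smooth_box_le_indicator: "\<bar>smooth_box x y \<epsilon> t\<bar> \<le> indicator {x..y + \<epsilon>} t"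
  using smooth_box_range[of t] smooth_box_outside[of t] by (auto split: split_indicator)

lemma smooth_box_L1: "integrable lborel (smooth_box x y \<epsilon>)" "(LINT t|lborel. \<bar>smooth_box x y \<epsilon> t\<bar>) \<le> y - x + \<epsilon>"
proof -
  have i: "integrable lborel (indicator {x..y + \<epsilon>} :: real \<Rightarrow> real)" using xy \<epsilon> by (intro integrable_real_indicator) (auto simp: emeasure_lborel_Icc_eq)
  show int: "integrable lborel (smooth_box x y \<epsilon>)"
    by (rule Bochner_Integration.integrable_bound[OF i]) (use smooth_box_le_indicator in \<open>auto intro!: AE_I2\<close>)
  have "(LINT t|lborel. \<bar>smooth_box x y \<epsilon> t\<bar>) \<le> (LINT t|lborel. indicator {x..y + \<epsilon>} t)"
    by (rule integral_mono) (use int i smooth_box_le_indicator in auto)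
  also have "\<dots> = y - x + \<epsilon>" using xy \<epsilon> by simp
  finally show "(LINT t|lborel. \<bar>smooth_box x y \<epsilon> t\<bar>) \<le> y - x + \<epsilon>" .
qed

lemma deriv_smooth_box: "deriv (smooth_box x y \<epsilon>) t = (deriv smooth_step ((t - x) / \<epsilon>) - deriv smooth_step ((t - y) / \<epsilon>)) / \<epsilon>"
proof -
  have *: "((\<lambda>t. smooth_step ((t - z) / \<epsilon>)) has_real_derivative deriv smooth_step ((t - z) / \<epsilon>) * (1 / \<epsilon>)) (at t)" for z
    by (rule DERIV_chain'[where f = "\<lambda>t. (t - z) / \<epsilon>", OF _ smooth_has_deriv[OF smooth_step_props(1)]])
       (use \<epsilon> in \<open>auto intro!: derivative_eq_intros\<close>)
  have "(smooth_box x y \<epsilon> has_real_derivative deriv smooth_step ((t - x) / \<epsilon>) * (1 / \<epsilon>) - deriv smooth_step ((t - y) / \<epsilon>) * (1 / \<epsilon>)) (at t)"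
    unfolding smooth_box_def[abs_def] by (intro DERIV_diff *)
  then show ?thesis by (simp add: DERIV_imp_deriv diff_divide_distrib)
qed

lemma rescaled_step_integral:
  fixes F :: "real \<Rightarrow> real"
  shows "(LINT t|lborel. F t * deriv smooth_step ((t - z) / \<epsilon>) / \<epsilon>) = (LINT s|lborel. F (z + \<epsilon> * s) * deriv smooth_step s)"
    and "integrable lborel (\<lambda>t. deriv smooth_step ((t - z) / \<epsilon>))"
proof -
  have "(LINT t|lborel. F t * deriv smooth_step ((t - z) / \<epsilon>) / \<epsilon>) = \<bar>\<epsilon>\<bar> *\<^sub>R (LINT s|lborel. F (z + \<epsilon> * s) * deriv smooth_step ((z + \<epsilon> * s - z) / \<epsilon>) / \<epsilon>)"
    using \<epsilon> by (intro lborel_integral_real_affine) auto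
  also have "\<dots> = (LINT s|lborel. F (z + \<epsilon> * s) * deriv smooth_step s)"
    using \<epsilon> by simp
  finally show "(LINT t|lborel. F t * deriv smooth_step ((t - z) / \<epsilon>) / \<epsilon>) = (LINT s|lborel. F (z + \<epsilon> * s) * deriv smooth_step s)" .
  have "integrable lborel (\<lambda>t. deriv smooth_step (- z / \<epsilon> + (1 / \<epsilon>) * t))"
    using \<epsilon> by (intro lborel_integrable_real_affine smooth_step_mass) auto
  then show "integrable lborel (\<lambda>t. deriv smooth_step ((t - z) / \<epsilon>))"
    by (simp add: diff_divide_distrib add.commute)
qed

lemma deriv_smooth_box_L1: "integrable lborel (deriv (smooth_box x y \<epsilon>))" "(LINT t|lborel. \<bar>deriv (smooth_box x y \<epsilon>) t\<bar>) \<le> 2"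
proof -
  have i: "integrable lborel (\<lambda>t. deriv smooth_step ((t - z) / \<epsilon>) / \<epsilon>)" for z
    using rescaled_step_integral(2)[of z] by (rule integrable_divide_zero)
  have db: "deriv (smooth_box x y \<epsilon>) = (\<lambda>t. deriv smooth_step ((t - x) / \<epsilon>) / \<epsilon> - deriv smooth_step ((t - y) / \<epsilon>) / \<epsilon>)"
    by (simp add: fun_eq_iff deriv_smooth_box diff_divide_distrib)
  show int: "integrable lborel (deriv (smooth_box x y \<epsilon>))"
    unfolding db by (intro Bochner_Integration.integrable_diff i)
  have m: "(LINT t|lborel. deriv smooth_step ((t - z) / \<epsilon>) / \<epsilon>) = 1" for z
    using rescaled_step_integral(1)[of "\<lambda>_. 1" z] smooth_step_mass(2) by simp
  have "(LINT t|lborel. \<bar>deriv (smooth_box x y \<epsilon>) t\<bar>) \<le> (LINT t|lborel. deriv smooth_step ((t - x) / \<epsilon>) / \<epsilon> + deriv smooth_step ((t - y) / \<epsilon>) / \<epsilon>)"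
  proof (rule integral_mono)
    show "integrable lborel (\<lambda>t. \<bar>deriv (smooth_box x y \<epsilon>) t\<bar>)" using int by simp
    show "integrable lborel (\<lambda>t. deriv smooth_step ((t - x) / \<epsilon>) / \<epsilon> + deriv smooth_step ((t - y) / \<epsilon>) / \<epsilon>)"
      by (intro Bochner_Integration.integrable_add i)
    show "\<bar>deriv (smooth_box x y \<epsilon>) t\<bar> \<le> deriv smooth_step ((t - x) / \<epsilon>) / \<epsilon> + deriv smooth_step ((t - y) / \<epsilon>) / \<epsilon>" for t
    proof -
      have "0 \<le> deriv smooth_step ((t - x) / \<epsilon>) / \<epsilon>" "0 \<le> deriv smooth_step ((t - y) / \<epsilon>) / \<epsilon>"
        using \<epsilon> smooth_step_props(5) by (simp_all add: divide_nonneg_pos)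
      then show ?thesis unfolding db by linarith
    qed
  qed
  also have "\<dots> = 2" using i m by simp
  finally show "(LINT t|lborel. \<bar>deriv (smooth_box x y \<epsilon>) t\<bar>) \<le> 2" .
qed

lemma deriv_smooth_box_measurable [measurable]: "deriv (smooth_box x y \<epsilon>) \<in> borel_measurable borel"
  using deriv_smooth_box_L1(1) by simp

lemma deriv_smooth_box_bounded: "\<exists>B. \<forall>t. \<bar>deriv (smooth_box x y \<epsilon>) t\<bar> \<le> B"
proof -
  have "continuous_on {0..1} (deriv smooth_step)"
    by (intro continuous_at_imp_continuous_on ballI DERIV_isCont[OF smooth_has_deriv[OF smooth_deriv[OF smooth_step_props(1)]]])
  then have "bounded (deriv smooth_step ` {0..1})"
    by (intro compact_imp_bounded compact_continuous_image) auto
  then obtain C where C: "\<forall>z\<in>deriv smooth_step ` {0..1}. norm z \<le> C" unfolding bounded_iff by blast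
  have C': "\<bar>deriv smooth_step t\<bar> \<le> max C 0" for t
    using C smooth_step_props(6)[of t] by (cases "t \<in> {0..1}") force+
  have "\<bar>deriv (smooth_box x y \<epsilon>) t\<bar> \<le> (max C 0 + max C 0) / \<epsilon>" for t
    unfolding deriv_smooth_box abs_divide using \<epsilon> C'[of "(t - x) / \<epsilon>"] C'[of "(t - y) / \<epsilon>"]
    by (simp add: divide_right_mono)
  then show ?thesis by blast
qed

end

text \<open>Both densities in the derivative of the box shrink to point masses. Hence increments of a
  continuous function can be computed from its pairings with derivatives of test functions, which
  is all that weak derivatives and $L^2$ expansions provide.\<close>

lemma deriv_smooth_box_limit:
  fixes f :: "real \<Rightarrow> real"
  assumes f: "continuous_on UNIV f" "bounded (range f)" and xy: "x \<le> y"
    and \<epsilon>: "\<And>n. \<epsilon> n > 0" "\<epsilon> \<longlonglongrightarrow> 0"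
  shows "(\<lambda>n. LINT t|lborel. f t * deriv (smooth_box x y (\<epsilon> n)) t) \<longlonglongrightarrow> f x - f y"
proof -
  have [measurable]: "f \<in> borel_measurable borel" using f(1) by (rule borel_measurable_continuous_onI)
  obtain B where B: "\<And>t. \<bar>f t\<bar> \<le> B" using f(2) unfolding bounded_iff by auto
  have int: "integrable lborel (\<lambda>t. f t * k t)" if "integrable lborel k" for k :: "real \<Rightarrow> real"
  proof (rule Bochner_Integration.integrable_bound[of _ "\<lambda>t. B * k t"])
    have [measurable]: "k \<in> borel_measurable borel" using that by simp
    show "(\<lambda>t. f t * k t) \<in> borel_measurable lborel" by measurable
    show "AE t in lborel. norm (f t * k t) \<le> norm (B * k t)"
      using B by (intro AE_I2) (auto simp: abs_mult intro!: mult_right_mono order_trans[OF B abs_ge_self])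
  qed (use that in simp)
  have conv: "(\<lambda>n. LINT s|lborel. f (z + \<epsilon> n * s) * deriv smooth_step s) \<longlonglongrightarrow> f z" for z
  proof -
    have "(\<lambda>n. LINT s|lborel. f (z + \<epsilon> n * s) * deriv smooth_step s) \<longlonglongrightarrow> (LINT s|lborel. f z * deriv smooth_step s)"
    proof (rule integral_dominated_convergence[where w = "\<lambda>s. B * deriv smooth_step s"])
      show "AE s in lborel. (\<lambda>n. f (z + \<epsilon> n * s) * deriv smooth_step s) \<longlonglongrightarrow> f z * deriv smooth_step s"
      proof (intro AE_I2 tendsto_mult tendsto_const)
        fix s
        have "(\<lambda>n. z + \<epsilon> n * s) \<longlonglongrightarrow> z + 0 * s" by (intro tendsto_intros \<epsilon>)
        then have lim: "(\<lambda>n. z + \<epsilon> n * s) \<longlonglongrightarrow> z" by simp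
        have "isCont f z" using f(1) by (simp add: continuous_on_eq_continuous_at)
        from isCont_tendsto_compose[OF this lim] show "(\<lambda>n. f (z + \<epsilon> n * s)) \<longlonglongrightarrow> f z" .
      qed
      show "integrable lborel (\<lambda>s. B * deriv smooth_step s)" using smooth_step_mass(1) by simp
      show "AE s in lborel. norm (f (z + \<epsilon> n * s) * deriv smooth_step s) \<le> B * deriv smooth_step s" for n
        using B smooth_step_props(5) by (intro AE_I2) (auto simp: abs_mult intro!: mult_right_mono)
    qed simp_all
    then show ?thesis using smooth_step_mass(2) by simp
  qed
  have "(LINT t|lborel. f t * deriv (smooth_box x y (\<epsilon> n)) t) =
     (LINT s|lborel. f (x + \<epsilon> n * s) * deriv smooth_step s) - (LINT s|lborel. f (y + \<epsilon> n * s) * deriv smooth_step s)" for n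
  proof -
    have i: "integrable lborel (\<lambda>t. f t * (deriv smooth_step ((t - z) / \<epsilon> n) / \<epsilon> n))" for z
      by (intro int integrable_divide_zero rescaled_step_integral(2)[OF order_refl[of 0] \<epsilon>(1)])
    have "(LINT t|lborel. f t * deriv (smooth_box x y (\<epsilon> n)) t) =
      (LINT t|lborel. f t * (deriv smooth_step ((t - x) / \<epsilon> n) / \<epsilon> n) - f t * (deriv smooth_step ((t - y) / \<epsilon> n) / \<epsilon> n))"
      by (intro Bochner_Integration.integral_cong refl) (simp add: deriv_smooth_box[OF xy \<epsilon>(1)] diff_divide_distrib right_diff_distrib)
    also have "\<dots> = (LINT t|lborel. f t * (deriv smooth_step ((t - x) / \<epsilon> n) / \<epsilon> n)) - (LINT t|lborel. f t * (deriv smooth_step ((t - y) / \<epsilon> n) / \<epsilon> n))"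
      by (intro Bochner_Integration.integral_diff i)
    finally show ?thesis using rescaled_step_integral(1)[OF order_refl[of 0] \<epsilon>(1)[of n], of f] by simp
  qed
  then show ?thesis using tendsto_diff[OF conv conv] by simp
qed

lemma locally_integrable_measurable:
  assumes "locally_integrable g" shows "g \<in> borel_measurable borel"
proof (rule borel_measurable_LIMSEQ_real)
  show "(\<lambda>t. indicator {- real n..real n} t * g t) \<in> borel_measurable borel" for n
    using assms[unfolded locally_integrable_def, rule_format, of "- real n" "real n"]
    unfolding set_integrable_def by (auto dest: borel_measurable_integrable)
  show "(\<lambda>n. indicator {- real n..real n} t * g t) \<longlonglongrightarrow> g t" for t
  proof (rule Lim_transform_eventually[OF tendsto_const])
    obtain N :: nat where N: "\<bar>t\<bar> \<le> real N" using real_arch_simple by blast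
    show "\<forall>\<^sub>F n in sequentially. g t = indicator {- real n..real n} t * g t"
      using eventually_ge_at_top[of N]
    proof eventually_elim
      case (elim n)
      then have "real N \<le> real n" by simp
      then have "t \<in> {- real n..real n}" using N by auto
      then show ?case by simp
    qed
  qed
qed

lemma locally_integrable_times:
  assumes g: "locally_integrable g" and [measurable]: "h \<in> borel_measurable borel"
    and h: "\<And>t. \<bar>h t\<bar> \<le> B * indicator {a..b} t"
  shows "integrable lborel (\<lambda>t. g t * h t)"
proof (rule Bochner_Integration.integrable_bound[of _ "\<lambda>t. B * (indicator {a..b} t * g t)"])
  have [measurable]: "g \<in> borel_measurable borel" using g by (rule locally_integrable_measurable)
  show "(\<lambda>t. g t * h t) \<in> borel_measurable lborel" by measurable
  have "set_integrable lborel {a..b} g" using g by (simp add: locally_integrable_def)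
  then show "integrable lborel (\<lambda>t. B * (indicator {a..b} t * g t))" by (simp add: set_integrable_def)
  show "AE t in lborel. norm (g t * h t) \<le> norm (B * (indicator {a..b} t * g t))"
  proof (rule AE_I2)
    fix t
    have "\<bar>g t\<bar> * \<bar>h t\<bar> \<le> \<bar>g t\<bar> * \<bar>B * indicator {a..b} t\<bar>"
      using h[of t] by (intro mult_left_mono) auto
    then show "norm (g t * h t) \<le> norm (B * (indicator {a..b} t * g t))" by (simp add: abs_mult mult_ac)
  qed
qed

text \<open>The fundamental lemma of the calculus of variations: smooth boxes with \<open>\<epsilon> \<rightarrow> 0\<close> converge
  to the indicator of \<open>{a<..b}\<close>, so the difference integrates to 0 over every interval. It transfers
  the almost everywhere decay of a weak derivative of order 0 to the function itself.\<close>

lemma weak_derivative_0_AE: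
  assumes w: "weak_derivative 0 f g"
  shows "AE t in lborel. f t = g t"
proof -
  define u where "u = (\<lambda>t. f t - g t)"
  have fg: "locally_integrable f" "locally_integrable g" using w by (auto simp: weak_derivative_def)
  have ul: "locally_integrable u"
    using fg unfolding locally_integrable_def u_def by (auto intro: set_integral_diff)
  have [measurable]: "u \<in> borel_measurable borel" using ul by (rule locally_integrable_measurable)
  have box0: "(LINT t|lborel. u t * smooth_box a b \<epsilon> t) = 0" if ab: "a \<le> b" and \<epsilon>: "\<epsilon> > 0" for a b \<epsilon>
  proof -
    have i: "integrable lborel (\<lambda>t. k t * smooth_box a b \<epsilon> t)" if "locally_integrable k" for k
      using smooth_box_le_indicator[OF ab \<epsilon>] by (intro locally_integrable_times[where B = 1 and a = a and b = "b + \<epsilon>"] that smooth_box_measurable[OF ab \<epsilon>]) simp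
    have "(LINT t|lborel. f t * smooth_box a b \<epsilon> t) = (LINT t|lborel. g t * smooth_box a b \<epsilon> t)"
      using w smooth_box_test[OF ab \<epsilon>] by (auto simp: weak_derivative_def)
    then show ?thesis
      using i[OF fg(1)] i[OF fg(2)] by (simp add: u_def left_diff_distrib)
  qed
  have int0: "(LINT t|lborel. u t * indicator {a<..b} t) = 0" if ab: "a \<le> b" for a b
  proof -
    have "(\<lambda>n. LINT t|lborel. u t * smooth_box a b (1 / real (Suc n)) t) \<longlonglongrightarrow> (LINT t|lborel. u t * indicator {a<..b} t)"
    proof (rule integral_dominated_convergence[where w = "\<lambda>t. \<bar>u t * indicator {a..b + 1} t\<bar>"])
      have "integrable lborel (\<lambda>t. u t * indicator {a..b + 1} t)"
        by (rule locally_integrable_times[OF ul, where B = 1 and a = a and b = "b + 1"]) auto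
      then show "integrable lborel (\<lambda>t. \<bar>u t * indicator {a..b + 1} t\<bar>)" by simp
      show "(\<lambda>t. u t * smooth_box a b (1 / real (Suc n)) t) \<in> borel_measurable lborel" for n
        using smooth_box_measurable[OF ab, of "1 / real (Suc n)"] by simp
      show "AE t in lborel. norm (u t * smooth_box a b (1 / real (Suc n)) t) \<le> \<bar>u t * indicator {a..b + 1} t\<bar>" for n
      proof (rule AE_I2)
        fix t
        have "\<bar>smooth_box a b (1 / real (Suc n)) t\<bar> \<le> indicator {a..b + 1 / real (Suc n)} t"
          by (rule smooth_box_le_indicator[OF ab]) simp
        also have "\<dots> \<le> indicator {a..b + 1} t"
        proof -
          have "1 / real (Suc n) \<le> 1" by simp
          then have "{a..b + 1 / real (Suc n)} \<subseteq> {a..b + 1}" by (simp del: of_nat_Suc)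
          then show ?thesis by (rule indicator_leI[OF subsetD])
        qed
        finally show "norm (u t * smooth_box a b (1 / real (Suc n)) t) \<le> \<bar>u t * indicator {a..b + 1} t\<bar>"
          by (auto simp: abs_mult intro!: mult_left_mono)
      qed
      have step: "(\<lambda>n. smooth_step ((t - z) / (1 / real (Suc n)))) \<longlonglongrightarrow> indicator {z<..} t" for t z
      proof (cases "t > z")
        case True
        obtain N :: nat where N: "1 / (t - z) \<le> real N" using real_arch_simple by blast
        have "\<forall>\<^sub>F n in sequentially. 1 = smooth_step ((t - z) / (1 / real (Suc n)))"
          using eventually_ge_at_top[of N]
        proof eventually_elim
          case (elim n)
          then have "1 / (t - z) \<le> real (Suc n)" using N by linarith
          then have "1 \<le> (t - z) / (1 / real (Suc n))" using True by (simp add: field_simps)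
          then show ?case by (simp add: smooth_step_props)
        qed
        then show ?thesis using True by (simp add: Lim_transform_eventually[OF tendsto_const])
      next
        case False
        then have "(t - z) * real (Suc n) \<le> 0" for n by (intro mult_nonpos_nonneg) auto
        then show ?thesis using False by (simp add: smooth_step_props del: of_nat_Suc)
      qed
      show "AE t in lborel. (\<lambda>n. u t * smooth_box a b (1 / real (Suc n)) t) \<longlonglongrightarrow> u t * indicator {a<..b} t"
      proof (rule AE_I2)
        fix t
        have "(\<lambda>n. u t * smooth_box a b (1 / real (Suc n)) t) \<longlonglongrightarrow> u t * (indicator {a<..} t - indicator {b<..} t)"
          unfolding smooth_box_def by (intro tendsto_intros step)
        also have "indicator {a<..} t - indicator {b<..} t = (indicator {a<..b} t :: real)" using ab by (auto split: split_indicator)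
        finally show "(\<lambda>n. u t * smooth_box a b (1 / real (Suc n)) t) \<longlonglongrightarrow> u t * indicator {a<..b} t" .
      qed
    qed simp_all
    moreover have "(\<lambda>n. LINT t|lborel. u t * smooth_box a b (1 / real (Suc n)) t) = (\<lambda>n. 0)"
      using box0[OF ab] by (simp add: fun_eq_iff)
    ultimately show ?thesis by (simp add: LIMSEQ_const_iff)
  qed
  have "AE t in lborel. u t * indicator {- real n<..real n} t = 0" for n :: nat
  proof (rule AE_zero_of_tail_integrals)
    show "integrable lborel (\<lambda>t. u t * indicator {- real n<..real n} t)"
      by (rule locally_integrable_times[OF ul, where B = 1 and a = "- real n" and b = "real n"]) (auto split: split_indicator)
    fix x
    \<comment> \<open>The half-line cuts the interval down to \<open>{m<..n}\<close>, possibly empty.\<close>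
    define m where "m = min (max x (- real n)) (real n)"
    have "(\<lambda>t. u t * indicator {- real n<..real n} t * indicator {x<..} t) = (\<lambda>t. u t * indicator {m<..real n} t)"
      by (auto simp: fun_eq_iff m_def split: split_indicator)
    then show "(LINT t|lborel. u t * indicator {- real n<..real n} t * indicator {x<..} t) = 0"
      using int0[of m "real n"] by (simp add: m_def)
  qed
  then have "AE t in lborel. \<forall>n::nat. u t * indicator {- real n<..real n} t = 0" unfolding AE_all_countable by blast
  then show ?thesis
  proof eventually_elim
    case (elim t)
    obtain n :: nat where "\<bar>t\<bar> < real n" using reals_Archimedean2 by blast
    then have "t \<in> {- real n<..real n}" by auto
    then show ?case using elim[rule_format, of n] by (simp add: u_def)
  qed
qed

section \<open>Orthonormal bases of $L^2$ and decaying translates\<close>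

definition inner_L2 :: "(real \<Rightarrow> real) \<Rightarrow> (real \<Rightarrow> real) \<Rightarrow> real" where
  "inner_L2 f g = (LINT x|lborel. f x * g x)"

lemma inner_L2_commute: "inner_L2 f g = inner_L2 g f"
  by (simp add: inner_L2_def mult.commute)

lemma L2_measurable: "f \<in> L2 \<Longrightarrow> f \<in> borel_measurable borel"
  by (simp add: L2_def)

lemma L2_square_integrable: "f \<in> L2 \<Longrightarrow> integrable lborel (\<lambda>x. (f x)\<^sup>2)"
  by (simp add: L2_def)

lemma L2_mult_integrable:
  assumes "f \<in> L2" "g \<in> L2" shows "integrable lborel (\<lambda>x. f x * g x)"
proof (rule Bochner_Integration.integrable_bound[of _ "\<lambda>x. (f x)\<^sup>2 + (g x)\<^sup>2"])
  have [measurable]: "f \<in> borel_measurable borel" "g \<in> borel_measurable borel" using assms by (auto simp: L2_def)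
  show "integrable lborel (\<lambda>x. (f x)\<^sup>2 + (g x)\<^sup>2)" using assms by (auto simp: L2_def)
  show "(\<lambda>x. f x * g x) \<in> borel_measurable lborel" by measurable
  show "AE x in lborel. norm (f x * g x) \<le> norm ((f x)\<^sup>2 + (g x)\<^sup>2)"
  proof (rule AE_I2)
    fix x
    have "0 \<le> (\<bar>f x\<bar> - \<bar>g x\<bar>)\<^sup>2" by simp
    then have "2 * (\<bar>f x\<bar> * \<bar>g x\<bar>) \<le> (f x)\<^sup>2 + (g x)\<^sup>2" by (simp add: power2_diff)
    moreover have "0 \<le> \<bar>f x\<bar> * \<bar>g x\<bar>" by simp
    ultimately show "norm (f x * g x) \<le> norm ((f x)\<^sup>2 + (g x)\<^sup>2)" unfolding real_norm_def abs_mult by linarith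
  qed
qed

lemma L2_diff: assumes "f \<in> L2" "g \<in> L2" shows "(\<lambda>x. f x - g x) \<in> L2"
proof -
  have "(\<lambda>x. (f x - g x)\<^sup>2) = (\<lambda>x. (f x)\<^sup>2 + (g x)\<^sup>2 - 2 * (f x * g x))" by (simp add: power2_diff fun_eq_iff mult.assoc)
  then show ?thesis using assms L2_mult_integrable[OF assms] by (auto simp: L2_def)
qed

lemma L2_cmult: "f \<in> L2 \<Longrightarrow> (\<lambda>x. c * f x) \<in> L2"
  by (auto simp: L2_def power_mult_distrib)

lemma L2_sum: "finite I \<Longrightarrow> (\<And>i. i \<in> I \<Longrightarrow> f i \<in> L2) \<Longrightarrow> (\<lambda>x. \<Sum>i\<in>I. f i x) \<in> L2"
proof (induction I rule: finite_induct)
  case (insert i I)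
  then have "(\<lambda>x. f i x - (-1) * (\<Sum>i\<in>I. f i x)) \<in> L2" by (intro L2_diff L2_cmult) auto
  then show ?case using insert by simp
qed (simp add: L2_def)

lemma inner_L2_diff: "f \<in> L2 \<Longrightarrow> g \<in> L2 \<Longrightarrow> h \<in> L2 \<Longrightarrow> inner_L2 (\<lambda>x. f x - g x) h = inner_L2 f h - inner_L2 g h"
  unfolding inner_L2_def by (simp add: left_diff_distrib L2_mult_integrable)

lemma inner_L2_cmult: "inner_L2 (\<lambda>x. c * f x) h = c * inner_L2 f h"
  unfolding inner_L2_def mult.assoc by (rule integral_mult_right_zero)

lemma inner_L2_sum: "(\<And>i. i \<in> I \<Longrightarrow> f i \<in> L2) \<Longrightarrow> h \<in> L2 \<Longrightarrow> inner_L2 (\<lambda>x. \<Sum>i\<in>I. c i * f i x) h = (\<Sum>i\<in>I. c i * inner_L2 (f i) h)"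
proof -
  assume *: "\<And>i. i \<in> I \<Longrightarrow> f i \<in> L2" "h \<in> L2"
  have "inner_L2 (\<lambda>x. \<Sum>i\<in>I. c i * f i x) h = (LINT x|lborel. (\<Sum>i\<in>I. c i * (f i x * h x)))"
    unfolding inner_L2_def by (simp add: sum_distrib_right mult.assoc)
  also have "\<dots> = (\<Sum>i\<in>I. c i * inner_L2 (f i) h)"
    unfolding inner_L2_def using * by (subst Bochner_Integration.integral_sum) (auto intro!: L2_mult_integrable)
  finally show ?thesis .
qed

lemma inner_L2_cauchy_schwarz:
  assumes f: "f \<in> L2" and g: "g \<in> L2"
  shows "(inner_L2 f g)\<^sup>2 \<le> inner_L2 f f * inner_L2 g g"
proof -
  have q: "0 \<le> inner_L2 f f - 2 * t * inner_L2 f g + t\<^sup>2 * inner_L2 g g" for t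
  proof -
    have "0 \<le> inner_L2 (\<lambda>x. f x - t * g x) (\<lambda>x. f x - t * g x)" unfolding inner_L2_def by (intro integral_nonneg_AE) auto
    also have "\<dots> = inner_L2 f (\<lambda>x. f x - t * g x) - inner_L2 (\<lambda>x. t * g x) (\<lambda>x. f x - t * g x)"
      by (intro inner_L2_diff L2_diff L2_cmult f g)
    also have "\<dots> = (inner_L2 f f - inner_L2 (\<lambda>x. t * g x) f) - (inner_L2 f (\<lambda>x. t * g x) - inner_L2 (\<lambda>x. t * g x) (\<lambda>x. t * g x))"
      unfolding inner_L2_commute[of f "\<lambda>x. f x - t * g x"] inner_L2_commute[of "\<lambda>x. t * g x" "\<lambda>x. f x - t * g x"]
      by (simp add: inner_L2_diff L2_cmult f g)
    finally show ?thesis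
      by (simp add: inner_L2_cmult inner_L2_commute[of f "\<lambda>x. t * g x"] inner_L2_commute[of g "\<lambda>x. t * g x"] inner_L2_commute[of g f] power2_eq_square)
  qed
  show ?thesis
  proof (cases "inner_L2 g g = 0")
    case True
    have "inner_L2 f g = 0"
    proof (rule ccontr)
      assume n: "inner_L2 f g \<noteq> 0"
      have "0 \<le> inner_L2 f f - 2 * ((inner_L2 f f + 1) / (2 * inner_L2 f g)) * inner_L2 f g" using q[of "(inner_L2 f f + 1) / (2 * inner_L2 f g)"] True by simp
      then show False using n by (simp add: field_simps)
    qed
    then show ?thesis using True by simp
  next
    case False
    have "inner_L2 g g \<ge> 0" unfolding inner_L2_def by (intro integral_nonneg_AE) auto
    then have gg: "inner_L2 g g > 0" using False by simp
    have "0 \<le> inner_L2 f f - 2 * (inner_L2 f g / inner_L2 g g) * inner_L2 f g + (inner_L2 f g / inner_L2 g g)\<^sup>2 * inner_L2 g g" by (rule q)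
    also have "\<dots> = inner_L2 f f - (inner_L2 f g)\<^sup>2 / inner_L2 g g" using gg by (simp add: power2_eq_square field_simps)
    finally show ?thesis using gg by (simp add: field_simps)
  qed
qed

text \<open>Cauchy-Schwarz turns convergence of the expansion in $L^2$ into convergence of its pairing
  with any \<open>k\<close> in $L^2$. Pairing with the basis itself identifies the coefficients.\<close>

theorem parseval:
  assumes e: "orthonormal_basis_L2 e" and f: "f \<in> L2" and h: "h \<in> L2"
  shows "((\<lambda>i. inner_L2 f (e i) * inner_L2 (e i) h) has_sum inner_L2 f h) UNIV"
proof -
  have eL: "e i \<in> L2" for i
    using e by (auto simp: orthonormal_basis_L2_def orthonormal_L2_def)
  have on: "inner_L2 (e i) (e j) = (if i = j then 1 else 0)" for i j
    using e by (auto simp: orthonormal_basis_L2_def orthonormal_L2_def inner_L2_def)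
  from e f have "f \<in> l2_combinations e" by (simp add: orthonormal_basis_L2_def)
  then obtain c where c: "((\<lambda>I. LINT x|lborel. (f x - (\<Sum>i\<in>I. c i * e i x))\<^sup>2) \<longlongrightarrow> 0) (finite_subsets_at_top UNIV)"
    by (auto simp: l2_combinations_def)
  have hs: "((\<lambda>i. c i * inner_L2 (e i) k) has_sum inner_L2 f k) UNIV" if k: "k \<in> L2" for k
  proof -
    define r where "r = (\<lambda>I x. f x - (\<Sum>i\<in>I. c i * e i x))"
    have rr: "inner_L2 (r I) (r I) = (LINT x|lborel. (f x - (\<Sum>i\<in>I. c i * e i x))\<^sup>2)" for I
      unfolding inner_L2_def r_def by (simp add: power2_eq_square)
    have rk: "inner_L2 (r I) k = inner_L2 f k - (\<Sum>i\<in>I. c i * inner_L2 (e i) k)" "(inner_L2 (r I) k)\<^sup>2 \<le> inner_L2 (r I) (r I) * inner_L2 k k" if "finite I" for I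
    proof -
      have s: "(\<lambda>x. \<Sum>i\<in>I. c i * e i x) \<in> L2" using that by (intro L2_sum L2_cmult eL)
      then have rI: "r I \<in> L2" unfolding r_def by (intro L2_diff f)
      show "inner_L2 (r I) k = inner_L2 f k - (\<Sum>i\<in>I. c i * inner_L2 (e i) k)"
        unfolding r_def by (simp add: inner_L2_diff[OF f s k] inner_L2_sum eL k)
      show "(inner_L2 (r I) k)\<^sup>2 \<le> inner_L2 (r I) (r I) * inner_L2 k k" by (rule inner_L2_cauchy_schwarz[OF rI k])
    qed
    have "((\<lambda>I. (inner_L2 (r I) k)\<^sup>2) \<longlongrightarrow> 0) (finite_subsets_at_top UNIV)"
    proof (rule tendsto_sandwich[OF _ _ tendsto_const])
      show "\<forall>\<^sub>F I in finite_subsets_at_top UNIV. (inner_L2 (r I) k)\<^sup>2 \<le> inner_L2 (r I) (r I) * inner_L2 k k"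
        using rk(2) by (intro eventually_finite_subsets_at_top_weakI) auto
      show "((\<lambda>I. inner_L2 (r I) (r I) * inner_L2 k k) \<longlongrightarrow> 0) (finite_subsets_at_top UNIV)"
        unfolding rr by (rule tendsto_mult_left_zero[OF c])
    qed auto
    from tendsto_real_sqrt[OF this] have "((\<lambda>I. \<bar>inner_L2 (r I) k\<bar>) \<longlongrightarrow> 0) (finite_subsets_at_top UNIV)" by simp
    then have "((\<lambda>I. inner_L2 (r I) k) \<longlongrightarrow> 0) (finite_subsets_at_top UNIV)"
      by (simp only: tendsto_rabs_zero_iff)
    then have "((\<lambda>I. inner_L2 f k - inner_L2 (r I) k) \<longlongrightarrow> inner_L2 f k - 0) (finite_subsets_at_top UNIV)" by (intro tendsto_intros)
    then have lim: "((\<lambda>I. inner_L2 f k - inner_L2 (r I) k) \<longlongrightarrow> inner_L2 f k) (finite_subsets_at_top UNIV)" by simp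
    have "\<forall>\<^sub>F I in finite_subsets_at_top UNIV. inner_L2 f k - inner_L2 (r I) k = (\<Sum>i\<in>I. c i * inner_L2 (e i) k)"
      using rk(1) by (intro eventually_finite_subsets_at_top_weakI) auto
    from Lim_transform_eventually[OF lim this] show ?thesis by (simp only: has_sum_def)
  qed
  have "inner_L2 f (e j) = c j" for j
  proof -
    have "((\<lambda>i. c i * inner_L2 (e i) (e j)) has_sum c j) UNIV"
      unfolding on by (rule has_sum_finite_neutralI[of "{j}"]) auto
    then show ?thesis using hs[OF eL, of j] has_sum_unique by blast
  qed
  then show ?thesis using hs[OF h] by simp
qed

text \<open>Replacing \<open>y\<close> by its integer part costs a factor $e^\gamma$ and leaves two geometric series.\<close>

lemma translate_decay_sum:
  assumes g: "\<gamma> > 0"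
  obtains M where "M > 0" "\<And>J y. finite J \<Longrightarrow> (\<Sum>j\<in>J. exp (- \<gamma> * \<bar>y - of_int j\<bar>)) \<le> (M :: real)"
proof -
  define q where "q = exp (- \<gamma>)"
  have q: "0 < q" "q < 1" using g by (auto simp: q_def)
  have geo: "(\<Sum>i\<in>A. q ^ i) \<le> 1 / (1 - q)" if "finite A" for A :: "nat set"
  proof -
    have "(\<Sum>i\<in>A. q ^ i) \<le> (\<Sum>i. q ^ i)"
      using q that by (intro sum_le_suminf summable_geometric) auto
    then show ?thesis using q by (simp add: suminf_geometric)
  qed
  have int: "(\<Sum>j\<in>J. q ^ nat \<bar>j\<bar>) \<le> 2 / (1 - q)" if J: "finite J" for J :: "int set"
  proof -
    have "(\<Sum>j\<in>J. q ^ nat \<bar>j\<bar>) = (\<Sum>j\<in>J \<inter> {0..}. q ^ nat \<bar>j\<bar>) + (\<Sum>j\<in>J - {0..}. q ^ nat \<bar>j\<bar>)"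
      by (rule sum.Int_Diff[OF J])
    also have "(\<Sum>j\<in>J \<inter> {0..}. q ^ nat \<bar>j\<bar>) = (\<Sum>i\<in>(\<lambda>j. nat \<bar>j\<bar>) ` (J \<inter> {0..}). q ^ i)"
      by (subst sum.reindex) (auto simp: inj_on_def)
    also have "(\<Sum>j\<in>J - {0..}. q ^ nat \<bar>j\<bar>) = (\<Sum>i\<in>(\<lambda>j. nat \<bar>j\<bar>) ` (J - {0..}). q ^ i)"
      by (subst sum.reindex) (auto simp: inj_on_def)
    finally have eq: "(\<Sum>j\<in>J. q ^ nat \<bar>j\<bar>) = (\<Sum>i\<in>(\<lambda>j. nat \<bar>j\<bar>) ` (J \<inter> {0..}). q ^ i) + (\<Sum>i\<in>(\<lambda>j. nat \<bar>j\<bar>) ` (J - {0..}). q ^ i)" .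
    have "\<dots> \<le> 1 / (1 - q) + 1 / (1 - q)" using J by (intro add_mono geo) auto
    then show ?thesis unfolding eq by simp
  qed
  have bound: "(\<Sum>j\<in>J. exp (- \<gamma> * \<bar>y - of_int j\<bar>)) \<le> exp \<gamma> * (2 / (1 - q))" if J: "finite J" for J y
  proof -
    have "(\<Sum>j\<in>J. exp (- \<gamma> * \<bar>y - of_int j\<bar>)) \<le> (\<Sum>j\<in>J. exp \<gamma> * q ^ nat \<bar>j - \<lfloor>y\<rfloor>\<bar>)"
    proof (rule sum_mono)
      fix j assume "j \<in> J"
      have "\<bar>of_int (j - \<lfloor>y\<rfloor>)\<bar> \<le> \<bar>y - of_int j\<bar> + 1" by linarith
      then have "\<gamma> * real (nat \<bar>j - \<lfloor>y\<rfloor>\<bar>) \<le> \<gamma> * (\<bar>y - of_int j\<bar> + 1)" using g by (intro mult_left_mono) auto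
      then have "- \<gamma> * \<bar>y - of_int j\<bar> \<le> \<gamma> + real (nat \<bar>j - \<lfloor>y\<rfloor>\<bar>) * (- \<gamma>)" by (simp add: algebra_simps)
      then have "exp (- \<gamma> * \<bar>y - of_int j\<bar>) \<le> exp (\<gamma> + real (nat \<bar>j - \<lfloor>y\<rfloor>\<bar>) * (- \<gamma>))" by simp
      also have "\<dots> = exp \<gamma> * q ^ nat \<bar>j - \<lfloor>y\<rfloor>\<bar>" unfolding exp_add q_def exp_of_nat_mult by simp
      finally show "exp (- \<gamma> * \<bar>y - of_int j\<bar>) \<le> exp \<gamma> * q ^ nat \<bar>j - \<lfloor>y\<rfloor>\<bar>" .
    qed
    also have "\<dots> = exp \<gamma> * (\<Sum>i\<in>(\<lambda>j. j - \<lfloor>y\<rfloor>) ` J. q ^ nat \<bar>i\<bar>)"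
      by (subst sum.reindex) (auto simp: inj_on_def sum_distrib_left)
    also have "\<dots> \<le> exp \<gamma> * (2 / (1 - q))" using J by (intro mult_left_mono int) auto
    finally show ?thesis .
  qed
  show ?thesis by (rule that[OF _ bound]) (use q in auto)
qed

section \<open>The modulus of continuity of the densities\<close>

text \<open>The unitary dilation of $L^2$ by $2^L$, and below its inverse. Wavelets and scaling functions of
  level \<open>L\<close> are dilated translates.\<close>

definition dilate :: "nat \<Rightarrow> (real \<Rightarrow> real) \<Rightarrow> real \<Rightarrow> real" where
  "dilate L f x = 2 powr (real L / 2) * f (2 ^ L * x)"

definition undilate :: "nat \<Rightarrow> (real \<Rightarrow> real) \<Rightarrow> real \<Rightarrow> real" where
  "undilate L f x = 2 powr (- real L / 2) * f (x / 2 ^ L)"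

lemma half_power_square: "2 powr (real L / 2) * 2 powr (real L / 2) = (2::real) ^ L"
  by (simp add: powr_add[symmetric] powr_realpow)

lemma dilate_undilate: "dilate L (undilate L h) = h"
  by (simp add: fun_eq_iff dilate_def undilate_def powr_minus)

lemma dilate_dilate: "dilate L (dilate K f) = dilate (L + K) f"
  by (simp add: fun_eq_iff dilate_def powr_add add_divide_distrib power_add mult_ac)

lemma inner_L2_dilate: "inner_L2 (dilate L f) (dilate L g) = inner_L2 f g"
proof -
  have "inner_L2 f g = \<bar>(2::real) ^ L\<bar> *\<^sub>R (LINT x|lborel. f (0 + 2 ^ L * x) * g (0 + 2 ^ L * x))"
    unfolding inner_L2_def by (rule lborel_integral_real_affine) simp
  also have "\<dots> = (LINT x|lborel. 2 ^ L * (f (2 ^ L * x) * g (2 ^ L * x)))" by simp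
  also have "\<dots> = inner_L2 (dilate L f) (dilate L g)"
    unfolding inner_L2_def dilate_def half_power_square[symmetric] by (simp add: mult_ac)
  finally show ?thesis by simp
qed

lemma inner_L2_dilate_left: "inner_L2 (dilate L f) h = inner_L2 f (undilate L h)"
  using inner_L2_dilate[of L f "undilate L h"] by (simp add: dilate_undilate)

lemma undilate_L2: "h \<in> L2 \<Longrightarrow> undilate L h \<in> L2"
proof -
  assume h: "h \<in> L2"
  have [measurable]: "h \<in> borel_measurable borel" using h by (rule L2_measurable)
  have "integrable lborel (\<lambda>x. (h (0 + (1 / 2 ^ L) * x))\<^sup>2)"
    by (rule lborel_integrable_real_affine[OF L2_square_integrable[OF h]]) simp
  then show ?thesis by (simp add: L2_def undilate_def[abs_def] power_mult_distrib)
qed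

lemma wavelet_dilates_eq: "wavelet_dilates \<psi> (l, k) = dilate l (translates \<psi> k)"
  by (simp add: fun_eq_iff wavelet_dilates_def dilate_def translates_def)

lemma inner_L2_translate: "inner_L2 (translates f k) (dilate 1 (translates g m)) = inner_L2 f (dilate 1 (translates g (m - 2 * k)))"
proof -
  have "inner_L2 (translates f k) (dilate 1 (translates g m)) = \<bar>1::real\<bar> *\<^sub>R (LINT x|lborel. translates f k (of_int k + 1 * x) * dilate 1 (translates g m) (of_int k + 1 * x))"
    unfolding inner_L2_def by (rule lborel_integral_real_affine) simp
  also have "\<dots> = inner_L2 f (dilate 1 (translates g (m - 2 * k)))"
    by (simp add: inner_L2_def translates_def dilate_def algebra_simps)
  finally show ?thesis .
qed

text \<open>A bound for $\sup_x \sum_m |g(x-m)|$ in integrated form. Testing against integrable \<open>w\<close> makes it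
  insensitive to null sets, which matters because exponential decay is only assumed almost everywhere.\<close>

definition decays :: "(real \<Rightarrow> real) \<Rightarrow> real \<Rightarrow> bool" where
  "decays g M \<longleftrightarrow> g \<in> borel_measurable borel \<and> M > 0 \<and>
     (\<forall>L w F. integrable lborel w \<longrightarrow> finite F \<longrightarrow>
        (\<Sum>m\<in>F. \<bar>inner_L2 (\<lambda>x. g (2 ^ L * x - of_int m)) w\<bar>) \<le> M * (LINT x|lborel. \<bar>w x\<bar>))"

lemma decays_exists:
  assumes [measurable]: "g \<in> borel_measurable borel" and dec: "exponentially_decaying g"
  obtains M where "decays g M"
proof -
  from dec obtain C \<gamma> where C: "C > 0" "\<gamma> > 0" "AE x in lborel. \<bar>g x\<bar> \<le> C * exp (- \<gamma> * \<bar>x\<bar>)"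
    by (auto simp: exponentially_decaying_def)
  obtain M where M: "M > 0" "\<And>J y. finite J \<Longrightarrow> (\<Sum>j\<in>J. exp (- \<gamma> * \<bar>y - of_int j\<bar>)) \<le> M"
    using translate_decay_sum[OF C(2)] by blast
  have "(\<Sum>m\<in>F. \<bar>inner_L2 (\<lambda>x. g (2 ^ L * x - of_int m)) w\<bar>) \<le> C * M * (LINT x|lborel. \<bar>w x\<bar>)"
    if w: "integrable lborel w" and F: "finite F" for L and w :: "real \<Rightarrow> real" and F :: "int set"
  proof -
    have [measurable]: "w \<in> borel_measurable borel" using w by simp
    have ae: "AE x in lborel. \<bar>g (2 ^ L * x - of_int m)\<bar> \<le> C * exp (- \<gamma> * \<bar>2 ^ L * x - of_int m\<bar>)" for m :: int
      using AE_borel_affine[of "2 ^ L" "\<lambda>x. \<bar>g x\<bar> \<le> C * exp (- \<gamma> * \<bar>x\<bar>)" "- of_int m"] C(3) by (simp add: algebra_simps)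
    have i: "integrable lborel (\<lambda>x. \<bar>g (2 ^ L * x - of_int m)\<bar> * \<bar>w x\<bar>)" for m :: int
    proof (rule Bochner_Integration.integrable_bound[of _ "\<lambda>x. C * w x"])
      show "AE x in lborel. norm (\<bar>g (2 ^ L * x - of_int m)\<bar> * \<bar>w x\<bar>) \<le> norm (C * w x)"
        using ae[of m]
      proof eventually_elim
        case (elim x)
        have "exp (- \<gamma> * \<bar>2 ^ L * x - of_int m\<bar>) \<le> 1" using C(2) by simp
        then have "C * exp (- \<gamma> * \<bar>2 ^ L * x - of_int m\<bar>) \<le> C * 1" using C(1) by (intro mult_left_mono) auto
        then have "\<bar>g (2 ^ L * x - of_int m)\<bar> \<le> C" using elim by linarith
        then have "\<bar>g (2 ^ L * x - of_int m)\<bar> * \<bar>w x\<bar> \<le> C * \<bar>w x\<bar>" by (intro mult_right_mono) auto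
        then show ?case using C(1) by (simp add: abs_mult)
      qed
    qed (use w in simp_all)
    have "(\<Sum>m\<in>F. \<bar>inner_L2 (\<lambda>x. g (2 ^ L * x - of_int m)) w\<bar>) \<le> (\<Sum>m\<in>F. LINT x|lborel. \<bar>g (2 ^ L * x - of_int m)\<bar> * \<bar>w x\<bar>)"
    proof (rule sum_mono)
      fix m
      show "\<bar>inner_L2 (\<lambda>x. g (2 ^ L * x - of_int m)) w\<bar> \<le> (LINT x|lborel. \<bar>g (2 ^ L * x - of_int m)\<bar> * \<bar>w x\<bar>)"
        unfolding inner_L2_def using integral_norm_bound[of lborel "\<lambda>x. g (2 ^ L * x - of_int m) * w x"] by (simp add: abs_mult)
    qed
    also have "\<dots> = (LINT x|lborel. (\<Sum>m\<in>F. \<bar>g (2 ^ L * x - of_int m)\<bar> * \<bar>w x\<bar>))"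
      by (rule Bochner_Integration.integral_sum[symmetric]) (rule i)
    also have "\<dots> \<le> (LINT x|lborel. C * M * \<bar>w x\<bar>)"
    proof (rule integral_mono_AE)
      show "integrable lborel (\<lambda>x. \<Sum>m\<in>F. \<bar>g (2 ^ L * x - of_int m)\<bar> * \<bar>w x\<bar>)" by (intro Bochner_Integration.integrable_sum i)
      show "integrable lborel (\<lambda>x. C * M * \<bar>w x\<bar>)" using w by simp
      have "AE x in lborel. \<forall>m\<in>F. \<bar>g (2 ^ L * x - of_int m)\<bar> \<le> C * exp (- \<gamma> * \<bar>2 ^ L * x - of_int m\<bar>)"
        using F ae by (simp add: AE_finite_all)
      then show "AE x in lborel. (\<Sum>m\<in>F. \<bar>g (2 ^ L * x - of_int m)\<bar> * \<bar>w x\<bar>) \<le> C * M * \<bar>w x\<bar>"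
      proof eventually_elim
        case (elim x)
        have "(\<Sum>m\<in>F. \<bar>g (2 ^ L * x - of_int m)\<bar>) \<le> (\<Sum>m\<in>F. C * exp (- \<gamma> * \<bar>2 ^ L * x - of_int m\<bar>))"
          using elim by (intro sum_mono) auto
        also have "\<dots> = C * (\<Sum>m\<in>F. exp (- \<gamma> * \<bar>2 ^ L * x - of_int m\<bar>))" by (simp add: sum_distrib_left)
        also have "\<dots> \<le> C * M" using C(1) M(2)[OF F] by (intro mult_left_mono) auto
        finally have "(\<Sum>m\<in>F. \<bar>g (2 ^ L * x - of_int m)\<bar>) * \<bar>w x\<bar> \<le> C * M * \<bar>w x\<bar>" by (intro mult_right_mono) auto
        then show ?case by (simp add: sum_distrib_right)
      qed
    qed
    finally show ?thesis by simp
  qed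
  then show ?thesis using C(1) M(1) by (intro that[of "C * M"]) (simp add: decays_def)
qed

lemma inner_L2_dilate_translate: "inner_L2 (dilate L (translates g m)) w = 2 powr (real L / 2) * inner_L2 (\<lambda>x. g (2 ^ L * x - of_int m)) w"
  unfolding inner_L2_def dilate_def translates_def mult.assoc by (rule integral_mult_right_zero)

lemma decays_sum_bound:
  assumes "decays g M" "integrable lborel w" "finite F"
  shows "(\<Sum>m\<in>F. \<bar>inner_L2 (dilate L (translates g m)) w\<bar>) \<le> 2 powr (real L / 2) * (M * (LINT x|lborel. \<bar>w x\<bar>))"
proof -
  have "(\<Sum>m\<in>F. \<bar>inner_L2 (dilate L (translates g m)) w\<bar>) = 2 powr (real L / 2) * (\<Sum>m\<in>F. \<bar>inner_L2 (\<lambda>x. g (2 ^ L * x - of_int m)) w\<bar>)"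
    by (simp add: inner_L2_dilate_translate abs_mult sum_distrib_left)
  also have "\<dots> \<le> 2 powr (real L / 2) * (M * (LINT x|lborel. \<bar>w x\<bar>))"
    using assms unfolding decays_def by (intro mult_left_mono) auto
  finally show ?thesis .
qed

text \<open>Integration by parts at level \<open>L\<close>: a test function rescaled to unit scale is again a test
  function, and its derivative picks up the factor $2^L$.\<close>

lemma weak_derivative_dilate:
  assumes wd: "weak_derivative 1 \<phi> g" and H: "test_function H"
  shows "inner_L2 (dilate L (translates \<phi> m)) (deriv H) = - (2 ^ L * inner_L2 (dilate L (translates g m)) H)"
proof -
  define c :: real where "c = 2 ^ L"
  have c: "c > 0" by (simp add: c_def)
  define G where "G = (\<lambda>y. H ((1 / c) * y + of_int m / c))"
  have H': "smooth H" using H by (simp add: test_function_iff)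
  obtain R where R: "\<And>x. \<bar>x\<bar> > R \<Longrightarrow> H x = 0" using H by (auto simp: test_function_iff)
  have "test_function G"
    unfolding test_function_iff
  proof
    show "smooth G" unfolding G_def by (rule smooth_affine[OF H'])
    have "G y = 0" if "\<bar>y\<bar> > c * R + \<bar>of_int m\<bar>" for y
    proof -
      have "c * R < \<bar>y + of_int m\<bar>" using that by linarith
      then have "R < \<bar>y + of_int m\<bar> / c" using c by (simp add: pos_less_divide_eq mult.commute)
      also have "\<dots> = \<bar>(1 / c) * y + of_int m / c\<bar>" using c by (simp add: add_divide_distrib[symmetric])
      finally show ?thesis unfolding G_def by (rule R)
    qed
    then show "\<exists>R. \<forall>x. \<bar>x\<bar> > R \<longrightarrow> G x = 0" by blast
  qed
  then have w: "(LINT y|lborel. \<phi> y * deriv G y) = - (LINT y|lborel. g y * G y)"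
    using wd by (simp add: weak_derivative_def)
  have dG: "deriv G y = deriv H ((1 / c) * y + of_int m / c) / c" for y
  proof -
    have "(G has_real_derivative deriv H ((1 / c) * y + of_int m / c) * (1 / c)) (at y)"
      unfolding G_def
      by (rule DERIV_chain'[where f = "\<lambda>y. (1 / c) * y + of_int m / c", OF _ smooth_has_deriv[OF H']])
         (use c in \<open>auto intro!: derivative_eq_intros\<close>)
    then show ?thesis by (simp add: DERIV_imp_deriv)
  qed
  have arg: "(1 / c) * (- of_int m + c * x) + of_int m / c = x" for x using c by (simp add: field_simps)
  have "(LINT y|lborel. \<phi> y * deriv G y) = \<bar>c\<bar> *\<^sub>R (LINT x|lborel. \<phi> (- of_int m + c * x) * deriv G (- of_int m + c * x))"
    using c by (intro lborel_integral_real_affine) auto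
  also have "\<dots> = (LINT x|lborel. \<phi> (c * x - of_int m) * deriv H x)"
    unfolding dG arg using c by simp
  finally have 1: "(LINT y|lborel. \<phi> y * deriv G y) = inner_L2 (\<lambda>x. \<phi> (c * x - of_int m)) (deriv H)" by (simp add: inner_L2_def)
  have "(LINT y|lborel. g y * G y) = \<bar>c\<bar> *\<^sub>R (LINT x|lborel. g (- of_int m + c * x) * G (- of_int m + c * x))"
    using c by (intro lborel_integral_real_affine) auto
  also have "\<dots> = c * inner_L2 (\<lambda>x. g (c * x - of_int m)) H"
    unfolding G_def arg inner_L2_def using c by simp
  finally have 2: "(LINT y|lborel. g y * G y) = c * inner_L2 (\<lambda>x. g (c * x - of_int m)) H" .
  show ?thesis unfolding inner_L2_dilate_translate using w 1 2 by (simp add: c_def)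
qed

context
  fixes \<phi> \<psi> :: "real \<Rightarrow> real"
  assumes basis: "orthonormal_basis_L2 (case_sum (translates \<phi>) (wavelet_dilates \<psi>))"
begin

lemma wavelet_L2: "wavelet_dilates \<psi> i \<in> L2" and wavelet_orthonormal: "inner_L2 (wavelet_dilates \<psi> i) (wavelet_dilates \<psi> j) = (if i = j then 1 else 0)"
proof -
  have *: "orthonormal_L2 (case_sum (translates \<phi>) (wavelet_dilates \<psi>))" using basis by (simp add: orthonormal_basis_L2_def)
  then have "case_sum (translates \<phi>) (wavelet_dilates \<psi>) (Inr i) \<in> L2" unfolding orthonormal_L2_def by blast
  then show "wavelet_dilates \<psi> i \<in> L2" by simp
  from * have "(LINT x|lborel. case_sum (translates \<phi>) (wavelet_dilates \<psi>) (Inr i) x * case_sum (translates \<phi>) (wavelet_dilates \<psi>) (Inr j) x)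
    = (if (Inr i :: int + nat \<times> int) = Inr j then 1 else 0)" unfolding orthonormal_L2_def by blast
  then show "inner_L2 (wavelet_dilates \<psi> i) (wavelet_dilates \<psi> j) = (if i = j then 1 else 0)" by (simp add: inner_L2_def)
qed

text \<open>Dilating the whole basis by $2^{l+1}$ gives an orthonormal basis made of the scaling functions
  of level \<open>l + 1\<close> and the wavelets of levels above \<open>l\<close>. A wavelet of level \<open>l\<close> is orthogonal to the
  latter, so its expansion in the dilated basis contains only scaling functions of level \<open>l + 1\<close>.
  By invariance the coefficients depend on \<open>m - 2 * k\<close> alone.\<close>

lemma detail_expansion:
  assumes h: "h \<in> L2"
  shows "((\<lambda>m. inner_L2 \<psi> (dilate 1 (translates \<phi> (m - 2 * k))) * inner_L2 (dilate (Suc l) (translates \<phi> m)) h) has_sum inner_L2 (wavelet_dilates \<psi> (l, k)) h) UNIV"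
proof -
  define e where "e = case_sum (translates \<phi>) (wavelet_dilates \<psi>)"
  have w0: "wavelet_dilates \<psi> (0, k) = translates \<psi> k" by (simp add: wavelet_dilates_eq fun_eq_iff dilate_def)
  define \<eta> where "\<eta> = undilate 1 (translates \<psi> k)"
  have d1: "dilate 1 \<eta> = translates \<psi> k" by (simp add: \<eta>_def dilate_undilate)
  have eta: "\<eta> \<in> L2" unfolding \<eta>_def using wavelet_L2[of "(0, k)"] by (intro undilate_L2) (simp add: w0)
  define h' where "h' = undilate (Suc l) h"
  have h': "h' \<in> L2" unfolding h'_def by (rule undilate_L2[OF h])
  have "((\<lambda>i. inner_L2 \<eta> (e i) * inner_L2 (e i) h') has_sum inner_L2 \<eta> h') UNIV"
    using basis eta h' unfolding e_def by (rule parseval)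
  moreover have "inner_L2 \<eta> (e (Inr (l', k'))) = 0" for l' k'
  proof -
    have "inner_L2 \<eta> (e (Inr (l', k'))) = inner_L2 (dilate 1 \<eta>) (dilate 1 (dilate l' (translates \<psi> k')))"
      by (simp add: inner_L2_dilate e_def wavelet_dilates_eq)
    also have "\<dots> = inner_L2 (wavelet_dilates \<psi> (0, k)) (wavelet_dilates \<psi> (Suc l', k'))"
      by (simp only: d1 w0 dilate_dilate wavelet_dilates_eq[of _ "Suc l'"] plus_1_eq_Suc)
    also have "\<dots> = 0" by (simp add: wavelet_orthonormal)
    finally show ?thesis .
  qed
  then have "inner_L2 \<eta> (e i) * inner_L2 (e i) h' = 0" if "i \<notin> range Inl" for i using that by (cases i) (auto simp: image_iff)
  then have "((\<lambda>i. inner_L2 \<eta> (e i) * inner_L2 (e i) h') has_sum inner_L2 \<eta> h') UNIV \<longleftrightarrow> ((\<lambda>i. inner_L2 \<eta> (e i) * inner_L2 (e i) h') has_sum inner_L2 \<eta> h') (range Inl)"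
    by (intro has_sum_cong_neutral) auto
  ultimately have "((\<lambda>i. inner_L2 \<eta> (e i) * inner_L2 (e i) h') \<circ> Inl has_sum inner_L2 \<eta> h') UNIV"
    by (subst has_sum_reindex[symmetric]) auto
  moreover have "inner_L2 \<eta> h' = inner_L2 (wavelet_dilates \<psi> (l, k)) h"
  proof -
    have "inner_L2 \<eta> h' = inner_L2 (dilate (Suc l) \<eta>) h" by (simp add: h'_def inner_L2_dilate_left)
    also have "dilate (Suc l) \<eta> = dilate l (dilate 1 \<eta>)" by (simp add: dilate_dilate)
    finally show ?thesis by (simp only: d1 wavelet_dilates_eq)
  qed
  moreover have "((\<lambda>i. inner_L2 \<eta> (e i) * inner_L2 (e i) h') \<circ> Inl) m = inner_L2 \<psi> (dilate 1 (translates \<phi> (m - 2 * k))) * inner_L2 (dilate (Suc l) (translates \<phi> m)) h" for m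
  proof -
    have "inner_L2 \<eta> (translates \<phi> m) = inner_L2 (dilate 1 \<eta>) (dilate 1 (translates \<phi> m))" by (simp add: inner_L2_dilate)
    also have "\<dots> = inner_L2 \<psi> (dilate 1 (translates \<phi> (m - 2 * k)))" unfolding d1 by (rule inner_L2_translate)
    finally show ?thesis by (simp add: e_def h'_def inner_L2_dilate_left)
  qed
  ultimately show ?thesis by (simp only: o_def)
qed

text \<open>The filter coefficients of \<open>\<psi>\<close> are summable as soon as \<open>\<psi>\<close> is integrable, so a convolution
  estimate passes bounds for scaling functions of level \<open>l + 1\<close> on to wavelets of level \<open>l\<close>.\<close>

lemma wavelet_sum_bound:
  assumes a: "\<And>F. finite F \<Longrightarrow> (\<Sum>m\<in>F. \<bar>inner_L2 \<psi> (dilate 1 (translates \<phi> m))\<bar>) \<le> A"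
    and h: "h \<in> L2" and B: "\<And>F. finite F \<Longrightarrow> (\<Sum>m\<in>F. \<bar>inner_L2 (dilate (Suc l) (translates \<phi> m)) h\<bar>) \<le> B"
    and F: "finite F"
  shows "(\<Sum>k\<in>F. \<bar>inner_L2 (wavelet_dilates \<psi> (l, k)) h\<bar>) \<le> A * B"
proof -
  define a' where "a' = (\<lambda>m. inner_L2 \<psi> (dilate 1 (translates \<phi> m)))"
  define b where "b = (\<lambda>m. inner_L2 (dilate (Suc l) (translates \<phi> m)) h)"
  have A0: "A \<ge> 0" using a[of "{}"] by simp
  have "((\<lambda>X. \<Sum>k\<in>F. \<bar>\<Sum>m\<in>X. a' (m - 2 * k) * b m\<bar>) \<longlongrightarrow> (\<Sum>k\<in>F. \<bar>inner_L2 (wavelet_dilates \<psi> (l, k)) h\<bar>)) (finite_subsets_at_top UNIV)"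
    using detail_expansion[OF h, of _ l] unfolding has_sum_def a'_def b_def by (intro tendsto_sum tendsto_rabs)
  then show ?thesis
  proof (rule tendsto_upperbound)
    show "\<forall>\<^sub>F X in finite_subsets_at_top UNIV. (\<Sum>k\<in>F. \<bar>\<Sum>m\<in>X. a' (m - 2 * k) * b m\<bar>) \<le> A * B"
    proof (rule eventually_finite_subsets_at_top_weakI)
      fix X :: "int set" assume X: "finite X"
      have "(\<Sum>k\<in>F. \<bar>\<Sum>m\<in>X. a' (m - 2 * k) * b m\<bar>) \<le> (\<Sum>k\<in>F. \<Sum>m\<in>X. \<bar>a' (m - 2 * k)\<bar> * \<bar>b m\<bar>)"
        by (intro sum_mono order_trans[OF sum_abs]) (simp add: abs_mult)
      also have "\<dots> = (\<Sum>m\<in>X. \<Sum>k\<in>F. \<bar>a' (m - 2 * k)\<bar> * \<bar>b m\<bar>)" by (rule sum.swap)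
      also have "\<dots> = (\<Sum>m\<in>X. (\<Sum>k\<in>F. \<bar>a' (m - 2 * k)\<bar>) * \<bar>b m\<bar>)" by (simp add: sum_distrib_right)
      also have "\<dots> \<le> (\<Sum>m\<in>X. A * \<bar>b m\<bar>)"
      proof (intro sum_mono mult_right_mono)
        fix m
        have "(\<Sum>k\<in>F. \<bar>a' (m - 2 * k)\<bar>) = (\<Sum>i\<in>(\<lambda>k. m - 2 * k) ` F. \<bar>a' i\<bar>)"
          by (subst sum.reindex) (auto simp: inj_on_def)
        also have "\<dots> \<le> A" unfolding a'_def using F by (intro a) auto
        finally show "(\<Sum>k\<in>F. \<bar>a' (m - 2 * k)\<bar>) \<le> A" .
      qed simp
      also have "\<dots> = A * (\<Sum>m\<in>X. \<bar>b m\<bar>)" by (simp add: sum_distrib_left)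
      also have "\<dots> \<le> A * B" using A0 B[OF X] by (intro mult_left_mono) (simp_all add: b_def)
      finally show "(\<Sum>k\<in>F. \<bar>\<Sum>m\<in>X. a' (m - 2 * k) * b m\<bar>) \<le> A * B" .
    qed
  qed simp
qed

end

lemma bounded_integrable_L2:
  assumes f: "integrable lborel f" and B: "\<And>x. \<bar>f x\<bar> \<le> B"
  shows "f \<in> L2"
proof -
  have [measurable]: "f \<in> borel_measurable borel" using f by simp
  have "integrable lborel (\<lambda>x. (f x)\<^sup>2)"
  proof (rule Bochner_Integration.integrable_bound[of _ "\<lambda>x. B * f x"])
    show "AE x in lborel. norm ((f x)\<^sup>2) \<le> norm (B * f x)"
    proof (rule AE_I2)
      fix x
      have "\<bar>f x\<bar> * \<bar>f x\<bar> \<le> \<bar>B\<bar> * \<bar>f x\<bar>" using B[of x] by (intro mult_right_mono) auto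
      then show "norm ((f x)\<^sup>2) \<le> norm (B * f x)" by (simp add: power2_eq_square abs_mult)
    qed
  qed (use f in simp_all)
  then show ?thesis by (simp add: L2_def)
qed

lemma wavelet_norm_coeffs:
  assumes "wavelet_norm \<phi> \<psi> \<alpha> f \<le> ennreal D" "D \<ge> 0"
  shows "\<bar>inner_L2 f (translates \<phi> k)\<bar> \<le> D"
    and "\<bar>inner_L2 f (wavelet_dilates \<psi> (l, k))\<bar> \<le> D * 2 powr (- (real l * (\<alpha> + 1/2)))"
proof -
  have s: "scaling_coeff \<phi> f k = inner_L2 f (translates \<phi> k)" by (simp add: scaling_coeff_def inner_L2_def translates_def)
  have w: "wavelet_coeff \<psi> f l k = inner_L2 f (wavelet_dilates \<psi> (l, k))" by (simp add: wavelet_coeff_def inner_L2_def wavelet_dilates_def)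
  have "ennreal \<bar>scaling_coeff \<phi> f k\<bar> \<le> (SUP k. ennreal \<bar>scaling_coeff \<phi> f k\<bar>)" by (intro SUP_upper) simp
  also have "\<dots> \<le> wavelet_norm \<phi> \<psi> \<alpha> f" unfolding wavelet_norm_def by simp
  also have "\<dots> \<le> ennreal D" by (rule assms)
  finally show "\<bar>inner_L2 f (translates \<phi> k)\<bar> \<le> D" using assms(2) by (simp add: s)
  have "ennreal (2 powr (real l * (\<alpha> + 1/2)) * \<bar>wavelet_coeff \<psi> f l k\<bar>)
    \<le> (SUP (l, k). ennreal (2 powr (real l * (\<alpha> + 1/2)) * \<bar>wavelet_coeff \<psi> f l k\<bar>))"
    by (rule SUP_upper2[of "(l, k)"]) auto
  also have "\<dots> \<le> wavelet_norm \<phi> \<psi> \<alpha> f" unfolding wavelet_norm_def by simp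
  also have "\<dots> \<le> ennreal D" by (rule assms)
  finally have "2 powr (real l * (\<alpha> + 1/2)) * \<bar>wavelet_coeff \<psi> f l k\<bar> \<le> D" using assms(2) by simp
  then show "\<bar>inner_L2 f (wavelet_dilates \<psi> (l, k))\<bar> \<le> D * 2 powr (- (real l * (\<alpha> + 1/2)))"
    by (simp add: w powr_minus field_simps)
qed

text \<open>Levels below \<open>J\<close> are controlled by the shortness $2^{-J}$ of the interval and contribute at most
  a multiple of $2^{-J\alpha}$ each; levels above \<open>J\<close> are controlled by the decay of the coefficients
  and form a geometric series. The factor \<open>J + 1\<close> counts the low levels; for \<open>\<alpha> = 1\<close> it is the
  logarithm in the modulus of continuity of the Zygmund class.\<close>

lemma geometric_level_sum:
  assumes \<alpha>: "0 < \<alpha>" "\<alpha> \<le> 1"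
  shows "(\<Sum>l<N. 2 powr (- (real l * \<alpha>)) * min (2::real) (2 ^ Suc l * (2 / 2 ^ J))) \<le> (4 + 2 / (1 - 2 powr (- \<alpha>))) * ((real J + 1) * 2 powr (- (real J * \<alpha>)))"
proof -
  define q where "q = 2 powr (- \<alpha>)"
  have q: "0 < q" "q < 1" using \<alpha> by (auto simp: q_def powr_minus field_simps)
  have ql: "2 powr (- (real l * \<alpha>)) = q ^ l" for l
    by (simp add: q_def powr_realpow[symmetric] powr_powr mult.commute)
  define g where "g = (\<lambda>l. q ^ l * min 2 (2 ^ Suc l * (2 / 2 ^ J)))"
  have g0: "g l \<ge> 0" for l using q by (simp add: g_def)
  have low: "g l \<le> 4 * q ^ J" if "l < J" for l
  proof -
    obtain i where i: "J = l + i" using \<open>l < J\<close> less_imp_add_positive by blast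
    have "1 \<le> 2 * q"
    proof -
      have "2 powr (-1) \<le> 2 powr (- \<alpha>)" using \<alpha> by (intro powr_mono) auto
      then show ?thesis by (simp add: q_def powr_minus)
    qed
    then have "1 \<le> (2 * q) ^ i" by (rule one_le_power)
    then have "1 / 2 ^ i \<le> q ^ i" by (simp add: power_mult_distrib field_simps)
    have "g l \<le> q ^ l * (2 ^ Suc l * (2 / 2 ^ J))" unfolding g_def using q by (intro mult_left_mono) auto
    also have "\<dots> = 4 * q ^ l * (1 / 2 ^ i)" by (simp add: i power_add)
    also have "\<dots> \<le> 4 * q ^ l * q ^ i" using \<open>1 / 2 ^ i \<le> q ^ i\<close> q by (intro mult_left_mono) auto
    finally show ?thesis by (simp add: i power_add)
  qed
  have high: "g (J + i) \<le> 2 * q ^ J * q ^ i" for i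
  proof -
    have "g (J + i) \<le> q ^ (J + i) * 2" unfolding g_def using q by (intro mult_left_mono) auto
    then show ?thesis by (simp add: power_add)
  qed
  have "(\<Sum>l<N. g l) \<le> (\<Sum>l<J + N. g l)" using g0 by (intro sum_mono2) auto
  also have "\<dots> = (\<Sum>l<J. g l) + (\<Sum>i<N. g (J + i))"
    by (induction N) (simp_all add: add.assoc)
  also have "\<dots> \<le> (\<Sum>l<J. 4 * q ^ J) + (\<Sum>i<N. 2 * q ^ J * q ^ i)"
    using low high by (intro add_mono sum_mono) auto
  also have "(\<Sum>i<N. 2 * q ^ J * q ^ i) \<le> 2 * q ^ J * (1 / (1 - q))"
  proof -
    have "(\<Sum>i<N. q ^ i) \<le> (\<Sum>i. q ^ i)" using q by (intro sum_le_suminf summable_geometric) auto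
    then have "(\<Sum>i<N. q ^ i) \<le> 1 / (1 - q)" using q by (simp add: suminf_geometric)
    then have "2 * q ^ J * (\<Sum>i<N. q ^ i) \<le> 2 * q ^ J * (1 / (1 - q))" using q by (intro mult_left_mono) auto
    then show ?thesis by (simp add: sum_distrib_left)
  qed
  also have "(\<Sum>l<J. 4 * q ^ J) + 2 * q ^ J * (1 / (1 - q)) = (4 * real J + 2 / (1 - q)) * q ^ J" by (simp add: algebra_simps)
  also have "\<dots> \<le> ((4 + 2 / (1 - q)) * (real J + 1)) * q ^ J"
  proof (rule mult_right_mono)
    define c where "c = 2 / (1 - q)"
    have "c \<ge> 0" using q by (simp add: c_def)
    then have "0 \<le> c * real J" by simp
    then show "4 * real J + 2 / (1 - q) \<le> (4 + 2 / (1 - q)) * (real J + 1)"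
      unfolding c_def[symmetric] by (simp add: algebra_simps)
  qed (use q in simp)
  finally show ?thesis unfolding ql by (simp add: g_def q_def[symmetric] mult_ac)
qed

text \<open>Write the increment as a limit of pairings of \<open>f\<close> with \<open>h = deriv H\<close>, where \<open>H\<close> is a smooth box
  between the two points, and apply Parseval. The pairing of \<open>h\<close> with the functions of one level is
  bounded in two ways: directly, as the $L^1$ norm of \<open>h\<close> is at most 2, and after integration by
  parts, as the $L^1$ norm of \<open>H\<close> is at most $2\cdot 2^{-J}$.\<close>

theorem density_class_modulus:
  assumes wav: "associated_wavelet \<phi> \<psi>" and reg: "s_regular s \<phi>" and s: "real s > \<alpha>"
    and \<alpha>: "0 < \<alpha>" "\<alpha> \<le> 1" and D: "0 < D"
  obtains C where "C \<ge> 0" "\<And>f J x y. f \<in> density_class \<phi> \<psi> \<alpha> D \<delta> F \<Longrightarrow> \<bar>x - y\<bar> \<le> 1 / 2 ^ J \<Longrightarrow>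
     \<bar>f x - f y\<bar> \<le> C * ((real J + 1) * 2 powr (- (real J * \<alpha>)))"
proof -
  have basis: "orthonormal_basis_L2 (case_sum (translates \<phi>) (wavelet_dilates \<psi>))" and psi: "integrable lborel \<psi>"
    using wav by (auto simp: associated_wavelet_def)
  have s1: "1 \<le> s" using s \<alpha> by (cases s) auto
  obtain g0 where g0: "weak_derivative 0 \<phi> g0" "exponentially_decaying g0" using reg unfolding s_regular_def by blast
  obtain g1 where g1: "weak_derivative 1 \<phi> g1" "exponentially_decaying g1" using reg s1 unfolding s_regular_def by blast
  have phi_m: "\<phi> \<in> borel_measurable borel" and g1_m: "g1 \<in> borel_measurable borel"
    using g1 by (auto simp: weak_derivative_def intro: locally_integrable_measurable)
  have "exponentially_decaying \<phi>"
  proof -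
    obtain C \<gamma> where "C > 0" "\<gamma> > 0" and ae: "AE x in lborel. \<bar>g0 x\<bar> \<le> C * exp (- \<gamma> * \<bar>x\<bar>)"
      using g0(2) by (auto simp: exponentially_decaying_def)
    moreover have "AE x in lborel. \<bar>\<phi> x\<bar> \<le> C * exp (- \<gamma> * \<bar>x\<bar>)"
      using weak_derivative_0_AE[OF g0(1)] ae by eventually_elim simp
    ultimately show ?thesis unfolding exponentially_decaying_def by blast
  qed
  then obtain M0 where M0: "decays \<phi> M0" by (rule decays_exists[OF phi_m])
  obtain M1 where M1: "decays g1 M1" by (rule decays_exists[OF g1_m g1(2)])
  define K where "K = max M0 M1"
  have K: "K > 0" "M0 \<le> K" "M1 \<le> K" using M0 by (auto simp: K_def decays_def)
  define A where "A = 2 powr (real 1 / 2) * (M0 * (LINT x|lborel. \<bar>\<psi> x\<bar>))"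
  have A: "(\<Sum>m\<in>F. \<bar>inner_L2 \<psi> (dilate 1 (translates \<phi> m))\<bar>) \<le> A" if "finite F" for F
    unfolding A_def inner_L2_commute[of \<psi>] by (rule decays_sum_bound[OF M0 psi that])
  have A0: "A \<ge> 0" using A[of "{}"] by simp
  define C where "C = 2 * D * K + D * A * K * sqrt 2 * (4 + 2 / (1 - 2 powr (- \<alpha>)))"
  have q1: "1 - 2 powr (- \<alpha>) > 0" using \<alpha> by (simp add: powr_minus field_simps)
  have C0: "C \<ge> 0" unfolding C_def using D K A0 q1 by (intro add_nonneg_nonneg mult_nonneg_nonneg divide_nonneg_nonneg) auto
  have main: "\<bar>f x - f y\<bar> \<le> C * ((real J + 1) * 2 powr (- (real J * \<alpha>)))"
    if f: "f \<in> density_class \<phi> \<psi> \<alpha> D \<delta> F" and xy: "x \<le> y" "y - x \<le> 1 / 2 ^ J" for f J x y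
  proof -
    have fc: "continuous_on UNIV f" "bounded (range f)" "integrable lborel f" "wavelet_norm \<phi> \<psi> \<alpha> f \<le> ennreal D"
      using f by (auto simp: density_class_def has_bochner_integral_iff)
    obtain B where "\<And>t. \<bar>f t\<bar> \<le> B" using fc(2) unfolding bounded_iff by auto
    then have fL: "f \<in> L2" by (rule bounded_integrable_L2[OF fc(3)])
    note cf = wavelet_norm_coeffs[OF fc(4) less_imp_le[OF D]]
    define E where "E = C * ((real J + 1) * 2 powr (- (real J * \<alpha>)))"
    have test: "\<bar>inner_L2 f (deriv (smooth_box x y \<epsilon>))\<bar> \<le> E" if eps: "0 < \<epsilon>" "\<epsilon> \<le> 1 / 2 ^ J" for \<epsilon>
    proof -
      define H where "H = smooth_box x y \<epsilon>"
      define h where "h = deriv H"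
      have H: "test_function H" "integrable lborel H" "(LINT t|lborel. \<bar>H t\<bar>) \<le> 2 / 2 ^ J"
        using smooth_box_test[OF xy(1) eps(1)] smooth_box_L1[OF xy(1) eps(1)] eps(2) xy(2) by (auto simp: H_def)
      have h: "integrable lborel h" "(LINT t|lborel. \<bar>h t\<bar>) \<le> 2"
        using deriv_smooth_box_L1[OF xy(1) eps(1)] by (auto simp: H_def h_def)
      obtain Bh where "\<And>t. \<bar>h t\<bar> \<le> Bh" using deriv_smooth_box_bounded[OF xy(1) eps(1)] by (auto simp: H_def h_def)
      then have hL: "h \<in> L2" by (rule bounded_integrable_L2[OF h(1)])
      have level: "(\<Sum>m\<in>F. \<bar>inner_L2 (dilate L (translates \<phi> m)) h\<bar>) \<le> 2 powr (real L / 2) * (K * min 2 (2 ^ L * (2 / 2 ^ J)))"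
        if F: "finite F" for L F
      proof -
        have "(\<Sum>m\<in>F. \<bar>inner_L2 (dilate L (translates \<phi> m)) h\<bar>) \<le> 2 powr (real L / 2) * (M0 * (LINT t|lborel. \<bar>h t\<bar>))"
          by (rule decays_sum_bound[OF M0 h(1) F])
        also have "\<dots> \<le> 2 powr (real L / 2) * (K * 2)" using K h(2) by (intro mult_left_mono mult_mono) auto
        finally have 1: "(\<Sum>m\<in>F. \<bar>inner_L2 (dilate L (translates \<phi> m)) h\<bar>) \<le> 2 powr (real L / 2) * (K * 2)" .
        have "(\<Sum>m\<in>F. \<bar>inner_L2 (dilate L (translates \<phi> m)) h\<bar>) = 2 ^ L * (\<Sum>m\<in>F. \<bar>inner_L2 (dilate L (translates g1 m)) H\<bar>)"
          unfolding h_def weak_derivative_dilate[OF g1(1) H(1)] by (simp add: abs_mult sum_distrib_left)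
        also have "\<dots> \<le> 2 ^ L * (2 powr (real L / 2) * (M1 * (LINT t|lborel. \<bar>H t\<bar>)))"
          by (intro mult_left_mono decays_sum_bound[OF M1 H(2) F]) auto
        also have "\<dots> \<le> 2 ^ L * (2 powr (real L / 2) * (K * (2 / 2 ^ J)))"
          using K H(3) by (intro mult_left_mono mult_mono) auto
        finally have 2: "(\<Sum>m\<in>F. \<bar>inner_L2 (dilate L (translates \<phi> m)) h\<bar>) \<le> 2 powr (real L / 2) * (K * (2 ^ L * (2 / 2 ^ J)))" by (simp add: mult_ac)
        show ?thesis using 1 2 by (simp add: min_def)
      qed
      have wl: "(\<Sum>k\<in>F. \<bar>inner_L2 (wavelet_dilates \<psi> (l, k)) h\<bar>) \<le> A * (2 powr (real (Suc l) / 2) * (K * min 2 (2 ^ Suc l * (2 / 2 ^ J))))"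
        if F: "finite F" for l F
        by (rule wavelet_sum_bound[OF basis A hL level F])
      define e where "e = case_sum (translates \<phi>) (wavelet_dilates \<psi>)"
      have "((\<lambda>i. inner_L2 f (e i) * inner_L2 (e i) h) has_sum inner_L2 f h) UNIV"
        unfolding e_def by (rule parseval[OF basis fL hL])
      then have "((\<lambda>X. \<bar>\<Sum>i\<in>X. inner_L2 f (e i) * inner_L2 (e i) h\<bar>) \<longlongrightarrow> \<bar>inner_L2 f h\<bar>) (finite_subsets_at_top UNIV)"
        unfolding has_sum_def by (intro tendsto_rabs)
      then have "\<bar>inner_L2 f h\<bar> \<le> E"
      proof (rule tendsto_upperbound)
        show "\<forall>\<^sub>F X in finite_subsets_at_top UNIV. \<bar>\<Sum>i\<in>X. inner_L2 f (e i) * inner_L2 (e i) h\<bar> \<le> E"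
        proof (rule eventually_finite_subsets_at_top_weakI)
          fix X :: "(int + nat \<times> int) set" assume X: "finite X"
          define F1 where "F1 = Inl -` X"
          define F2 where "F2 = Inr -` X"
          have fin: "finite F1" "finite F2" unfolding F1_def F2_def using X by (auto intro!: finite_vimageI)
          have XE: "X = Inl ` F1 \<union> Inr ` F2"
          proof (intro set_eqI)
            fix i show "i \<in> X \<longleftrightarrow> i \<in> Inl ` F1 \<union> Inr ` F2" by (cases i) (auto simp: F1_def F2_def)
          qed
          have "finite (fst ` F2)" using fin(2) by simp
          then obtain N where N: "\<forall>l\<in>fst ` F2. l < N" unfolding finite_nat_set_iff_bounded by blast
          define F3 where "F3 = snd ` F2"
          have F3: "finite F3" "F2 \<subseteq> {..<N} \<times> F3"
          proof -
            show "finite F3" using fin(2) by (simp add: F3_def)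
            show "F2 \<subseteq> {..<N} \<times> F3"
            proof
              fix i assume "i \<in> F2"
              then have "fst i < N" "snd i \<in> F3" using N by (auto simp: F3_def)
              then show "i \<in> {..<N} \<times> F3" by (simp add: mem_Times_iff)
            qed
          qed
          have "(\<Sum>k\<in>F1. \<bar>inner_L2 f (translates \<phi> k)\<bar> * \<bar>inner_L2 (translates \<phi> k) h\<bar>) \<le> (\<Sum>k\<in>F1. D * \<bar>inner_L2 (dilate 0 (translates \<phi> k)) h\<bar>)"
            using cf(1) by (intro sum_mono) (simp add: dilate_def[abs_def] mult_right_mono)
          also have "\<dots> \<le> D * (2 powr (real 0 / 2) * (K * min 2 (2 ^ 0 * (2 / 2 ^ J))))"
            unfolding sum_distrib_left[symmetric] using D by (intro mult_left_mono level fin) auto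
          also have "\<dots> = D * (K * min 2 (2 / 2 ^ J))" by simp
          also have "\<dots> \<le> D * (K * (2 / 2 ^ J))" using D K by (intro mult_left_mono min.cobounded2) auto
          also have "\<dots> \<le> 2 * D * K * ((real J + 1) * 2 powr (- (real J * \<alpha>)))"
          proof -
            have "2 powr (- real J) \<le> 2 powr (- (real J * \<alpha>))" using \<alpha> by (intro powr_mono) (auto simp: mult_left_le)
            then have "1 / 2 ^ J \<le> 1 * 2 powr (- (real J * \<alpha>))" by (simp add: powr_minus powr_realpow divide_inverse)
            also have "\<dots> \<le> (real J + 1) * 2 powr (- (real J * \<alpha>))" by (intro mult_right_mono) auto
            finally have "2 * D * K * (1 / 2 ^ J) \<le> 2 * D * K * ((real J + 1) * 2 powr (- (real J * \<alpha>)))" using D K by (intro mult_left_mono) auto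
            moreover have "D * (K * (2 / 2 ^ J)) = 2 * D * K * (1 / 2 ^ J)" by simp
            ultimately show ?thesis by (simp only:)
          qed
          finally have b1: "(\<Sum>k\<in>F1. \<bar>inner_L2 f (translates \<phi> k)\<bar> * \<bar>inner_L2 (translates \<phi> k) h\<bar>) \<le> 2 * D * K * ((real J + 1) * 2 powr (- (real J * \<alpha>)))" .
          have "(\<Sum>i\<in>F2. \<bar>inner_L2 f (wavelet_dilates \<psi> i)\<bar> * \<bar>inner_L2 (wavelet_dilates \<psi> i) h\<bar>) \<le>
             (\<Sum>i\<in>{..<N} \<times> F3. \<bar>inner_L2 f (wavelet_dilates \<psi> i)\<bar> * \<bar>inner_L2 (wavelet_dilates \<psi> i) h\<bar>)"
            using F3 by (intro sum_mono2) auto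
          also have "\<dots> = (\<Sum>l<N. \<Sum>k\<in>F3. \<bar>inner_L2 f (wavelet_dilates \<psi> (l, k))\<bar> * \<bar>inner_L2 (wavelet_dilates \<psi> (l, k)) h\<bar>)"
            by (simp add: sum.cartesian_product)
          also have "\<dots> \<le> (\<Sum>l<N. D * A * K * sqrt 2 * (2 powr (- (real l * \<alpha>)) * min 2 (2 ^ Suc l * (2 / 2 ^ J))))"
          proof (rule sum_mono)
            fix l
            have "(\<Sum>k\<in>F3. \<bar>inner_L2 f (wavelet_dilates \<psi> (l, k))\<bar> * \<bar>inner_L2 (wavelet_dilates \<psi> (l, k)) h\<bar>)
              \<le> (\<Sum>k\<in>F3. D * 2 powr (- (real l * (\<alpha> + 1/2))) * \<bar>inner_L2 (wavelet_dilates \<psi> (l, k)) h\<bar>)"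
              using cf(2) by (intro sum_mono mult_right_mono) auto
            also have "\<dots> = D * 2 powr (- (real l * (\<alpha> + 1/2))) * (\<Sum>k\<in>F3. \<bar>inner_L2 (wavelet_dilates \<psi> (l, k)) h\<bar>)" by (simp add: sum_distrib_left)
            also have "\<dots> \<le> D * 2 powr (- (real l * (\<alpha> + 1/2))) * (A * (2 powr (real (Suc l) / 2) * (K * min 2 (2 ^ Suc l * (2 / 2 ^ J)))))"
              using D by (intro mult_left_mono wl F3) auto
            also have "\<dots> = D * A * K * (2 powr (- (real l * (\<alpha> + 1/2))) * 2 powr (real (Suc l) / 2)) * min 2 (2 ^ Suc l * (2 / 2 ^ J))" by (simp only: mult_ac)
            also have "2 powr (- (real l * (\<alpha> + 1/2))) * 2 powr (real (Suc l) / 2) = sqrt 2 * 2 powr (- (real l * \<alpha>))"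
            proof -
              have "- (real l * (\<alpha> + 1/2)) + real (Suc l) / 2 = 1 / 2 + - (real l * \<alpha>)" by (simp add: algebra_simps)
              then have "2 powr (- (real l * (\<alpha> + 1/2))) * 2 powr (real (Suc l) / 2) = 2 powr (1 / 2 + - (real l * \<alpha>))" by (simp only: powr_add[symmetric])
              then show ?thesis by (simp only: powr_add powr_half_sqrt zero_le_numeral)
            qed
            finally show "(\<Sum>k\<in>F3. \<bar>inner_L2 f (wavelet_dilates \<psi> (l, k))\<bar> * \<bar>inner_L2 (wavelet_dilates \<psi> (l, k)) h\<bar>)
              \<le> D * A * K * sqrt 2 * (2 powr (- (real l * \<alpha>)) * min 2 (2 ^ Suc l * (2 / 2 ^ J)))" by (simp only: mult_ac)
          qed
          also have "\<dots> = D * A * K * sqrt 2 * (\<Sum>l<N. 2 powr (- (real l * \<alpha>)) * min 2 (2 ^ Suc l * (2 / 2 ^ J)))" by (rule sum_distrib_left[symmetric])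
          also have "\<dots> \<le> D * A * K * sqrt 2 * ((4 + 2 / (1 - 2 powr (- \<alpha>))) * ((real J + 1) * 2 powr (- (real J * \<alpha>))))"
            using D A0 K by (intro mult_left_mono geometric_level_sum \<alpha>) auto
          finally have b2: "(\<Sum>i\<in>F2. \<bar>inner_L2 f (wavelet_dilates \<psi> i)\<bar> * \<bar>inner_L2 (wavelet_dilates \<psi> i) h\<bar>)
            \<le> D * A * K * sqrt 2 * ((4 + 2 / (1 - 2 powr (- \<alpha>))) * ((real J + 1) * 2 powr (- (real J * \<alpha>))))" .
          have "\<bar>\<Sum>i\<in>X. inner_L2 f (e i) * inner_L2 (e i) h\<bar> \<le> (\<Sum>i\<in>X. \<bar>inner_L2 f (e i) * inner_L2 (e i) h\<bar>)" by (rule sum_abs)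
          also have "\<dots> = (\<Sum>k\<in>F1. \<bar>inner_L2 f (translates \<phi> k)\<bar> * \<bar>inner_L2 (translates \<phi> k) h\<bar>) + (\<Sum>i\<in>F2. \<bar>inner_L2 f (wavelet_dilates \<psi> i)\<bar> * \<bar>inner_L2 (wavelet_dilates \<psi> i) h\<bar>)"
            unfolding XE using fin by (subst sum.union_disjoint) (auto simp: sum.reindex e_def abs_mult)
          also have "\<dots> \<le> 2 * D * K * ((real J + 1) * 2 powr (- (real J * \<alpha>)))
            + D * A * K * sqrt 2 * ((4 + 2 / (1 - 2 powr (- \<alpha>))) * ((real J + 1) * 2 powr (- (real J * \<alpha>))))"
            by (rule add_mono[OF b1 b2])
          also have "\<dots> = E" by (simp add: E_def C_def distrib_right mult.assoc)
          finally show "\<bar>\<Sum>i\<in>X. inner_L2 f (e i) * inner_L2 (e i) h\<bar> \<le> E" .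
        qed
      qed simp
      then show ?thesis by (simp add: h_def H_def)
    qed
    define \<epsilon> where "\<epsilon> = (\<lambda>n. 1 / 2 ^ J / real (Suc n))"
    have eps: "\<epsilon> n > 0" "\<epsilon> n \<le> 1 / 2 ^ J" for n
    proof -
      show "\<epsilon> n > 0" by (simp add: \<epsilon>_def del: of_nat_Suc)
      have "1 / 2 ^ J / real (Suc n) \<le> 1 / 2 ^ J / 1" by (intro divide_left_mono) auto
      then show "\<epsilon> n \<le> 1 / 2 ^ J" by (simp add: \<epsilon>_def)
    qed
    have "\<epsilon> \<longlonglongrightarrow> 0" unfolding \<epsilon>_def by (rule LIMSEQ_Suc[of "\<lambda>n. 1 / 2 ^ J / real n"]) (rule lim_const_over_n)
    then have "(\<lambda>n. \<bar>inner_L2 f (deriv (smooth_box x y (\<epsilon> n)))\<bar>) \<longlonglongrightarrow> \<bar>f x - f y\<bar>"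
      unfolding inner_L2_def by (intro tendsto_rabs deriv_smooth_box_limit fc xy eps)
    then have "\<bar>f x - f y\<bar> \<le> E"
      by (rule LIMSEQ_le_const2) (use test[OF eps] in blast)
    then show ?thesis by (simp add: E_def)
  qed
  show ?thesis
  proof (rule that[OF C0])
    fix f :: "real \<Rightarrow> real" and J :: nat and x y :: real
    assume f: "f \<in> density_class \<phi> \<psi> \<alpha> D \<delta> F" and xy: "\<bar>x - y\<bar> \<le> 1 / 2 ^ J"
    show "\<bar>f x - f y\<bar> \<le> C * ((real J + 1) * 2 powr (- (real J * \<alpha>)))"
    proof (cases "x \<le> y")
      case True
      then show ?thesis using main[OF f True, of J] xy by simp
    next
      case False
      then show ?thesis using main[OF f, of y x J] xy by (simp add: abs_minus_commute)
    qed
  qed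
qed

section \<open>Stirling's formula and local binomial asymptotics\<close>

definition stirling_ratio :: "nat \<Rightarrow> real" where
  "stirling_ratio n = fact n / (sqrt (2 * pi * real n) * (real n / exp 1) ^ n)"

text \<open>Consecutive terms differ by $O(n^{-2})$.\<close>

lemma stirling_log_convergent:
  "convergent (\<lambda>n. ln (fact n) - (real n + 1/2) * ln (real n) + real n)"
proof -
  define x where "x = (\<lambda>n. ln (fact n) - (real n + 1/2) * ln (real n) + real n)"
  have diff: "x (Suc n) - x n = 1 - (real n + 1/2) * ln (1 + 1 / real n)" if "n > 0" for n
  proof -
    define L where "L = ln (1 + 1 / real n)"
    have "1 + 1 / real n = real (Suc n) / real n"
      using that by (simp add: field_simps)
    then have "L = ln (real (Suc n)) - ln (real n)"
      using that unfolding L_def by (simp only: ln_div) (simp add: ln_div)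
    then have L: "ln (1 + real n) = ln (real n) + L" by simp
    have F: "ln (fact (Suc n) :: real) = ln (1 + real n) + ln (fact n)"
      by (subst fact_Suc, subst ln_mult) auto
    show ?thesis
      unfolding L_def[symmetric] by (simp add: x_def F L algebra_simps del: fact_Suc)
  qed
  have "(\<lambda>n. 1 - (real n + 1/2) * ln (1 + 1 / real n)) \<in> O(\<lambda>n. 1 / real n ^ 2)"
    by real_asymp
  moreover have "eventually (\<lambda>n. x (Suc n) - x n = 1 - (real n + 1/2) * ln (1 + 1 / real n)) sequentially"
    using eventually_gt_at_top[of 0] by eventually_elim (rule diff)
  ultimately have "(\<lambda>n. x (Suc n) - x n) \<in> O(\<lambda>n. 1 / real n ^ 2)"
    by (subst landau_o.big.in_cong) auto
  moreover have "summable (\<lambda>n. norm (1 / real n ^ 2))"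
    using inverse_power_summable[of 2, where 'a = real] by (simp add: divide_simps)
  ultimately have "summable (\<lambda>n. x (Suc n) - x n)"
    by (rule summable_comparison_test_bigo[rotated])
  then have "convergent (\<lambda>n. \<Sum>i<n. x (Suc i) - x i)"
    by (simp add: summable_iff_convergent)
  then have "convergent (\<lambda>n. x n - x 0)"
    by (simp add: sum_lessThan_telescope)
  then have "convergent (\<lambda>n. (x n - x 0) + x 0)"
    by (intro convergent_add convergent_const)
  then show ?thesis
    by (simp add: x_def)
qed

text \<open>The logarithm of the ratio converges, and Wallis' product identifies the limit because the
  $n$-th partial product is a quotient of factorials of $n$ and $2n$.\<close>

theorem stirling: "stirling_ratio \<longlonglongrightarrow> 1"
proof -
  define x where "x = (\<lambda>n. ln (fact n) - (real n + 1/2) * ln (real n) + real n)"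
  obtain c where c: "x \<longlonglongrightarrow> c"
    using stirling_log_convergent by (auto simp: x_def convergent_def)
  define W where "W = (\<lambda>n::nat. \<Prod>k=1..n. (4*real k^2) / (4*real k^2 - 1))"
  have W: "W n = 2 ^ (4 * n) * fact n ^ 4 / (fact (2 * n) ^ 2 * (2 * real n + 1))" for n
  proof (induction n)
    case (Suc n)
    have ne: "4 * (real n + 1)\<^sup>2 - 1 = (2 * real n + 1) * (2 * real n + 3)"
      by (simp add: power2_eq_square algebra_simps)
    have "W (Suc n) = W n * ((4 * (real n + 1)\<^sup>2) / ((2 * real n + 1) * (2 * real n + 3)))"
      by (simp only: W_def ne[symmetric] of_nat_Suc prod.cl_ivl_Suc) (simp add: add.commute)
    also have "\<dots> = 2 ^ (4 * n) * fact n ^ 4 / (fact (2 * n) ^ 2 * (2 * real n + 1)) * ((4 * (real n + 1)\<^sup>2) / ((2 * real n + 1) * (2 * real n + 3)))"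
      by (simp only: Suc.IH)
    also have "\<dots> = 2 ^ (4 * Suc n) * fact (Suc n) ^ 4 / (fact (2 * Suc n) ^ 2 * (2 * real (Suc n) + 1))"
    proof -
      have f1: "(fact (Suc n) :: real) = (real n + 1) * fact n" by simp
      have f2: "(fact (2 * Suc n) :: real) = (2 * real n + 2) * (2 * real n + 1) * fact (2 * n)"
        by (simp add: algebra_simps)
      have pos: "(fact (2 * n) :: real) \<noteq> 0" "2 * real n + 1 \<noteq> 0" "2 * real n + 2 \<noteq> 0" "2 * real n + 3 \<noteq> 0"
        by (auto simp: add_eq_0_iff)
      have e: "2 * real (Suc n) + 1 = 2 * real n + 3" "(2::real) ^ (4 * Suc n) = 16 * 2 ^ (4 * n)"
        "2 * real n + 2 = 2 * (real n + 1)"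
        by (simp_all add: power_add)
      have "real n + 1 \<noteq> 0" by linarith
      then show ?thesis unfolding f1 f2 e using pos
        by (simp add: divide_simps power2_eq_square power4_eq_xxxx) (simp add: algebra_simps)
    qed
    finally show ?case .
  qed (simp add: W_def)
  have lnW: "ln (W n) = 4 * x n - 2 * x (2 * n) + (ln (real n) - ln 2 - ln (2 * real n + 1))"
    if "n > 0" for n
  proof -
    have "ln (W n) = real (4 * n) * ln 2 + 4 * ln (fact n) - 2 * ln (fact (2 * n)) - ln (2 * real n + 1)"
      unfolding W by (simp add: ln_div ln_mult ln_realpow)
    moreover have "ln (fact n :: real) = x n + (real n + 1/2) * ln (real n) - real n"
      "ln (fact (2*n) :: real) = x (2 * n) + (2 * real n + 1/2) * (ln 2 + ln (real n)) - 2 * real n"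
      using that by (simp_all add: x_def ln_mult)
    ultimately show ?thesis by (simp add: algebra_simps)
  qed
  have "(\<lambda>n. ln (W n)) \<longlonglongrightarrow> ln (pi / 2)"
    using wallis unfolding W_def by (intro tendsto_ln) auto
  moreover have "(\<lambda>n. ln (W n)) \<longlonglongrightarrow> 4 * c - 2 * c - ln 4"
  proof (rule Lim_transform_eventually)
    have "(\<lambda>n. x (2 * n)) \<longlonglongrightarrow> c"
      by (rule filterlim_compose[OF c]) real_asymp
    moreover have "(\<lambda>n. ln (real n) - ln 2 - ln (2 * real n + 1)) \<longlonglongrightarrow> - ln 4"
    proof -
      have "(\<lambda>n. ln (real n) - ln 2 - ln (2 * real n + 1)) \<longlonglongrightarrow> - 2 * ln 2" by real_asymp
      moreover have "ln (4::real) = 2 * ln 2" using ln_realpow[of 2 2] by simp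
      ultimately show ?thesis by simp
    qed
    ultimately have "(\<lambda>n. 4 * x n - 2 * x (2 * n) + (ln (real n) - ln 2 - ln (2 * real n + 1)))
      \<longlonglongrightarrow> 4 * c - 2 * c + (- ln 4)"
      using c by (intro tendsto_intros) auto
    then show "(\<lambda>n. 4 * x n - 2 * x (2 * n) + (ln (real n) - ln 2 - ln (2 * real n + 1)))
      \<longlonglongrightarrow> 4 * c - 2 * c - ln 4" by simp
    show "\<forall>\<^sub>F n in sequentially. 4 * x n - 2 * x (2 * n) + (ln (real n) - ln 2 - ln (2 * real n + 1)) = ln (W n)"
      using eventually_gt_at_top[of 0] by eventually_elim (simp add: lnW)
  qed
  ultimately have "2 * c = ln (pi / 2) + ln 4"
    using LIMSEQ_unique by fastforce
  also have "\<dots> = ln (2 * pi)"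
    using ln_mult_pos[of "pi / 2" 4] by simp
  finally have c_eq: "c = ln (2 * pi) / 2" by simp
  have "(\<lambda>n. exp (x n - c)) \<longlonglongrightarrow> exp (c - c)"
    using c by (intro tendsto_intros)
  then show ?thesis
  proof (subst filterlim_cong[OF refl refl], goal_cases)
    case 1
    show "\<forall>\<^sub>F n in sequentially. stirling_ratio n = exp (x n - c)"
      using eventually_gt_at_top[of 0]
    proof eventually_elim
      case (elim n)
      have "stirling_ratio n > 0" using elim by (simp add: stirling_ratio_def)
      moreover have "ln (stirling_ratio n) = x n - c"
        unfolding stirling_ratio_def x_def c_eq using elim
        by (simp add: ln_div ln_mult ln_sqrt ln_realpow field_simps)
      ultimately show ?case by (metis exp_ln)
    qed
  qed simp
qed

text \<open>The probability function of the binomial distribution as a plain expression, which is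
  meaningful before \<open>r\<close> is known to lie between 0 and 1.\<close>

definition binom_prob :: "nat \<Rightarrow> real \<Rightarrow> nat \<Rightarrow> real" where
  "binom_prob m r k = real (m choose k) * r ^ k * (1 - r) ^ (m - k)"

lemma entropy_taylor2:
  "\<exists>c d::real. d > 0 \<and> (\<forall>z. \<bar>z\<bar> < d \<longrightarrow> \<bar>(1 + z) * ln (1 + z) - z - z\<^sup>2 / 2\<bar> \<le> c * \<bar>z\<bar> ^ 3)"
proof -
  have "(\<lambda>z::real. (1 + z) * ln (1 + z) - z - z\<^sup>2 / 2) \<in> O[at 0](\<lambda>z. z ^ 3)"
    unfolding at_eq_sup_left_right by (rule landau_o.big.sup; real_asymp)
  then obtain c where "eventually (\<lambda>z. \<bar>(1 + z) * ln (1 + z) - z - z\<^sup>2 / 2\<bar> \<le> c * \<bar>z\<bar> ^ 3) (at (0::real))"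
    by (elim landau_o.bigE) (auto simp: power_abs)
  then obtain d where "d > 0" "\<And>z. z \<noteq> 0 \<Longrightarrow> \<bar>z\<bar> < d \<Longrightarrow> \<bar>(1 + z) * ln (1 + z) - z - z\<^sup>2 / 2\<bar> \<le> c * \<bar>z\<bar> ^ 3"
    unfolding eventually_at by (auto simp: dist_real_def)
  then show ?thesis
    by (intro exI[of _ c] exI[of _ d]) (metis (no_types, lifting) abs_zero add_0_right cancel_comm_monoid_add_class.diff_cancel divide_eq_0_iff ln_one mult_zero_right order_refl power_zero_numeral)
qed

lemma entropy_taylor1:
  "\<exists>c d::real. d > 0 \<and> (\<forall>z. \<bar>z\<bar> < d \<longrightarrow> \<bar>(1 + z) * ln (1 + z) - z\<bar> \<le> c * \<bar>z\<bar> ^ 2)"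
proof -
  have "(\<lambda>z::real. (1 + z) * ln (1 + z) - z) \<in> O[at 0](\<lambda>z. z ^ 2)"
    unfolding at_eq_sup_left_right by (rule landau_o.big.sup; real_asymp)
  then obtain c where "eventually (\<lambda>z. \<bar>(1 + z) * ln (1 + z) - z\<bar> \<le> c * \<bar>z\<bar> ^ 2) (at (0::real))"
    by (elim landau_o.bigE) (auto simp: power_abs)
  then obtain d where "d > 0" "\<And>z. z \<noteq> 0 \<Longrightarrow> \<bar>z\<bar> < d \<Longrightarrow> \<bar>(1 + z) * ln (1 + z) - z\<bar> \<le> c * \<bar>z\<bar> ^ 2"
    unfolding eventually_at by (auto simp: dist_real_def)
  then show ?thesis
    by (intro exI[of _ c] exI[of _ d]) (metis (no_types, lifting) abs_zero add_0_right cancel_comm_monoid_add_class.diff_cancel ln_one mult_zero_right order_refl power_zero_numeral)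
qed

lemma fact_eq_stirling:
  assumes "k > 0"
  shows "ln (fact k :: real) = ln (stirling_ratio k) + (ln (2 * pi) + ln (real k)) / 2 + real k * ln (real k) - real k"
    and "stirling_ratio k > 0"
proof -
  show pos: "stirling_ratio k > 0" using assms by (simp add: stirling_ratio_def)
  have "ln (stirling_ratio k) = ln (fact k) - (ln (2 * pi) + ln (real k)) / 2 - real k * ln (real k) + real k"
    unfolding stirling_ratio_def using assms
    by (simp add: ln_div ln_mult ln_sqrt ln_realpow field_simps)
  then show "ln (fact k :: real) = ln (stirling_ratio k) + (ln (2 * pi) + ln (real k)) / 2 + real k * ln (real k) - real k"
    by simp
qed

text \<open>The powers in Stirling's formula combine with those in the binomial probability into the
  exponential of a relative entropy.\<close>

lemma binom_prob_stirling:
  fixes m a :: nat and r :: real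
  assumes r: "0 < r" "r < 1" and a: "0 < a" "a < m"
  defines "l \<equiv> real m * r"
  shows "binom_prob m r a * sqrt (2 * pi * l) =
     stirling_ratio m / (stirling_ratio a * stirling_ratio (m - a)) * sqrt (l / real a) * sqrt (1 / (1 - real a / real m))
     * exp (- (real a * ln (real a / l) + (real m - real a) * ln ((real m - real a) / (real m - l))))"
    (is "?L = ?R")
proof -
  have m: "m > 0" "m - a > 0" using a by auto
  have l: "l > 0" using r m by (simp add: l_def)
  have ml: "real m - l = real m * (1 - r)" by (simp add: l_def algebra_simps)
  have ma: "real (m - a) = real m - real a" using a by (simp add: of_nat_diff)
  have q: "1 / (1 - real a / real m) = real m / (real m - real a)" using m a by (simp add: field_simps)
  note sp = fact_eq_stirling(2)[OF m(1)] fact_eq_stirling(2)[OF m(2)] fact_eq_stirling(2)[OF a(1)]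
  have ch: "real (m choose a) = fact m / (fact a * fact (m - a))"
    using a by (simp add: binomial_fact)
  have Lpos: "?L > 0" and Rpos: "?R > 0"
    using a r l sp m by (auto simp: binom_prob_def zero_less_binomial_iff q intro!: mult_pos_pos divide_pos_pos)
  have "ln (binom_prob m r a) = ln (fact m) - ln (fact a) - ln (fact (m - a)) + real a * ln r + (real m - real a) * ln (1 - r)"
    unfolding binom_prob_def ch using r a by (simp add: ln_mult ln_div ln_realpow ma)
  then have "ln ?L = ln (fact m) - ln (fact a) - ln (fact (m - a)) + real a * ln r + (real m - real a) * ln (1 - r)
      + (ln (2 * pi) + ln (real m) + ln r) / 2"
    using l r a m by (subst ln_mult) (auto simp: binom_prob_def zero_less_binomial_iff ln_sqrt ln_mult l_def algebra_simps add_divide_distrib)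
  moreover have "ln ?R = ln (stirling_ratio m) - ln (stirling_ratio a) - ln (stirling_ratio (m - a))
      + (ln (real m) + ln r - ln (real a)) / 2 + (ln (real m) - ln (real m - real a)) / 2
      - (real a * (ln (real a) - ln (real m) - ln r) + (real m - real a) * (ln (real m - real a) - ln (real m) - ln (1 - r)))"
    unfolding q ml using sp l r a m by (simp add: ln_mult ln_div ln_sqrt l_def) (simp add: algebra_simps)
  ultimately have "ln ?L = ln ?R"
    unfolding fact_eq_stirling(1)[OF m(1)] fact_eq_stirling(1)[OF m(2)] fact_eq_stirling(1)[OF a(1)] ma
    by (simp add: algebra_simps add_divide_distrib diff_divide_distrib)
  then show ?thesis using Lpos Rpos by (metis exp_ln)
qed

text \<open>Expand the relative entropy of \<open>binom_prob_stirling\<close>. The successes contribute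
  $v^2/2$ with an error of order $v^3/\sqrt l$ (third order Taylor term), the failures an error of
  order $v^2 r$; the linear terms cancel.\<close>

lemma binomial_local_limit:
  fixes m a :: "nat \<Rightarrow> nat" and r :: "nat \<Rightarrow> real"
  defines "l \<equiv> \<lambda>n. real (m n) * r n"
  defines "v \<equiv> \<lambda>n. (real (a n) - l n) / sqrt (l n)"
  assumes r: "\<And>n. 0 < r n" "\<And>n. r n < 1" "r \<longlonglongrightarrow> 0"
    and l: "filterlim l at_top sequentially"
    and v: "(\<lambda>n. v n / sqrt (l n)) \<longlonglongrightarrow> 0" "(\<lambda>n. v n ^ 3 / sqrt (l n)) \<longlonglongrightarrow> 0" "(\<lambda>n. v n ^ 2 * r n) \<longlonglongrightarrow> 0"
  shows "(\<lambda>n. binom_prob (m n) (r n) (a n) * sqrt (2 * pi * l n) * exp (v n ^ 2 / 2)) \<longlonglongrightarrow> 1"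
    and "\<forall>\<^sub>F n in sequentially. 0 < a n \<and> a n < m n"
    and "(\<lambda>n. real (a n) / l n) \<longlonglongrightarrow> 1"
proof -
  define eta where "eta = (\<lambda>n. v n / sqrt (l n))"
  have eta: "eta \<longlonglongrightarrow> 0" using v by (simp add: eta_def)
  have ev_l: "\<forall>\<^sub>F n in sequentially. l n > 0" using l by (simp add: filterlim_at_top_dense)
  have a_eq: "\<forall>\<^sub>F n in sequentially. real (a n) / l n = 1 + eta n"
    using ev_l by eventually_elim (simp add: eta_def v_def field_simps)
  have "(\<lambda>n. 1 + eta n) \<longlonglongrightarrow> 1 + 0" using eta by (intro tendsto_intros)
  then show al: "(\<lambda>n. real (a n) / l n) \<longlonglongrightarrow> 1"
    using a_eq by (subst filterlim_cong[OF refl refl a_eq]) simp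
  have am: "(\<lambda>n. real (a n) / real (m n)) \<longlonglongrightarrow> 0"
  proof (rule Lim_transform_eventually)
    show "(\<lambda>n. (real (a n) / l n) * r n) \<longlonglongrightarrow> 0"
      using tendsto_mult[OF al r(3)] by simp
    show "\<forall>\<^sub>F n in sequentially. (real (a n) / l n) * r n = real (a n) / real (m n)"
      using ev_l by eventually_elim (use r(1) in \<open>auto simp: l_def less_imp_neq[symmetric]\<close>)
  qed
  have a_real: "filterlim (\<lambda>n. real (a n)) at_top sequentially"
  proof (rule filterlim_cong[THEN iffD1, OF refl refl])
    show "filterlim (\<lambda>n. (real (a n) / l n) * l n) at_top sequentially"
      by (rule filterlim_tendsto_pos_mult_at_top[OF al _ l]) simp
    show "\<forall>\<^sub>F n in sequentially. (real (a n) / l n) * l n = real (a n)"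
      using ev_l by eventually_elim simp
  qed
  then have a_top: "filterlim a at_top sequentially"
    by (simp add: filterlim_sequentially_iff_filterlim_real)
  have m_real: "filterlim (\<lambda>n. real (m n)) at_top sequentially"
  proof (rule filterlim_at_top_mono[OF l])
    show "\<forall>\<^sub>F n in sequentially. l n \<le> real (m n)"
      using r(1,2) by (intro always_eventually allI) (simp add: l_def mult_left_le less_imp_le)
  qed
  then have m_top: "filterlim m at_top sequentially"
    by (simp add: filterlim_sequentially_iff_filterlim_real)
  have "\<forall>\<^sub>F n in sequentially. real (a n) / real (m n) < 1/2"
    using am by (rule order_tendstoD) simp
  moreover have "\<forall>\<^sub>F n in sequentially. a n > 0" by (rule eventually_compose_filterlim[OF eventually_gt_at_top a_top])
  moreover have "\<forall>\<^sub>F n in sequentially. m n > 0" by (rule eventually_compose_filterlim[OF eventually_gt_at_top m_top])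
  ultimately have ev: "\<forall>\<^sub>F n in sequentially. 0 < a n \<and> 2 * a n < m n"
    by eventually_elim (simp add: field_simps)
  then show ev': "\<forall>\<^sub>F n in sequentially. 0 < a n \<and> a n < m n"
    by eventually_elim simp
  have ma_top: "filterlim (\<lambda>n. m n - a n) at_top sequentially"
  proof (rule filterlim_at_top_mono[OF a_top])
    show "\<forall>\<^sub>F n in sequentially. a n \<le> m n - a n" using ev by eventually_elim linarith
  qed
  define E where "E = (\<lambda>n. real (a n) * ln (real (a n) / l n) + (real (m n) - real (a n)) * ln ((real (m n) - real (a n)) / (real (m n) - l n)))"
  define z where "z = (\<lambda>n. - (eta n * (r n / (1 - r n))))"
  have z: "z \<longlonglongrightarrow> - (0 * (0 / (1 - 0)))"
    unfolding z_def using eta r(3) by (intro tendsto_intros) auto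
  then have z: "z \<longlonglongrightarrow> 0" by simp
  obtain c1 d1 where 1: "d1 > 0" "\<And>z::real. \<bar>z\<bar> < d1 \<Longrightarrow> \<bar>(1 + z) * ln (1 + z) - z\<bar> \<le> c1 * \<bar>z\<bar> ^ 2"
    using entropy_taylor1 by blast
  obtain c2 d2 where 2: "d2 > 0" "\<And>z::real. \<bar>z\<bar> < d2 \<Longrightarrow> \<bar>(1 + z) * ln (1 + z) - z - z\<^sup>2 / 2\<bar> \<le> c2 * \<bar>z\<bar> ^ 3"
    using entropy_taylor2 by blast
  have "\<forall>\<^sub>F n in sequentially. \<bar>eta n\<bar> < d2" using tendsto_rabs[OF eta] \<open>d2 > 0\<close> by (intro order_tendstoD) auto
  moreover have "\<forall>\<^sub>F n in sequentially. \<bar>z n\<bar> < d1" using tendsto_rabs[OF z] \<open>d1 > 0\<close> by (intro order_tendstoD) auto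
  ultimately have bound: "\<forall>\<^sub>F n in sequentially. \<bar>E n - v n ^ 2 / 2\<bar> \<le> c2 * \<bar>v n ^ 3 / sqrt (l n)\<bar> + c1 * ((v n ^ 2 * r n) / (1 - r n))"
    using ev_l ev'
  proof eventually_elim
    case (elim n)
    have lpos: "l n > 0" and m: "real (m n) > 0" using elim by auto
    have r1: "1 - r n > 0" "r n > 0" using r(1,2)[of n] by auto
    have s: "sqrt (l n) * sqrt (l n) = l n" using lpos by simp
    have v2: "v n = eta n * sqrt (l n)" using lpos by (simp add: eta_def)
    have a1: "real (a n) = l n * (1 + eta n)" using lpos s by (simp add: eta_def v_def field_simps)
    have a1': "real (a n) / l n = 1 + eta n" using lpos a1 by simp
    have ml: "real (m n) - l n = real (m n) * (1 - r n)" by (simp add: l_def algebra_simps)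
    have a2: "real (m n) - real (a n) = (real (m n) - l n) * (1 + z n)"
      unfolding ml a1 z_def l_def using r1 by (simp add: field_simps)
    have a2': "(real (m n) - real (a n)) / (real (m n) - l n) = 1 + z n"
      using m r1 unfolding a2 by (simp add: ml)
    have E: "E n = l n * ((1 + eta n) * ln (1 + eta n)) + (real (m n) - l n) * ((1 + z n) * ln (1 + z n))"
      unfolding E_def a1' a2' unfolding a2 unfolding a1 by (simp only: mult.assoc)
    have mlz: "(real (m n) - l n) * z n = - l n * eta n"
      unfolding ml z_def l_def using r1 by (simp add: field_simps)
    have v22: "v n ^ 2 = l n * eta n ^ 2" using v2 s by (simp add: power2_eq_square algebra_simps)
    have "E n - v n ^ 2 / 2 = l n * ((1 + eta n) * ln (1 + eta n) - eta n - eta n ^ 2 / 2)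
       + (real (m n) - l n) * ((1 + z n) * ln (1 + z n) - z n)"
      unfolding E v22 using mlz by (simp add: algebra_simps)
    also have "\<bar>\<dots>\<bar> \<le> \<bar>l n * ((1 + eta n) * ln (1 + eta n) - eta n - eta n ^ 2 / 2)\<bar>
       + \<bar>(real (m n) - l n) * ((1 + z n) * ln (1 + z n) - z n)\<bar>"
      by (rule abs_triangle_ineq)
    also have "\<dots> \<le> l n * (c2 * \<bar>eta n\<bar> ^ 3) + (real (m n) - l n) * (c1 * \<bar>z n\<bar> ^ 2)"
      using lpos m r1 elim unfolding abs_mult ml by (intro add_mono mult_mono 1 2) auto
    also have "l n * (c2 * \<bar>eta n\<bar> ^ 3) = c2 * \<bar>v n ^ 3 / sqrt (l n)\<bar>"
    proof -
      have "v n ^ 3 / sqrt (l n) = eta n ^ 3 * (sqrt (l n) * sqrt (l n))"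
        using lpos unfolding v2 by (simp add: power3_eq_cube field_simps)
      also have "\<bar>\<dots>\<bar> = l n * \<bar>eta n\<bar> ^ 3" using lpos by (simp add: abs_mult power_abs)
      finally show ?thesis by simp
    qed
    also have "(real (m n) - l n) * (c1 * \<bar>z n\<bar> ^ 2) = c1 * ((v n ^ 2 * r n) / (1 - r n))"
    proof -
      define t where "t = 1 - r n"
      have "t > 0" using r1 by (simp add: t_def)
      then show ?thesis
        unfolding ml v22 z_def l_def t_def[symmetric]
        by (simp add: power2_eq_square field_simps) (simp add: t_def algebra_simps)
    qed
    finally show ?case .
  qed
  have "(\<lambda>n. c2 * \<bar>v n ^ 3 / sqrt (l n)\<bar> + c1 * ((v n ^ 2 * r n) / (1 - r n))) \<longlonglongrightarrow> c2 * \<bar>0\<bar> + c1 * (0 / (1 - 0))"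
    using v r(3) by (intro tendsto_intros) auto
  then have "(\<lambda>n. E n - v n ^ 2 / 2) \<longlonglongrightarrow> 0"
    by (intro Lim_null_comparison[OF bound[folded real_norm_def]]) simp
  then have "(\<lambda>n. exp (- (E n - v n ^ 2 / 2))) \<longlonglongrightarrow> exp (- 0)" by (intro tendsto_intros)
  moreover have "(\<lambda>n. stirling_ratio (m n) / (stirling_ratio (a n) * stirling_ratio (m n - a n))) \<longlonglongrightarrow> 1 / (1 * 1)"
    by (intro tendsto_intros filterlim_compose[OF stirling] m_top a_top ma_top) auto
  moreover have "(\<lambda>n. sqrt (inverse (real (a n) / l n))) \<longlonglongrightarrow> sqrt (inverse 1)"
    using al by (intro tendsto_intros) auto
  moreover have "(\<lambda>n. sqrt (1 / (1 - real (a n) / real (m n)))) \<longlonglongrightarrow> sqrt (1 / (1 - 0))"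
    using am by (intro tendsto_intros) auto
  ultimately have lim: "(\<lambda>n. stirling_ratio (m n) / (stirling_ratio (a n) * stirling_ratio (m n - a n)) * sqrt (inverse (real (a n) / l n))
     * sqrt (1 / (1 - real (a n) / real (m n))) * exp (- (E n - v n ^ 2 / 2))) \<longlonglongrightarrow> 1 / (1 * 1) * sqrt (inverse 1) * sqrt (1 / (1 - 0)) * exp (- 0)"
    by (intro tendsto_mult)
  show "(\<lambda>n. binom_prob (m n) (r n) (a n) * sqrt (2 * pi * l n) * exp (v n ^ 2 / 2)) \<longlonglongrightarrow> 1"
  proof (rule Lim_transform_eventually)
    show "(\<lambda>n. stirling_ratio (m n) / (stirling_ratio (a n) * stirling_ratio (m n - a n)) * sqrt (inverse (real (a n) / l n))
     * sqrt (1 / (1 - real (a n) / real (m n))) * exp (- (E n - v n ^ 2 / 2))) \<longlonglongrightarrow> 1"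
      using lim by simp
    show "\<forall>\<^sub>F n in sequentially. stirling_ratio (m n) / (stirling_ratio (a n) * stirling_ratio (m n - a n)) * sqrt (inverse (real (a n) / l n))
     * sqrt (1 / (1 - real (a n) / real (m n))) * exp (- (E n - v n ^ 2 / 2)) = binom_prob (m n) (r n) (a n) * sqrt (2 * pi * l n) * exp (v n ^ 2 / 2)"
      using ev'
    proof eventually_elim
      case (elim n)
      have "exp (- (E n - v n ^ 2 / 2)) = exp (- E n) * exp (v n ^ 2 / 2)"
        by (simp add: exp_add[symmetric])
      then show ?case
        using elim r(1,2)[of n] unfolding l_def
        by (subst binom_prob_stirling) (auto simp: E_def l_def)
    qed
  qed
qed

section \<open>Binomial tails at moderate deviations\<close>

text \<open>Both bounds compare with geometric series. The lower one uses only the first \<open>L\<close> terms, on which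
  the ratios have not yet deteriorated.\<close>

lemma geometric_tail_bounds:
  fixes c :: "nat \<Rightarrow> real"
  assumes c: "\<And>i. c i \<ge> 0"
    and up: "\<And>i. c (Suc i) \<le> q0 * c i" and low: "\<And>i. i < L \<Longrightarrow> q1 * c i \<le> c (Suc i)"
    and q: "0 \<le> q0" "q0 < 1" "0 \<le> q1" "q1 < 1" and LM: "L \<le> M"
  shows "(\<Sum>i<M. c i) \<le> c 0 / (1 - q0)"
    and "c 0 * (1 - exp (- real L * (1 - q1))) / (1 - q1) \<le> (\<Sum>i<M. c i)"
proof -
  have u: "c i \<le> q0 ^ i * c 0" for i
  proof (induction i)
    case (Suc i)
    have "c (Suc i) \<le> q0 * c i" by (rule up)
    also have "\<dots> \<le> q0 * (q0 ^ i * c 0)" using Suc q by (intro mult_left_mono)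
    finally show ?case by simp
  qed simp
  have "(\<Sum>i<M. c i) \<le> (\<Sum>i<M. q0 ^ i * c 0)" by (intro sum_mono u)
  also have "\<dots> = c 0 * ((1 - q0 ^ M) / (1 - q0))"
    using q by (simp add: sum_distrib_right[symmetric] sum_gp_strict)
  also have "\<dots> \<le> c 0 * (1 / (1 - q0))" using q c[of 0] by (intro mult_left_mono divide_right_mono) auto
  finally show "(\<Sum>i<M. c i) \<le> c 0 / (1 - q0)" by simp
  have l: "q1 ^ i * c 0 \<le> c i" if "i \<le> L" for i using that
  proof (induction i)
    case (Suc i)
    have "q1 * (q1 ^ i * c 0) \<le> q1 * c i" using Suc q by (intro mult_left_mono) auto
    also have "\<dots> \<le> c (Suc i)" using Suc by (intro low) auto
    finally show ?case by simp
  qed simp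
  have "q1 ^ L \<le> exp (- real L * (1 - q1))"
  proof -
    have "q1 \<le> exp (- (1 - q1))" using exp_ge_add_one_self[of "- (1 - q1)"] by simp
    then have "q1 ^ L \<le> exp (- (1 - q1)) ^ L" using q by (intro power_mono)
    also have "\<dots> = exp (- real L * (1 - q1))" by (simp add: exp_of_nat_mult[symmetric] algebra_simps)
    finally show ?thesis .
  qed
  then have "c 0 * (1 - exp (- real L * (1 - q1))) / (1 - q1) \<le> c 0 * (1 - q1 ^ L) / (1 - q1)"
    using q c[of 0] by (intro divide_right_mono mult_left_mono) auto
  also have "\<dots> = (\<Sum>i<L. q1 ^ i * c 0)"
    using q by (simp add: sum_distrib_right[symmetric] sum_gp_strict)
  also have "\<dots> \<le> (\<Sum>i<L. c i)" by (intro sum_mono l) auto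
  also have "\<dots> \<le> (\<Sum>i<M. c i)" using LM c by (intro sum_mono2) auto
  finally show "c 0 * (1 - exp (- real L * (1 - q1))) / (1 - q1) \<le> (\<Sum>i<M. c i)" .
qed

text \<open>If the ratios are \<open>1 - \<kappa>(1 + o(1))\<close> over a stretch much longer than \<open>1/\<kappa>\<close>, a sum is its first
  term divided by \<open>\<kappa>\<close>, up to a factor tending to 1.\<close>

lemma geometric_tail_asymptotics:
  fixes c :: "nat \<Rightarrow> nat \<Rightarrow> real" and q0 q1 \<kappa> :: "nat \<Rightarrow> real"
  assumes c: "\<And>n i. c n i \<ge> 0" and c0: "\<forall>\<^sub>F n in sequentially. c n 0 > 0"
    and up: "\<forall>\<^sub>F n in sequentially. \<forall>i. c n (Suc i) \<le> q0 n * c n i"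
    and low: "\<forall>\<^sub>F n in sequentially. \<forall>i<L n. q1 n * c n i \<le> c n (Suc i)"
    and q: "\<forall>\<^sub>F n in sequentially. 0 \<le> q0 n \<and> 0 \<le> q1 n" and LM: "\<forall>\<^sub>F n in sequentially. L n \<le> M n"
    and k: "\<forall>\<^sub>F n in sequentially. \<kappa> n > 0"
    and q0: "(\<lambda>n. (1 - q0 n) / \<kappa> n) \<longlonglongrightarrow> 1" and q1: "(\<lambda>n. (1 - q1 n) / \<kappa> n) \<longlonglongrightarrow> 1"
    and Lk: "filterlim (\<lambda>n. real (L n) * \<kappa> n) at_top sequentially"
  shows "(\<lambda>n. (\<Sum>i<M n. c n i) * \<kappa> n / c n 0) \<longlonglongrightarrow> 1"
proof -
  have p: "\<forall>\<^sub>F n in sequentially. (1 - q0 n) / \<kappa> n > 0" "\<forall>\<^sub>F n in sequentially. (1 - q1 n) / \<kappa> n > 0"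
    using order_tendstoD(1)[OF q0, of 0] order_tendstoD(1)[OF q1, of 0] by auto
  define E where "E = (\<lambda>n. exp (- (((1 - q1 n) / \<kappa> n) * (real (L n) * \<kappa> n))))"
  have "filterlim (\<lambda>n. ((1 - q1 n) / \<kappa> n) * (real (L n) * \<kappa> n)) at_top sequentially"
    by (rule filterlim_tendsto_pos_mult_at_top[OF q1 _ Lk]) simp
  then have E: "E \<longlonglongrightarrow> 0"
    unfolding E_def by (intro filterlim_compose[OF exp_at_bot]) (simp add: filterlim_uminus_at_bot)
  have "\<forall>\<^sub>F n in sequentially. (1 - E n) / ((1 - q1 n) / \<kappa> n) \<le> (\<Sum>i<M n. c n i) * \<kappa> n / c n 0
      \<and> (\<Sum>i<M n. c n i) * \<kappa> n / c n 0 \<le> 1 / ((1 - q0 n) / \<kappa> n)"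
    using c0 up low q LM k p
  proof eventually_elim
    case (elim n)
    then have lt: "q0 n < 1" "q1 n < 1" by (auto simp: zero_less_divide_iff)
    note b = geometric_tail_bounds[of "c n" "q0 n" "L n" "q1 n" "M n"]
    have 1: "(\<Sum>i<M n. c n i) \<le> c n 0 / (1 - q0 n)"
      using elim lt c by (intro b(1)) auto
    have 2: "c n 0 * (1 - exp (- real (L n) * (1 - q1 n))) / (1 - q1 n) \<le> (\<Sum>i<M n. c n i)"
      using elim lt c by (intro b(2)) auto
    have EE: "E n = exp (- real (L n) * (1 - q1 n))" using elim by (simp add: E_def)
    have "(1 - E n) / ((1 - q1 n) / \<kappa> n) = (c n 0 * (1 - E n) / (1 - q1 n)) * (\<kappa> n / c n 0)"
      using elim by simp
    also have "\<dots> \<le> (\<Sum>i<M n. c n i) * (\<kappa> n / c n 0)"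
      using elim 2 unfolding EE by (intro mult_right_mono) auto
    finally have 3: "(1 - E n) / ((1 - q1 n) / \<kappa> n) \<le> (\<Sum>i<M n. c n i) * \<kappa> n / c n 0" by simp
    have "(\<Sum>i<M n. c n i) * (\<kappa> n / c n 0) \<le> c n 0 / (1 - q0 n) * (\<kappa> n / c n 0)"
      using elim 1 by (intro mult_right_mono) auto
    also have "\<dots> = 1 / ((1 - q0 n) / \<kappa> n)" using elim by simp
    finally show ?case using 3 by simp
  qed
  then have ev: "\<forall>\<^sub>F n in sequentially. (1 - E n) / ((1 - q1 n) / \<kappa> n) \<le> (\<Sum>i<M n. c n i) * \<kappa> n / c n 0"
     "\<forall>\<^sub>F n in sequentially. (\<Sum>i<M n. c n i) * \<kappa> n / c n 0 \<le> 1 / ((1 - q0 n) / \<kappa> n)"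
    by (auto elim: eventually_mono)
  have "(\<lambda>n. (1 - E n) / ((1 - q1 n) / \<kappa> n)) \<longlonglongrightarrow> (1 - 0) / 1"
    using E q1 by (intro tendsto_intros) auto
  moreover have "(\<lambda>n. 1 / ((1 - q0 n) / \<kappa> n)) \<longlonglongrightarrow> 1 / 1"
    using q0 by (intro tendsto_intros) auto
  ultimately show ?thesis
    using tendsto_sandwich[OF ev] by simp
qed

lemma binom_prob_nonneg: "0 \<le> r \<Longrightarrow> r \<le> 1 \<Longrightarrow> binom_prob m r k \<ge> 0"
  by (simp add: binom_prob_def)

lemma binom_prob_Suc:
  assumes "0 < r" "r < 1"
  shows "binom_prob m r (Suc k) * (real (Suc k) * (1 - r)) = binom_prob m r k * ((real m - real k) * r)"
proof (cases "k < m")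
  case True
  then obtain d where m: "m = Suc (k + d)" using less_iff_Suc_add by auto
  have "real (Suc k) * real (m choose Suc k) = real (m - k) * real (m choose k)"
    using binomial_absorb_comp[of m k] binomial_absorption[of k m] by (metis of_nat_mult)
  moreover have "real (m - k) = real m - real k" using True by simp
  ultimately have ch: "real (m choose Suc k) * real (Suc k) = (real m - real k) * real (m choose k)" by (simp add: mult.commute)
  have pw: "(1 - r) ^ (m - k) = (1 - r) * (1 - r) ^ (m - Suc k)" by (simp add: m)
  have "binom_prob m r (Suc k) * (real (Suc k) * (1 - r)) = (real (m choose Suc k) * real (Suc k)) * (r ^ Suc k * ((1 - r) * (1 - r) ^ (m - Suc k)))"
    by (simp add: binom_prob_def)
  also have "\<dots> = binom_prob m r k * ((real m - real k) * r)"
    unfolding ch pw[symmetric] by (simp add: binom_prob_def)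
  finally show ?thesis .
next
  case False
  then show ?thesis by (cases "k = m") (auto simp: binom_prob_def binomial_eq_0)
qed

lemma sum_reindex_from:
  fixes f :: "nat \<Rightarrow> real" assumes "a \<le> m"
  shows "(\<Sum>k\<in>{a..m}. f k) = (\<Sum>i<m - a + 1. f (a + i))"
  by (rule sum.reindex_bij_witness[of _ "\<lambda>i. a + i" "\<lambda>k. k - a"]) (use assms in auto)

lemma sum_reindex_down:
  fixes f :: "nat \<Rightarrow> real"
  shows "(\<Sum>k\<le>a. f k) = (\<Sum>i<Suc a. if i \<le> a then f (a - i) else 0)"
  by (rule sum.reindex_bij_witness[of _ "\<lambda>i. a - i" "\<lambda>k. a - k"]) auto

lemma ceiling_sqrt_asymptotics:
  fixes l :: "nat \<Rightarrow> real"
  assumes l: "filterlim l at_top sequentially"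
  defines "L \<equiv> \<lambda>n. nat \<lceil>sqrt (l n)\<rceil>"
  shows "\<forall>\<^sub>F n in sequentially. real (L n) \<le> sqrt (l n) + 1"
    and "(\<lambda>n. real (L n) / sqrt (l n)) \<longlonglongrightarrow> 1" and "(\<lambda>n. real (L n) / l n) \<longlonglongrightarrow> 0"
proof -
  have sl: "filterlim (\<lambda>n. sqrt (l n)) at_top sequentially"
    by (rule filterlim_compose[OF sqrt_at_top l])
  have isl: "(\<lambda>n. 1 / sqrt (l n)) \<longlonglongrightarrow> 0"
    by (rule tendsto_divide_0[OF tendsto_const filterlim_at_top_imp_at_infinity[OF sl]])
  have ev_l: "\<forall>\<^sub>F n in sequentially. l n > 1" using l by (simp add: filterlim_at_top_dense)
  have Lb: "\<forall>\<^sub>F n in sequentially. sqrt (l n) \<le> real (L n) \<and> real (L n) \<le> sqrt (l n) + 1"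
    using ev_l
  proof eventually_elim
    case (elim n)
    then have "0 \<le> sqrt (l n)" by simp
    then have "0 \<le> \<lceil>sqrt (l n)\<rceil>" by linarith
    then have "real (L n) = of_int \<lceil>sqrt (l n)\<rceil>" by (simp add: L_def)
    then show ?case using ceiling_correct[of "sqrt (l n)"] by linarith
  qed
  then show "\<forall>\<^sub>F n in sequentially. real (L n) \<le> sqrt (l n) + 1" by eventually_elim simp
  show L1: "(\<lambda>n. real (L n) / sqrt (l n)) \<longlonglongrightarrow> 1"
  proof (rule tendsto_sandwich)
    show "\<forall>\<^sub>F n in sequentially. 1 \<le> real (L n) / sqrt (l n)"
      using Lb ev_l by eventually_elim (simp add: field_simps)
    show "\<forall>\<^sub>F n in sequentially. real (L n) / sqrt (l n) \<le> 1 + 1 / sqrt (l n)"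
      using Lb ev_l by eventually_elim (simp add: field_simps)
    show "(\<lambda>n. 1 + 1 / sqrt (l n)) \<longlonglongrightarrow> 1" using tendsto_add[OF tendsto_const isl] by simp
  qed simp
  show "(\<lambda>n. real (L n) / l n) \<longlonglongrightarrow> 0"
  proof (rule Lim_transform_eventually)
    show "(\<lambda>n. real (L n) / sqrt (l n) * (1 / sqrt (l n))) \<longlonglongrightarrow> 0" using tendsto_mult[OF L1 isl] by simp
    show "\<forall>\<^sub>F n in sequentially. real (L n) / sqrt (l n) * (1 / sqrt (l n)) = real (L n) / l n"
      using ev_l by eventually_elim simp
  qed
qed

text \<open>The reason for Mills' ratio in both binomial tails. At distance $v\sqrt l$ from the mean the ratio of
  consecutive terms is $1 - (v/\sqrt l)(1+o(1))$, and it stays so over a stretch of $\sqrt l$ further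
  terms, which is short against the distance but long against $\sqrt l/v$. Beyond it, monotonicity of the
  ratios is enough.\<close>

lemma mills_ratio_sum:
  fixes c q :: "nat \<Rightarrow> nat \<Rightarrow> real" and v l :: "nat \<Rightarrow> real" and M :: "nat \<Rightarrow> nat"
  assumes l: "filterlim l at_top sequentially" and vt: "filterlim v at_top sequentially"
    and c: "\<And>n i. c n i \<ge> 0" "\<forall>\<^sub>F n in sequentially. c n 0 > 0"
    and c_Suc: "\<forall>\<^sub>F n in sequentially. \<forall>i. c n (Suc i) = q n i * c n i"
    and q_mono: "\<forall>\<^sub>F n in sequentially. antimono (q n)"
    and q_nonneg: "\<forall>\<^sub>F n in sequentially. 0 \<le> q n (nat \<lceil>sqrt (l n)\<rceil>)"
    and LM: "\<forall>\<^sub>F n in sequentially. nat \<lceil>sqrt (l n)\<rceil> \<le> M n"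
    and key: "\<And>I :: nat \<Rightarrow> nat. (\<lambda>n. real (I n) / (v n * sqrt (l n))) \<longlonglongrightarrow> 0 \<Longrightarrow> (\<lambda>n. real (I n) / l n) \<longlonglongrightarrow> 0 \<Longrightarrow>
      (\<lambda>n. (1 - q n (I n)) / (v n / sqrt (l n))) \<longlonglongrightarrow> 1"
  shows "(\<lambda>n. (\<Sum>i<M n. c n i) * (v n / sqrt (l n)) / c n 0) \<longlonglongrightarrow> 1"
proof -
  define L where "L n = nat \<lceil>sqrt (l n)\<rceil>" for n
  note L1 = ceiling_sqrt_asymptotics(2)[OF l, folded L_def] and Ll = ceiling_sqrt_asymptotics(3)[OF l, folded L_def]
  have ev_l: "\<forall>\<^sub>F n in sequentially. l n > 1" using l by (simp add: filterlim_at_top_dense)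
  have ev_v: "\<forall>\<^sub>F n in sequentially. v n > 1" using vt by (simp add: filterlim_at_top_dense)
  show ?thesis
  proof (rule geometric_tail_asymptotics[where ?q0.0 = "\<lambda>n. q n 0" and ?q1.0 = "\<lambda>n. q n (L n)" and L = L])
    show "\<forall>\<^sub>F n in sequentially. \<forall>i. c n (Suc i) \<le> q n 0 * c n i"
      using c_Suc q_mono
    proof eventually_elim
      case (elim n)
      show ?case
      proof
        fix i show "c n (Suc i) \<le> q n 0 * c n i"
          using elim(1) antimonoD[OF elim(2), of 0 i] by (simp add: mult_right_mono c(1))
      qed
    qed
    show "\<forall>\<^sub>F n in sequentially. \<forall>i<L n. q n (L n) * c n i \<le> c n (Suc i)"
      using c_Suc q_mono
    proof eventually_elim
      case (elim n)
      show ?case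
      proof (intro allI impI)
        fix i assume "i < L n"
        then show "q n (L n) * c n i \<le> c n (Suc i)"
          using elim(1) antimonoD[OF elim(2), of i "L n"] by (simp add: mult_right_mono c(1))
      qed
    qed
    show "\<forall>\<^sub>F n in sequentially. 0 \<le> q n 0 \<and> 0 \<le> q n (L n)"
      using q_nonneg q_mono unfolding L_def by eventually_elim (auto intro: order_trans antimonoD)
    show "\<forall>\<^sub>F n in sequentially. v n / sqrt (l n) > 0" using ev_l ev_v by eventually_elim simp
    show "(\<lambda>n. (1 - q n 0) / (v n / sqrt (l n))) \<longlonglongrightarrow> 1" using key[of "\<lambda>_. 0"] by simp
    have "(\<lambda>n. real (L n) / sqrt (l n) * (1 / v n)) \<longlonglongrightarrow> 1 * 0"
      by (intro tendsto_mult L1 tendsto_divide_0[OF tendsto_const filterlim_at_top_imp_at_infinity[OF vt]])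
    then show "(\<lambda>n. (1 - q n (L n)) / (v n / sqrt (l n))) \<longlonglongrightarrow> 1"
      by (intro key Ll) (simp add: mult.commute)
    have "filterlim (\<lambda>n. (real (L n) / sqrt (l n)) * v n) at_top sequentially"
      by (rule filterlim_tendsto_pos_mult_at_top[OF L1 _ vt]) simp
    then show "filterlim (\<lambda>n. real (L n) * (v n / sqrt (l n))) at_top sequentially" by simp
  qed (use c LM in \<open>simp_all add: L_def\<close>)
qed

lemma binomial_upper_tail:
  fixes m a :: "nat \<Rightarrow> nat" and r :: "nat \<Rightarrow> real"
  defines "l \<equiv> \<lambda>n. real (m n) * r n"
  defines "v \<equiv> \<lambda>n. (real (a n) - l n) / sqrt (l n)"
  assumes r: "\<And>n. 0 < r n" "\<And>n. r n < 1" "r \<longlonglongrightarrow> 0"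
    and l: "filterlim l at_top sequentially"
    and v: "(\<lambda>n. v n / sqrt (l n)) \<longlonglongrightarrow> 0" "(\<lambda>n. v n ^ 3 / sqrt (l n)) \<longlonglongrightarrow> 0" "(\<lambda>n. v n ^ 2 * r n) \<longlonglongrightarrow> 0"
    and vt: "filterlim v at_top sequentially"
  shows "(\<lambda>n. (\<Sum>k\<in>{a n..m n}. binom_prob (m n) (r n) k) * v n * sqrt (2 * pi) * exp (v n ^ 2 / 2)) \<longlonglongrightarrow> 1"
proof -
  note local_limit = binomial_local_limit[of r m a, OF r l[unfolded l_def] v[unfolded v_def l_def]]
  have loc: "(\<lambda>n. binom_prob (m n) (r n) (a n) * sqrt (2 * pi * l n) * exp (v n ^ 2 / 2)) \<longlonglongrightarrow> 1"
    "\<forall>\<^sub>F n in sequentially. 0 < a n \<and> a n < m n" "(\<lambda>n. real (a n) / l n) \<longlonglongrightarrow> 1"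
    using local_limit unfolding v_def l_def by blast+
  define L where "L n = nat \<lceil>sqrt (l n)\<rceil>" for n
  define q where "q = (\<lambda>n i. 1 - (real (a n) + real i + 1 - r n - l n) / ((real (a n) + real i + 1) * (1 - r n)))"
  define c where "c = (\<lambda>n i. binom_prob (m n) (r n) (a n + i))"
  have r': "r n \<ge> 0" "r n \<le> 1" for n using r(1,2)[of n] by auto
  have ev_l: "\<forall>\<^sub>F n in sequentially. l n > 1" using l by (simp add: filterlim_at_top_dense)
  have ev_v: "\<forall>\<^sub>F n in sequentially. v n > 1" using vt by (simp add: filterlim_at_top_dense)
  have sl: "filterlim (\<lambda>n. sqrt (l n)) at_top sequentially"
    by (rule filterlim_compose[OF sqrt_at_top l])
  note Lb = ceiling_sqrt_asymptotics(1)[OF l, folded L_def]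
  have q_eq: "q n i = ((real (m n) - (real (a n) + real i)) * r n) / ((real (a n) + real i + 1) * (1 - r n))" for n i
  proof -
    have "(real (a n) + real i + 1) * (1 - r n) \<noteq> 0"
      using r(2)[of n] by (simp add: add_nonneg_eq_0_iff)
    then show ?thesis
      unfolding q_def l_def by (simp add: divide_simps) (simp add: algebra_simps)
  qed
  have c_Suc: "c n (Suc i) = q n i * c n i" for n i
  proof -
    have "(real (a n) + real i + 1) * (1 - r n) \<noteq> 0"
      using r(2)[of n] by (simp add: add_nonneg_eq_0_iff)
    then show ?thesis
      using binom_prob_Suc[OF r(1)[of n] r(2)[of n], of "m n" "a n + i"] unfolding q_eq c_def
      by (simp add: field_simps)
  qed
  have q_mono: "q n i \<le> q n j" if "j \<le> i" "0 \<le> l n" for n i j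
  proof -
    have "(real (a n) + real j + 1 - r n - l n) / ((real (a n) + real j + 1) * (1 - r n)) \<le>
       (real (a n) + real i + 1 - r n - l n) / ((real (a n) + real i + 1) * (1 - r n))"
    proof -
      have *: "(t - s) / (t * w) = (1 - s / t) / w" if "t > 0" for t s w :: real
        using that by (simp add: field_simps)
      have "s / (real (a n) + real i + 1) \<le> s / (real (a n) + real j + 1)" if "s \<ge> 0" for s
        using that \<open>j \<le> i\<close> by (intro divide_left_mono) auto
      from this[of "r n + l n"] show ?thesis
        using *[of "real (a n) + real j + 1" "r n + l n" "1 - r n"] *[of "real (a n) + real i + 1" "r n + l n" "1 - r n"]
          r'[of n] that r(2)[of n] by (simp add: diff_diff_eq divide_right_mono)
    qed
    then show ?thesis by (simp add: q_def)
  qed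
  have LM: "\<forall>\<^sub>F n in sequentially. L n \<le> m n - a n \<and> 0 < a n \<and> a n < m n"
  proof -
    have "(\<lambda>n. (l n / real (m n)) + (real (a n) / l n) * (l n / real (m n)) + 1 / (l n) * (l n / real (m n))) \<longlonglongrightarrow> 0 + 1 * 0 + 0 * 0"
    proof (intro tendsto_intros loc(3))
      have "\<forall>\<^sub>F n in sequentially. r n = l n / real (m n)"
        using loc(2) by eventually_elim (auto simp: l_def)
      then show *: "(\<lambda>n. l n / real (m n)) \<longlonglongrightarrow> 0" using r(3) by (rule Lim_transform_eventually[rotated])
      show "(\<lambda>n. l n / real (m n)) \<longlonglongrightarrow> 0" by (rule *)
      show "(\<lambda>n. l n / real (m n)) \<longlonglongrightarrow> 0" by (rule *)
      show "(\<lambda>n. 1 / l n) \<longlonglongrightarrow> 0" by (rule tendsto_divide_0[OF tendsto_const filterlim_at_top_imp_at_infinity[OF l]])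
    qed
    then have "\<forall>\<^sub>F n in sequentially. (l n / real (m n)) + (real (a n) / l n) * (l n / real (m n)) + 1 / (l n) * (l n / real (m n)) < 1"
      by (rule order_tendstoD) simp
    then show ?thesis using loc(2) ev_l Lb
    proof eventually_elim
      case (elim n)
      have "sqrt (l n) \<le> l n" using elim by (intro real_le_lsqrt) (auto simp: power2_eq_square)
      moreover have "l n + real (a n) + 1 < real (m n)"
        using elim by (simp add: field_simps)
      ultimately have "real (L n + a n) < real (m n)" using elim by simp
      then show ?case using elim by linarith
    qed
  qed
  have key: "(\<lambda>n. (1 - q n (I n)) / (v n / sqrt (l n))) \<longlonglongrightarrow> 1"
    if I: "(\<lambda>n. real (I n) / (v n * sqrt (l n))) \<longlonglongrightarrow> 0" "(\<lambda>n. real (I n) / l n) \<longlonglongrightarrow> 0" for I :: "nat \<Rightarrow> nat"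
  proof (rule Lim_transform_eventually)
    have vl: "filterlim (\<lambda>n. v n * sqrt (l n)) at_top sequentially"
      by (rule filterlim_at_top_mult_at_top[OF vt sl])
    have 0: "(\<lambda>n. (1 - r n) / (v n * sqrt (l n))) \<longlonglongrightarrow> 0"
      by (rule tendsto_divide_0[OF tendsto_diff[OF tendsto_const r(3)] filterlim_at_top_imp_at_infinity[OF vl]])
    have 1: "(\<lambda>n. 1 / l n) \<longlonglongrightarrow> 0" by (rule tendsto_divide_0[OF tendsto_const filterlim_at_top_imp_at_infinity[OF l]])
    have "(\<lambda>n. (1 + (real (I n) / (v n * sqrt (l n)) + (1 - r n) / (v n * sqrt (l n)))) / ((real (a n) / l n + real (I n) / l n + 1 / l n) * (1 - r n)))
       \<longlonglongrightarrow> (1 + (0 + 0)) / ((1 + 0 + 0) * (1 - 0))"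
      by (intro tendsto_intros I 0 1 r(3) loc(3)) auto
    then show "(\<lambda>n. (1 + (real (I n) / (v n * sqrt (l n)) + (1 - r n) / (v n * sqrt (l n)))) / ((real (a n) / l n + real (I n) / l n + 1 / l n) * (1 - r n))) \<longlonglongrightarrow> 1"
      by simp
    show "\<forall>\<^sub>F n in sequentially. (1 + (real (I n) / (v n * sqrt (l n)) + (1 - r n) / (v n * sqrt (l n)))) / ((real (a n) / l n + real (I n) / l n + 1 / l n) * (1 - r n))
       = (1 - q n (I n)) / (v n / sqrt (l n))"
      using ev_l ev_v
    proof eventually_elim
      case (elim n)
      define s where "s = sqrt (l n)"
      have s: "s > 0" "l n = s * s" using elim by (auto simp: s_def)
      have a: "real (a n) - l n = v n * s" using s by (simp add: v_def s_def[symmetric])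
      have A: "1 + (real (I n) / (v n * s) + (1 - r n) / (v n * s)) = (v n * s + real (I n) + 1 - r n) / (v n * s)"
        using s elim by (simp add: field_simps)
      have B: "real (a n) / l n + real (I n) / l n + 1 / l n = (real (a n) + real (I n) + 1) / (s * s)"
        using s by (simp add: field_simps)
      have C: "1 - q n (I n) = (v n * s + real (I n) + 1 - r n) / ((real (a n) + real (I n) + 1) * (1 - r n))"
        by (simp add: q_def a[symmetric])
      show ?case unfolding s_def[symmetric] A B C using s elim by (simp add: divide_simps)
    qed
  qed
  have tail: "(\<lambda>n. (\<Sum>i<m n - a n + 1. c n i) * (v n / sqrt (l n)) / c n 0) \<longlonglongrightarrow> 1"
  proof (rule mills_ratio_sum[OF l vt _ _ _ _ _ _ key])
    show "c n i \<ge> 0" for n i unfolding c_def by (auto intro: binom_prob_nonneg r')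
    show "\<forall>\<^sub>F n in sequentially. c n 0 > 0"
      using loc(2) by eventually_elim (use r in \<open>auto simp: c_def binom_prob_def zero_less_binomial_iff\<close>)
    show "\<forall>\<^sub>F n in sequentially. \<forall>i. c n (Suc i) = q n i * c n i"
      using loc(2) by eventually_elim (simp add: c_Suc)
    show "\<forall>\<^sub>F n in sequentially. antimono (q n)"
      using loc(2) ev_l by eventually_elim (simp add: antimono_def q_mono)
    show "\<forall>\<^sub>F n in sequentially. 0 \<le> q n (nat \<lceil>sqrt (l n)\<rceil>)"
      using LM unfolding L_def[symmetric]
    proof eventually_elim
      case (elim n)
      then have "real (a n) + real (L n) \<le> real (m n)" by linarith
      then show ?case unfolding q_eq using r' elim by (auto intro!: divide_nonneg_nonneg mult_nonneg_nonneg)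
    qed
    show "\<forall>\<^sub>F n in sequentially. nat \<lceil>sqrt (l n)\<rceil> \<le> m n - a n + 1"
      using LM unfolding L_def[symmetric] by eventually_elim simp
  qed
  have "(\<lambda>n. ((\<Sum>i<m n - a n + 1. c n i) * (v n / sqrt (l n)) / c n 0) * (binom_prob (m n) (r n) (a n) * sqrt (2 * pi * l n) * exp (v n ^ 2 / 2))) \<longlonglongrightarrow> 1 * 1"
    by (intro tendsto_mult tail loc(1))
  then have "(\<lambda>n. ((\<Sum>i<m n - a n + 1. c n i) * (v n / sqrt (l n)) / c n 0) * (binom_prob (m n) (r n) (a n) * sqrt (2 * pi * l n) * exp (v n ^ 2 / 2))) \<longlonglongrightarrow> 1"
    by simp
  then show ?thesis
  proof (rule Lim_transform_eventually)
    show "\<forall>\<^sub>F n in sequentially. ((\<Sum>i<m n - a n + 1. c n i) * (v n / sqrt (l n)) / c n 0) * (binom_prob (m n) (r n) (a n) * sqrt (2 * pi * l n) * exp (v n ^ 2 / 2))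
       = (\<Sum>k\<in>{a n..m n}. binom_prob (m n) (r n) k) * v n * sqrt (2 * pi) * exp (v n ^ 2 / 2)"
      using LM ev_l
    proof eventually_elim
      case (elim n)
      have "c n 0 > 0" using elim r(1,2)[of n] by (auto simp: c_def binom_prob_def zero_less_binomial_iff)
      moreover have "c n 0 = binom_prob (m n) (r n) (a n)" by (simp add: c_def)
      moreover have "sqrt (2 * pi * l n) = sqrt (2 * pi) * sqrt (l n)" by (simp add: real_sqrt_mult)
      moreover have "(\<Sum>k\<in>{a n..m n}. binom_prob (m n) (r n) k) = (\<Sum>i<m n - a n + 1. c n i)"
        unfolding c_def using elim by (intro sum_reindex_from) simp
      ultimately show ?case using elim by simp
    qed
  qed
qed

text \<open>The mirror image of \<open>binomial_upper_tail\<close>, summing downwards from \<open>a n\<close>. The terms are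
  continued by 0 past the end of the range, consistently with the ratio, which vanishes there.\<close>

lemma binomial_lower_tail:
  fixes m a :: "nat \<Rightarrow> nat" and r :: "nat \<Rightarrow> real"
  defines "l \<equiv> \<lambda>n. real (m n) * r n"
  defines "v \<equiv> \<lambda>n. (l n - real (a n)) / sqrt (l n)"
  assumes r: "\<And>n. 0 < r n" "\<And>n. r n < 1" "r \<longlonglongrightarrow> 0"
    and l: "filterlim l at_top sequentially"
    and v: "(\<lambda>n. v n / sqrt (l n)) \<longlonglongrightarrow> 0" "(\<lambda>n. v n ^ 3 / sqrt (l n)) \<longlonglongrightarrow> 0" "(\<lambda>n. v n ^ 2 * r n) \<longlonglongrightarrow> 0"
    and vt: "filterlim v at_top sequentially"
  shows "(\<lambda>n. (\<Sum>k\<le>a n. binom_prob (m n) (r n) k) * v n * sqrt (2 * pi) * exp (v n ^ 2 / 2)) \<longlonglongrightarrow> 1"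
proof -
  have l_def': "real (m n) * r n = l n" for n by (simp add: l_def)
  have vm: "(real (a n) - l n) / sqrt (l n) = - v n" for n
    unfolding v_def by (simp add: minus_divide_left)
  have "(\<lambda>n. - (v n / sqrt (l n))) \<longlonglongrightarrow> - 0" "(\<lambda>n. - (v n ^ 3 / sqrt (l n))) \<longlonglongrightarrow> - 0"
    using v(1,2) by (intro tendsto_minus; simp)+
  then have v': "(\<lambda>n. - v n / sqrt (l n)) \<longlonglongrightarrow> 0"
    "(\<lambda>n. (- v n) ^ 3 / sqrt (l n)) \<longlonglongrightarrow> 0"
    "(\<lambda>n. (- v n) ^ 2 * r n) \<longlonglongrightarrow> 0"
    using v(3) by simp_all
  note local_limit = binomial_local_limit[of r m a, unfolded l_def' vm, OF r l v']
  have loc: "(\<lambda>n. binom_prob (m n) (r n) (a n) * sqrt (2 * pi * l n) * exp (v n ^ 2 / 2)) \<longlonglongrightarrow> 1"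
    "\<forall>\<^sub>F n in sequentially. 0 < a n \<and> a n < m n" "(\<lambda>n. real (a n) / l n) \<longlonglongrightarrow> 1"
    using local_limit by simp_all
  define L where "L n = nat \<lceil>sqrt (l n)\<rceil>" for n
  define q where "q = (\<lambda>n i. 1 - (l n - real (a n) + real i + r n) / ((real (m n) - real (a n) + real i + 1) * r n))"
  define c where "c = (\<lambda>n i. if i \<le> a n then binom_prob (m n) (r n) (a n - i) else 0)"
  have r': "r n \<ge> 0" "r n \<le> 1" for n using r(1,2)[of n] by auto
  have ev_l: "\<forall>\<^sub>F n in sequentially. l n > 1" using l by (simp add: filterlim_at_top_dense)
  have ev_v: "\<forall>\<^sub>F n in sequentially. v n > 1" using vt by (simp add: filterlim_at_top_dense)
  have sl: "filterlim (\<lambda>n. sqrt (l n)) at_top sequentially"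
    by (rule filterlim_compose[OF sqrt_at_top l])
  note Lb = ceiling_sqrt_asymptotics(1)[OF l, folded L_def] and Ll = ceiling_sqrt_asymptotics(3)[OF l, folded L_def]
  have q_eq: "q n i = ((real (a n) - real i) * (1 - r n)) / ((real (m n) - real (a n) + real i + 1) * r n)"
    if "a n < m n" for n i
  proof -
    have "(real (m n) - real (a n) + real i + 1) * r n \<noteq> 0"
      using r(1)[of n] that by simp
    then show ?thesis
      unfolding q_def l_def by (simp add: divide_simps) (simp add: algebra_simps)
  qed
  have c_Suc: "c n (Suc i) = q n i * c n i" if "a n < m n" for n i
  proof (cases "Suc i \<le> a n")
    case True
    define k where "k = a n - Suc i"
    have k: "a n - i = Suc k" "real (a n) = real k + real i + 1" using True by (auto simp: k_def)
    have nz: "(real (m n) - real (a n) + real i + 1) * r n > 0"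
      using r(1)[of n] that by (intro mult_pos_pos) auto
    have "c n (Suc i) * ((real (m n) - real (a n) + real i + 1) * r n) = ((real (a n) - real i) * (1 - r n)) * c n i"
      using binom_prob_Suc[OF r(1)[of n] r(2)[of n], of "m n" k] True k
      by (simp add: c_def k_def[symmetric] algebra_simps)
    then show ?thesis
      using nz unfolding q_eq[OF that] by (simp add: field_simps)
  next
    case False
    then show ?thesis using that by (cases "i = a n") (auto simp: c_def q_eq)
  qed
  have q_mono: "q n i \<le> q n j" if "j \<le> i" "a n < m n" for n i j
  proof -
    define w where "w = real (m n) - real (a n)"
    have w: "w > 0" using that by (simp add: w_def)
    define s where "s = real (m n) - l n + 1 - r n"
    have "l n \<le> real (m n)" using r'[of n] by (simp add: l_def mult_left_le)
    then have s: "s \<ge> 0" using r'[of n] by (simp add: s_def)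
    have *: "q n k = 1 - (1 - s / (w + real k + 1)) / r n" for k
    proof -
      have "l n - real (a n) + real k + r n = (w + real k + 1) - s" by (simp add: w_def s_def)
      then have "(l n - real (a n) + real k + r n) / ((w + real k + 1) * r n) = (1 - s / (w + real k + 1)) / r n"
        using w r(1)[of n] by (simp add: field_simps)
      then show ?thesis by (simp add: q_def w_def)
    qed
    have "s / (w + real i + 1) \<le> s / (w + real j + 1)"
      using w s that by (intro divide_left_mono) auto
    then have "(1 - s / (w + real j + 1)) / r n \<le> (1 - s / (w + real i + 1)) / r n"
      using r(1)[of n] by (intro divide_right_mono) auto
    then show ?thesis by (simp add: *)
  qed
  have LM: "\<forall>\<^sub>F n in sequentially. L n \<le> a n \<and> 0 < a n \<and> a n < m n"
  proof -
    have "\<forall>\<^sub>F n in sequentially. real (L n) / l n < 1/2" by (rule order_tendstoD[OF Ll]) simp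
    moreover have "\<forall>\<^sub>F n in sequentially. real (a n) / l n > 1/2" by (rule order_tendstoD[OF loc(3)]) simp
    ultimately show ?thesis using loc(2) ev_l by eventually_elim (simp add: field_simps)
  qed
  have key: "(\<lambda>n. (1 - q n (I n)) / (v n / sqrt (l n))) \<longlonglongrightarrow> 1"
    if I: "(\<lambda>n. real (I n) / (v n * sqrt (l n))) \<longlonglongrightarrow> 0" "(\<lambda>n. real (I n) / l n) \<longlonglongrightarrow> 0" for I :: "nat \<Rightarrow> nat"
  proof (rule Lim_transform_eventually)
    have vl: "filterlim (\<lambda>n. v n * sqrt (l n)) at_top sequentially"
      by (rule filterlim_at_top_mult_at_top[OF vt sl])
    have 0: "(\<lambda>n. r n / (v n * sqrt (l n))) \<longlonglongrightarrow> 0"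
      by (rule tendsto_divide_0[OF r(3) filterlim_at_top_imp_at_infinity[OF vl]])
    have 1: "(\<lambda>n. 1 / l n) \<longlonglongrightarrow> 0" by (rule tendsto_divide_0[OF tendsto_const filterlim_at_top_imp_at_infinity[OF l]])
    have "(\<lambda>n. (1 + (real (I n) / (v n * sqrt (l n)) + r n / (v n * sqrt (l n)))) / (1 - real (a n) / l n * r n + real (I n) / l n * r n + 1 / l n * r n))
       \<longlonglongrightarrow> (1 + (0 + 0)) / (1 - 1 * 0 + 0 * 0 + 0 * 0)"
      by (intro tendsto_intros I 0 1 r(3) loc(3)) auto
    then show "(\<lambda>n. (1 + (real (I n) / (v n * sqrt (l n)) + r n / (v n * sqrt (l n)))) / (1 - real (a n) / l n * r n + real (I n) / l n * r n + 1 / l n * r n)) \<longlonglongrightarrow> 1"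
      by simp
    show "\<forall>\<^sub>F n in sequentially. (1 + (real (I n) / (v n * sqrt (l n)) + r n / (v n * sqrt (l n)))) / (1 - real (a n) / l n * r n + real (I n) / l n * r n + 1 / l n * r n)
       = (1 - q n (I n)) / (v n / sqrt (l n))"
      using ev_l ev_v
    proof eventually_elim
      case (elim n)
      define s where "s = sqrt (l n)"
      have s: "s > 0" "l n = s * s" using elim by (auto simp: s_def)
      have a: "l n - real (a n) = v n * s" using s by (simp add: v_def s_def[symmetric])
      have A: "1 + (real (I n) / (v n * s) + r n / (v n * s)) = (v n * s + real (I n) + r n) / (v n * s)"
        using s elim by (simp add: field_simps)
      have e: "(real (m n) - real (a n) + real (I n) + 1) * r n = l n - real (a n) * r n + real (I n) * r n + r n"
        by (simp add: l_def algebra_simps)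
      have B: "1 - real (a n) / l n * r n + real (I n) / l n * r n + 1 / l n * r n = ((real (m n) - real (a n) + real (I n) + 1) * r n) / (s * s)"
        unfolding s(2)[symmetric] e using elim by (simp add: field_simps)
      have C: "1 - q n (I n) = (v n * s + real (I n) + r n) / ((real (m n) - real (a n) + real (I n) + 1) * r n)"
        by (simp add: q_def a[symmetric])
      show ?case unfolding s_def[symmetric] A B C using s elim by (simp add: divide_simps)
    qed
  qed
  have tail: "(\<lambda>n. (\<Sum>i<Suc (a n). c n i) * (v n / sqrt (l n)) / c n 0) \<longlonglongrightarrow> 1"
  proof (rule mills_ratio_sum[OF l vt _ _ _ _ _ _ key])
    show "c n i \<ge> 0" for n i unfolding c_def by (auto intro: binom_prob_nonneg r')
    show "\<forall>\<^sub>F n in sequentially. c n 0 > 0"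
      using loc(2) by eventually_elim (use r in \<open>auto simp: c_def binom_prob_def zero_less_binomial_iff\<close>)
    show "\<forall>\<^sub>F n in sequentially. \<forall>i. c n (Suc i) = q n i * c n i"
      using loc(2) by eventually_elim (simp add: c_Suc)
    show "\<forall>\<^sub>F n in sequentially. antimono (q n)"
      using loc(2) ev_l by eventually_elim (simp add: antimono_def q_mono)
    show "\<forall>\<^sub>F n in sequentially. 0 \<le> q n (nat \<lceil>sqrt (l n)\<rceil>)"
      using LM unfolding L_def[symmetric]
    proof eventually_elim
      case (elim n)
      then show ?case using r'[of n] by (auto simp: q_eq intro!: divide_nonneg_nonneg mult_nonneg_nonneg)
    qed
    show "\<forall>\<^sub>F n in sequentially. nat \<lceil>sqrt (l n)\<rceil> \<le> Suc (a n)"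
      using LM unfolding L_def[symmetric] by eventually_elim simp
  qed
  have "(\<lambda>n. ((\<Sum>i<Suc (a n). c n i) * (v n / sqrt (l n)) / c n 0) * (binom_prob (m n) (r n) (a n) * sqrt (2 * pi * l n) * exp (v n ^ 2 / 2))) \<longlonglongrightarrow> 1 * 1"
    by (intro tendsto_mult tail loc(1))
  then have "(\<lambda>n. ((\<Sum>i<Suc (a n). c n i) * (v n / sqrt (l n)) / c n 0) * (binom_prob (m n) (r n) (a n) * sqrt (2 * pi * l n) * exp (v n ^ 2 / 2))) \<longlonglongrightarrow> 1"
    by simp
  then show ?thesis
  proof (rule Lim_transform_eventually)
    show "\<forall>\<^sub>F n in sequentially. ((\<Sum>i<Suc (a n). c n i) * (v n / sqrt (l n)) / c n 0) * (binom_prob (m n) (r n) (a n) * sqrt (2 * pi * l n) * exp (v n ^ 2 / 2))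
       = (\<Sum>k\<le>a n. binom_prob (m n) (r n) k) * v n * sqrt (2 * pi) * exp (v n ^ 2 / 2)"
      using LM ev_l
    proof eventually_elim
      case (elim n)
      have "c n 0 > 0" using elim r(1,2)[of n] by (auto simp: c_def binom_prob_def zero_less_binomial_iff)
      moreover have "c n 0 = binom_prob (m n) (r n) (a n)" by (simp add: c_def)
      moreover have "sqrt (2 * pi * l n) = sqrt (2 * pi) * sqrt (l n)" by (simp add: real_sqrt_mult)
      moreover have "(\<Sum>k\<le>a n. binom_prob (m n) (r n) k) = (\<Sum>i<Suc (a n). c n i)"
        unfolding c_def by (rule sum_reindex_down)
      ultimately show ?case using elim by simp
    qed
  qed
qed

text \<open>The Gaussian tail at level \<open>u\<close> is insensitive to changes of \<open>u\<close> by \<open>o(1/u)\<close>.\<close>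

lemma mills_transfer:
  fixes u v l r S :: "nat \<Rightarrow> real"
  assumes u: "filterlim u at_top sequentially" and vu: "(\<lambda>n. (v n - u n) * u n) \<longlonglongrightarrow> 0"
  shows "(\<lambda>n. v n / u n) \<longlonglongrightarrow> 1" and "filterlim v at_top sequentially"
    and "(\<lambda>n. S n * v n * sqrt (2 * pi) * exp (v n ^ 2 / 2)) \<longlonglongrightarrow> 1 \<Longrightarrow>
         (\<lambda>n. S n * u n * sqrt (2 * pi) * exp (u n ^ 2 / 2)) \<longlonglongrightarrow> 1"
proof -
  have ev: "\<forall>\<^sub>F n in sequentially. u n > 1" using u by (simp add: filterlim_at_top_dense)
  have iu: "(\<lambda>n. 1 / u n) \<longlonglongrightarrow> 0"
    by (rule tendsto_divide_0[OF tendsto_const filterlim_at_top_imp_at_infinity[OF u]])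
  have "(\<lambda>n. ((v n - u n) * u n) * (1 / u n)) \<longlonglongrightarrow> 0 * 0" by (intro tendsto_mult vu iu)
  then have "(\<lambda>n. ((v n - u n) * u n) * (1 / u n)) \<longlonglongrightarrow> 0" by simp
  then have e0: "(\<lambda>n. v n - u n) \<longlonglongrightarrow> 0"
  proof (rule Lim_transform_eventually)
    show "\<forall>\<^sub>F n in sequentially. ((v n - u n) * u n) * (1 / u n) = v n - u n" using ev by eventually_elim simp
  qed
  have "(\<lambda>n. 1 + (v n - u n) * (1 / u n)) \<longlonglongrightarrow> 1 + 0 * 0" by (intro tendsto_intros e0 iu)
  then have "(\<lambda>n. 1 + (v n - u n) * (1 / u n)) \<longlonglongrightarrow> 1" by simp
  then show q: "(\<lambda>n. v n / u n) \<longlonglongrightarrow> 1"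
  proof (rule Lim_transform_eventually)
    show "\<forall>\<^sub>F n in sequentially. 1 + (v n - u n) * (1 / u n) = v n / u n"
      using ev by eventually_elim (simp add: field_simps)
  qed
  have "filterlim (\<lambda>n. (v n - u n) + u n) at_top sequentially"
    by (rule filterlim_tendsto_add_at_top[OF e0 u])
  then show vt: "filterlim v at_top sequentially" by simp
  assume S: "(\<lambda>n. S n * v n * sqrt (2 * pi) * exp (v n ^ 2 / 2)) \<longlonglongrightarrow> 1"
  have evv: "\<forall>\<^sub>F n in sequentially. v n > 1" using vt by (simp add: filterlim_at_top_dense)
  have "(\<lambda>n. (S n * v n * sqrt (2 * pi) * exp (v n ^ 2 / 2)) * (1 / (v n / u n)) * exp (- ((v n - u n) * u n + (v n - u n) ^ 2 / 2)))
     \<longlonglongrightarrow> 1 * (1 / 1) * exp (- (0 + 0 ^ 2 / 2))"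
    by (intro tendsto_intros S q e0 vu) auto
  then have "(\<lambda>n. (S n * v n * sqrt (2 * pi) * exp (v n ^ 2 / 2)) * (1 / (v n / u n)) * exp (- ((v n - u n) * u n + (v n - u n) ^ 2 / 2)))
     \<longlonglongrightarrow> 1" by simp
  then show "(\<lambda>n. S n * u n * sqrt (2 * pi) * exp (u n ^ 2 / 2)) \<longlonglongrightarrow> 1"
  proof (rule Lim_transform_eventually)
    show "\<forall>\<^sub>F n in sequentially. (S n * v n * sqrt (2 * pi) * exp (v n ^ 2 / 2)) * (1 / (v n / u n)) * exp (- ((v n - u n) * u n + (v n - u n) ^ 2 / 2))
       = S n * u n * sqrt (2 * pi) * exp (u n ^ 2 / 2)"
      using ev evv
    proof eventually_elim
      case (elim n)
      have "v n ^ 2 / 2 - ((v n - u n) * u n + (v n - u n) ^ 2 / 2) = u n ^ 2 / 2"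
        by (simp add: power2_eq_square algebra_simps add_divide_distrib diff_divide_distrib)
      then have "exp (v n ^ 2 / 2) * exp (- ((v n - u n) * u n + (v n - u n) ^ 2 / 2)) = exp (u n ^ 2 / 2)"
        by (simp add: exp_add[symmetric])
      then show ?case using elim by (simp add: field_simps)
    qed
  qed
qed

text \<open>The set of large deviations is the union of an integer upper and an integer lower tail. The two levels
  differ from \<open>u\<close> by the rounding error $1/\sqrt l$ and by the discrepancies allowed in the centre \<open>t\<close>
  and the width \<open>w\<close>, all of which are \<open>o(1/u)\<close>.\<close>

lemma binomial_two_sided_tail:
  fixes m :: "nat \<Rightarrow> nat" and r t w u :: "nat \<Rightarrow> real"
  defines "l \<equiv> \<lambda>n. real (m n) * r n"
  assumes r: "\<And>n. 0 < r n" "\<And>n. r n < 1" "r \<longlonglongrightarrow> 0"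
    and l: "filterlim l at_top sequentially" and u: "filterlim u at_top sequentially"
    and ul: "(\<lambda>n. u n ^ 3 / sqrt (l n)) \<longlonglongrightarrow> 0" and ur: "(\<lambda>n. u n ^ 2 * r n) \<longlonglongrightarrow> 0"
    and w: "(\<lambda>n. (w n / sqrt (l n) - u n) * u n) \<longlonglongrightarrow> 0"
    and t: "(\<lambda>n. (t n - l n) / sqrt (l n) * u n) \<longlonglongrightarrow> 0"
  shows "(\<lambda>n. (\<Sum>k | k \<le> m n \<and> \<bar>real k - t n\<bar> > w n. binom_prob (m n) (r n) k) * u n * sqrt (2 * pi) * exp (u n ^ 2 / 2)) \<longlonglongrightarrow> 2"
proof -
  have evu: "\<forall>\<^sub>F n in sequentially. u n > 1" using u by (simp add: filterlim_at_top_dense)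
  have ev_l: "\<forall>\<^sub>F n in sequentially. l n > 1" using l by (simp add: filterlim_at_top_dense)
  have iu: "(\<lambda>n. 1 / u n) \<longlonglongrightarrow> 0"
    by (rule tendsto_divide_0[OF tendsto_const filterlim_at_top_imp_at_infinity[OF u]])
  have "(\<lambda>n. (u n ^ 3 / sqrt (l n)) * (1 / u n) ^ 2) \<longlonglongrightarrow> 0 * 0 ^ 2" by (intro tendsto_intros ul iu)
  then have "(\<lambda>n. (u n ^ 3 / sqrt (l n)) * (1 / u n) ^ 2) \<longlonglongrightarrow> 0" by simp
  then have ul1: "(\<lambda>n. u n / sqrt (l n)) \<longlonglongrightarrow> 0"
  proof (rule Lim_transform_eventually)
    show "\<forall>\<^sub>F n in sequentially. (u n ^ 3 / sqrt (l n)) * (1 / u n) ^ 2 = u n / sqrt (l n)"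
      using evu by eventually_elim (simp add: power2_eq_square power3_eq_cube)
  qed
  have one_sided:
    "(\<lambda>n. v n / sqrt (l n)) \<longlonglongrightarrow> 0 \<and> (\<lambda>n. v n ^ 3 / sqrt (l n)) \<longlonglongrightarrow> 0 \<and> (\<lambda>n. v n ^ 2 * r n) \<longlonglongrightarrow> 0 \<and> filterlim v at_top sequentially"
    if vu: "(\<lambda>n. (v n - u n) * u n) \<longlonglongrightarrow> 0" for v
  proof -
    note q = mills_transfer(1)[OF u vu]
    have "(\<lambda>n. (v n / u n) * (u n / sqrt (l n))) \<longlonglongrightarrow> 1 * 0" by (intro tendsto_mult q ul1)
    moreover have "(\<lambda>n. (v n / u n) ^ 3 * (u n ^ 3 / sqrt (l n))) \<longlonglongrightarrow> 1 ^ 3 * 0" by (intro tendsto_intros q ul)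
    moreover have "(\<lambda>n. (v n / u n) ^ 2 * (u n ^ 2 * r n)) \<longlonglongrightarrow> 1 ^ 2 * 0" by (intro tendsto_intros q ur)
    moreover have "\<forall>\<^sub>F n in sequentially. (v n / u n) * (u n / sqrt (l n)) = v n / sqrt (l n)"
      "\<forall>\<^sub>F n in sequentially. (v n / u n) ^ 3 * (u n ^ 3 / sqrt (l n)) = v n ^ 3 / sqrt (l n)"
      "\<forall>\<^sub>F n in sequentially. (v n / u n) ^ 2 * (u n ^ 2 * r n) = v n ^ 2 * r n"
      using evu by (eventually_elim, simp add: power_divide)+
    ultimately show ?thesis
      using mills_transfer(2)[OF u vu] by (auto intro: Lim_transform_eventually)
  qed
  define au where "au = (\<lambda>n. nat (\<lfloor>t n + w n\<rfloor> + 1))"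
  define al where "al = (\<lambda>n. nat (\<lceil>t n - w n\<rceil> - 1))"
  have sl: "filterlim (\<lambda>n. sqrt (l n)) at_top sequentially"
    by (rule filterlim_compose[OF sqrt_at_top l])
  have t0: "(\<lambda>n. (t n - l n) / sqrt (l n)) \<longlonglongrightarrow> 0"
  proof (rule Lim_transform_eventually)
    show "(\<lambda>n. ((t n - l n) / sqrt (l n) * u n) * (1 / u n)) \<longlonglongrightarrow> 0" using tendsto_mult[OF t iu] by simp
    show "\<forall>\<^sub>F n in sequentially. ((t n - l n) / sqrt (l n) * u n) * (1 / u n) = (t n - l n) / sqrt (l n)"
      using evu by eventually_elim simp
  qed
  have w0: "(\<lambda>n. w n / sqrt (l n) - u n) \<longlonglongrightarrow> 0"
  proof (rule Lim_transform_eventually)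
    show "(\<lambda>n. ((w n / sqrt (l n) - u n) * u n) * (1 / u n)) \<longlonglongrightarrow> 0" using tendsto_mult[OF w iu] by simp
    show "\<forall>\<^sub>F n in sequentially. ((w n / sqrt (l n) - u n) * u n) * (1 / u n) = w n / sqrt (l n) - u n"
      using evu by eventually_elim simp
  qed
  have evt: "\<forall>\<^sub>F n in sequentially. \<bar>(t n - l n) / sqrt (l n)\<bar> < 1/4"
    using tendsto_rabs[OF t0] by (rule order_tendstoD) simp
  have evw: "\<forall>\<^sub>F n in sequentially. \<bar>w n / sqrt (l n) - u n\<bar> < 1/4"
    using tendsto_rabs[OF w0] by (rule order_tendstoD) simp
  have evul: "\<forall>\<^sub>F n in sequentially. u n / sqrt (l n) < 1/4"
    using ul1 by (rule order_tendstoD) simp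
  have evsl: "\<forall>\<^sub>F n in sequentially. sqrt (l n) > 4" using sl by (simp add: filterlim_at_top_dense)
  have pos: "\<forall>\<^sub>F n in sequentially. w n > 0 \<and> t n - w n > 1 \<and> t n + w n > 0"
    using evt evw evul evsl evu
  proof eventually_elim
    case (elim n)
    define s where "s = sqrt (l n)"
    have "s > 4" using elim by (simp add: s_def)
    moreover have "l n > 0" using elim(4) by (smt (verit) real_sqrt_le_0_iff)
    ultimately have s: "s > 4" "l n = s * s" by (auto simp: s_def)
    have w: "w n = (w n / s) * s" using s by simp
    have t: "t n = s * s + ((t n - l n) / s) * s" using s by (simp add: field_simps)
    have "\<bar>(t n - l n) / s\<bar> < 1/4" "\<bar>w n / s - u n\<bar> < 1/4" "u n / s < 1/4"
      using elim by (simp_all only: s_def)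
    then have ws: "w n / s > u n - 1/4" "w n / s < u n + 1/4" "(t n - l n) / s > -1/4" "u n < s/4"
      using s by (linarith, linarith, linarith, simp add: pos_divide_less_eq)
    have wp: "w n > 0" using ws(1) elim s by (subst w) (intro mult_pos_pos, auto)
    have "t n - w n = s * (s + (t n - l n) / s - w n / s)" using s by (simp add: field_simps)
    moreover have "s + (t n - l n) / s - w n / s > 1" using ws s by linarith
    ultimately have "t n - w n > 1" using s by (smt (verit) mult_less_cancel_left2 mult_cancel_left1)
    then show ?case using wp by simp
  qed
  have il: "(\<lambda>n. u n / sqrt (l n)) \<longlonglongrightarrow> 0" by (rule ul1)
  define vu where "vu = (\<lambda>n. (real (au n) - l n) / sqrt (l n))"
  define vl where "vl = (\<lambda>n. (l n - real (al n)) / sqrt (l n))"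
  have base: "(\<lambda>n. \<bar>(w n / sqrt (l n) - u n) * u n\<bar> + \<bar>(t n - l n) / sqrt (l n) * u n\<bar> + u n / sqrt (l n)) \<longlonglongrightarrow> \<bar>0\<bar> + \<bar>0\<bar> + 0"
    by (intro tendsto_intros w t il)
  have vu1: "(\<lambda>n. (vu n - u n) * u n) \<longlonglongrightarrow> 0"
  proof (rule Lim_null_comparison)
    show "\<forall>\<^sub>F n in sequentially. norm ((vu n - u n) * u n) \<le> \<bar>(w n / sqrt (l n) - u n) * u n\<bar> + \<bar>(t n - l n) / sqrt (l n) * u n\<bar> + u n / sqrt (l n)"
      using pos evu evsl
    proof eventually_elim
      case (elim n)
      define th where "th = real (au n) - (t n + w n)"
      have th: "0 \<le> th" "th \<le> 1"
      proof -
        have "0 \<le> \<lfloor>t n + w n\<rfloor>" using elim by simp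
        then have "real (au n) = of_int \<lfloor>t n + w n\<rfloor> + 1" by (simp add: au_def)
        then show "0 \<le> th" "th \<le> 1" unfolding th_def by linarith+
      qed
      have "(vu n - u n) * u n = (w n / sqrt (l n) - u n) * u n + (t n - l n) / sqrt (l n) * u n + th / sqrt (l n) * u n"
        unfolding vu_def th_def by (simp add: add_divide_distrib diff_divide_distrib algebra_simps)
      moreover have "\<bar>th / sqrt (l n) * u n\<bar> \<le> u n / sqrt (l n)"
      proof -
        have "0 < sqrt (l n)" using elim by linarith
        then have "0 \<le> u n / sqrt (l n)" using elim by (intro divide_nonneg_pos) linarith+
        then have "\<bar>th * (u n / sqrt (l n))\<bar> \<le> 1 * (u n / sqrt (l n))"
          using th by (simp only: abs_mult abs_of_nonneg) (intro mult_right_mono, auto)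
        then show ?thesis by simp
      qed
      moreover have "\<bar>a + b + c\<bar> \<le> \<bar>a\<bar> + \<bar>b\<bar> + d" if "\<bar>c\<bar> \<le> d" for a b c d :: real
        using that by linarith
      ultimately show ?case unfolding real_norm_def by presburger
    qed
  qed (use base in simp)
  have vl1: "(\<lambda>n. (vl n - u n) * u n) \<longlonglongrightarrow> 0"
  proof (rule Lim_null_comparison)
    show "\<forall>\<^sub>F n in sequentially. norm ((vl n - u n) * u n) \<le> \<bar>(w n / sqrt (l n) - u n) * u n\<bar> + \<bar>(t n - l n) / sqrt (l n) * u n\<bar> + u n / sqrt (l n)"
      using pos evu evsl
    proof eventually_elim
      case (elim n)
      define th where "th = (t n - w n) - real (al n)"
      have th: "0 \<le> th" "th \<le> 1"
      proof -
        have "1 \<le> \<lceil>t n - w n\<rceil>" using elim by linarith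
        then have "real (al n) = of_int \<lceil>t n - w n\<rceil> - 1" by (simp add: al_def)
        then show "0 \<le> th" "th \<le> 1" unfolding th_def by linarith+
      qed
      have "(vl n - u n) * u n = (w n / sqrt (l n) - u n) * u n - (t n - l n) / sqrt (l n) * u n + th / sqrt (l n) * u n"
        unfolding vl_def th_def by (simp add: add_divide_distrib diff_divide_distrib algebra_simps)
      moreover have "\<bar>th / sqrt (l n) * u n\<bar> \<le> u n / sqrt (l n)"
      proof -
        have "0 < sqrt (l n)" using elim by linarith
        then have "0 \<le> u n / sqrt (l n)" using elim by (intro divide_nonneg_pos) linarith+
        then have "\<bar>th * (u n / sqrt (l n))\<bar> \<le> 1 * (u n / sqrt (l n))"
          using th by (simp only: abs_mult abs_of_nonneg) (intro mult_right_mono, auto)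
        then show ?thesis by simp
      qed
      moreover have "\<bar>a - b + c\<bar> \<le> \<bar>a\<bar> + \<bar>b\<bar> + d" if "\<bar>c\<bar> \<le> d" for a b c d :: real
        using that by linarith
      ultimately show ?case unfolding real_norm_def by presburger
    qed
  qed (use base in simp)
  note a1 = conjunct1[OF one_sided[OF vu1]] conjunct1[OF conjunct2[OF one_sided[OF vu1]]]
    conjunct1[OF conjunct2[OF conjunct2[OF one_sided[OF vu1]]]] conjunct2[OF conjunct2[OF conjunct2[OF one_sided[OF vu1]]]]
  note a2 = conjunct1[OF one_sided[OF vl1]] conjunct1[OF conjunct2[OF one_sided[OF vl1]]]
    conjunct1[OF conjunct2[OF conjunct2[OF one_sided[OF vl1]]]] conjunct2[OF conjunct2[OF conjunct2[OF one_sided[OF vl1]]]]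
  have U: "(\<lambda>n. (\<Sum>k\<in>{au n..m n}. binom_prob (m n) (r n) k) * vu n * sqrt (2 * pi) * exp (vu n ^ 2 / 2)) \<longlonglongrightarrow> 1"
    using binomial_upper_tail[of r m au, OF r l[unfolded l_def] a1[unfolded vu_def l_def]] unfolding vu_def l_def .
  have L: "(\<lambda>n. (\<Sum>k\<le>al n. binom_prob (m n) (r n) k) * vl n * sqrt (2 * pi) * exp (vl n ^ 2 / 2)) \<longlonglongrightarrow> 1"
    using binomial_lower_tail[of r m al, OF r l[unfolded l_def] a2[unfolded vl_def l_def]] unfolding vl_def l_def .
  have alm: "\<forall>\<^sub>F n in sequentially. al n < m n"
  proof -
    have "filterlim (\<lambda>n. vl n * sqrt (l n)) at_top sequentially" by (rule filterlim_at_top_mult_at_top[OF a2(4) sl])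
    then have "\<forall>\<^sub>F n in sequentially. vl n * sqrt (l n) > 0" by (simp add: filterlim_at_top_dense)
    then show ?thesis using evsl
    proof eventually_elim
      case (elim n)
      then have "real (al n) < l n" by (simp add: vl_def split: if_splits)
      also have "l n \<le> real (m n)" using r(1,2)[of n] by (simp add: l_def mult_left_le)
      finally show ?case by simp
    qed
  qed
  have "(\<lambda>n. (\<Sum>k\<in>{au n..m n}. binom_prob (m n) (r n) k) * u n * sqrt (2 * pi) * exp (u n ^ 2 / 2)
     + (\<Sum>k\<le>al n. binom_prob (m n) (r n) k) * u n * sqrt (2 * pi) * exp (u n ^ 2 / 2)) \<longlonglongrightarrow> 1 + 1"
    by (intro tendsto_add mills_transfer(3)[OF u vu1 U] mills_transfer(3)[OF u vl1 L])
  then have "(\<lambda>n. (\<Sum>k\<in>{au n..m n}. binom_prob (m n) (r n) k) * u n * sqrt (2 * pi) * exp (u n ^ 2 / 2)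
     + (\<Sum>k\<le>al n. binom_prob (m n) (r n) k) * u n * sqrt (2 * pi) * exp (u n ^ 2 / 2)) \<longlonglongrightarrow> 2"
    by simp
  then show ?thesis
  proof (rule Lim_transform_eventually)
    show "\<forall>\<^sub>F n in sequentially. (\<Sum>k\<in>{au n..m n}. binom_prob (m n) (r n) k) * u n * sqrt (2 * pi) * exp (u n ^ 2 / 2)
     + (\<Sum>k\<le>al n. binom_prob (m n) (r n) k) * u n * sqrt (2 * pi) * exp (u n ^ 2 / 2)
     = (\<Sum>k | k \<le> m n \<and> \<bar>real k - t n\<bar> > w n. binom_prob (m n) (r n) k) * u n * sqrt (2 * pi) * exp (u n ^ 2 / 2)"
      using pos alm
    proof eventually_elim
      case (elim n)
      have up: "au n \<le> k \<longleftrightarrow> real k > t n + w n" for k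
      proof -
        have "0 \<le> \<lfloor>t n + w n\<rfloor>" using elim by simp
        then have "au n \<le> k \<longleftrightarrow> \<lfloor>t n + w n\<rfloor> < int k" unfolding au_def by linarith
        then show ?thesis by (simp add: floor_less_iff)
      qed
      have lo: "k \<le> al n \<longleftrightarrow> real k < t n - w n" for k
      proof -
        have "1 \<le> \<lceil>t n - w n\<rceil>" using elim by linarith
        then have "k \<le> al n \<longleftrightarrow> int k < \<lceil>t n - w n\<rceil>" unfolding al_def by linarith
        then show ?thesis by (simp add: less_ceiling_iff)
      qed
      have eq: "{k. k \<le> m n \<and> \<bar>real k - t n\<bar> > w n} = {au n..m n} \<union> {..al n}"
      proof (intro set_eqI)
        fix k
        have "k \<le> al n \<Longrightarrow> k \<le> m n" using elim by simp
        then show "k \<in> {k. k \<le> m n \<and> \<bar>real k - t n\<bar> > w n} \<longleftrightarrow> k \<in> {au n..m n} \<union> {..al n}"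
          using elim by (auto simp: up lo abs_less_iff)
      qed
      have dj: "{au n..m n} \<inter> {..al n} = {}"
      proof -
        have False if "au n \<le> k" "k \<le> al n" for k
          using that elim unfolding up lo by linarith
        then show ?thesis by fastforce
      qed
      show ?case unfolding eq by (subst sum.union_disjoint) (use dj in \<open>auto simp: algebra_simps\<close>)
    qed
  qed
qed

definition gumbel_level :: "real \<Rightarrow> real \<Rightarrow> real" where
  "gumbel_level x l = B_norming l + x / A_norming l"

lemma gumbel_level_at_top: "filterlim (gumbel_level x) at_top at_top"
  unfolding gumbel_level_def B_norming_def A_norming_def by real_asymp

lemma gumbel_level_sqrt: "((\<lambda>l. gumbel_level x l / sqrt l) \<longlongrightarrow> sqrt (2 * ln 2)) at_top"
  unfolding gumbel_level_def B_norming_def A_norming_def by (real_asymp simp: powr_half_sqrt)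

text \<open>The norming constants solve $2^l \cdot 2\varphi(u)/u \approx e^{-x}$ for the standard normal
  density $\varphi$: expanding $u^2/2$ gives $l\log 2 - \frac12\log(\pi l\log 2) + x$ up to an error
  tending to 0.\<close>

lemma gumbel_level_mills:
  "((\<lambda>l. 2 powr l / (gumbel_level x l * sqrt (2 * pi) * exp (gumbel_level x l ^ 2 / 2))) \<longlongrightarrow> exp (- x) / 2) at_top"
proof (rule Lim_transform_eventually)
  define d where "d = (\<lambda>l. x / A_norming l - (ln l + ln (pi * ln 2)) / (2 * A_norming l))"
  have d: "(d \<longlongrightarrow> 0) at_top"
    unfolding d_def A_norming_def by real_asymp
  have "((\<lambda>l. sqrt (pi * ln 2) * exp (- x) * exp (- (d l ^ 2 / 2)) / (gumbel_level x l / sqrt l * sqrt (2 * pi)))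
     \<longlongrightarrow> sqrt (pi * ln 2) * exp (- x) * exp (- (0 ^ 2 / 2)) / (sqrt (2 * ln 2) * sqrt (2 * pi))) at_top"
    by (intro tendsto_intros d gumbel_level_sqrt) auto
  also have "sqrt (pi * ln 2) * exp (- x) * exp (- (0 ^ 2 / 2)) / (sqrt (2 * ln 2) * sqrt (2 * pi)) = exp (- x) / 2"
    by (simp add: real_sqrt_mult)
  finally show "((\<lambda>l. sqrt (pi * ln 2) * exp (- x) * exp (- (d l ^ 2 / 2)) / (gumbel_level x l / sqrt l * sqrt (2 * pi)))
     \<longlongrightarrow> exp (- x) / 2) at_top" .
  show "\<forall>\<^sub>F l in at_top. sqrt (pi * ln 2) * exp (- x) * exp (- (d l ^ 2 / 2)) / (gumbel_level x l / sqrt l * sqrt (2 * pi))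
     = 2 powr l / (gumbel_level x l * sqrt (2 * pi) * exp (gumbel_level x l ^ 2 / 2))"
    using eventually_gt_at_top[of 0]
  proof eventually_elim
    case (elim l)
    define A where "A = A_norming l"
    have A: "A > 0" "A * A = 2 * ln 2 * l" using elim by (auto simp: A_def A_norming_def)
    have g: "gumbel_level x l = A + d l" by (simp add: gumbel_level_def B_norming_def d_def A_def)
    have Ad: "A * d l = x - (ln l + ln (pi * ln 2)) / 2"
      unfolding d_def A_def[symmetric] using A(1) by (simp add: field_simps)
    have "gumbel_level x l ^ 2 / 2 = ln 2 * l + (x - (ln l + ln (pi * ln 2)) / 2) + d l ^ 2 / 2"
      unfolding Ad[symmetric] g using A(2) by (simp add: power2_eq_square algebra_simps)
    then have "exp (gumbel_level x l ^ 2 / 2) = exp (ln 2 * l) * (exp x * inverse (exp ((ln l + ln (pi * ln 2)) / 2))) * exp (d l ^ 2 / 2)"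
      by (simp only: exp_add exp_diff divide_inverse)
    also have "exp (ln 2 * l) = 2 powr l" by (simp add: powr_def mult.commute)
    also have "exp ((ln l + ln (pi * ln 2)) / 2) = sqrt l * sqrt (pi * ln 2)"
    proof -
      have "(ln l + ln (pi * ln 2)) / 2 = ln (sqrt (l * (pi * ln 2)))"
        using elim by (simp add: ln_sqrt ln_mult)
      then show ?thesis using elim by (simp add: real_sqrt_mult)
    qed
    finally have e: "exp (gumbel_level x l ^ 2 / 2) = 2 powr l * (exp x * inverse (sqrt l * sqrt (pi * ln 2))) * exp (d l ^ 2 / 2)" .
    have alg: "S * inverse ex * inverse ed / (g / s * q) = p / (g * q * (p * (ex * inverse (s * S)) * ed))"
      if "p \<noteq> 0" "s \<noteq> 0" "S \<noteq> 0" for S ex ed g s q p :: real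
      using that by (simp add: divide_inverse)
    show ?case unfolding e exp_minus by (rule alg) (use elim in auto)
  qed
qed

text \<open>The normal level of \<open>gumbel_level_mills\<close> inserted into the binomial tail. As \<open>u\<close> is of order
  $\sqrt J$, the moderate deviation condition becomes $J^3/l \to 0$. The statement is about sequences because
  uniformity in the parameters will be read off from it.\<close>

lemma binomial_gumbel_tail:
  fixes m J :: "nat \<Rightarrow> nat" and r t w :: "nat \<Rightarrow> real" and x :: real
  defines "l \<equiv> \<lambda>n. real (m n) * r n" and "u \<equiv> \<lambda>n. gumbel_level x (real (J n))"
  assumes r: "\<And>n. 0 < r n" "\<And>n. r n < 1" and J: "filterlim J at_top sequentially"
    and Jl: "(\<lambda>n. real (J n) ^ 3 / l n) \<longlonglongrightarrow> 0" and Jr: "(\<lambda>n. real (J n) * r n) \<longlonglongrightarrow> 0"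
    and lpos: "\<And>n. l n > 0"
    and w: "(\<lambda>n. (w n / sqrt (l n) - u n) * sqrt (real (J n))) \<longlonglongrightarrow> 0"
    and t: "(\<lambda>n. (t n - l n) / sqrt (l n) * sqrt (real (J n))) \<longlonglongrightarrow> 0"
  shows "(\<lambda>n. 2 ^ J n * (\<Sum>k | k \<le> m n \<and> \<bar>real k - t n\<bar> > w n. binom_prob (m n) (r n) k)) \<longlonglongrightarrow> exp (- x)"
proof -
  have Jreal: "filterlim (\<lambda>n. real (J n)) at_top sequentially"
    by (rule filterlim_compose[OF filterlim_real_sequentially J])
  have evJ: "\<forall>\<^sub>F n in sequentially. real (J n) > 1" using Jreal unfolding filterlim_at_top_dense by blast
  have u: "filterlim u at_top sequentially"
    unfolding u_def by (rule filterlim_compose[OF gumbel_level_at_top Jreal])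
  have evu: "\<forall>\<^sub>F n in sequentially. u n > 1" using u by (simp add: filterlim_at_top_dense)
  have q: "(\<lambda>n. u n / sqrt (real (J n))) \<longlonglongrightarrow> sqrt (2 * ln 2)"
    unfolding u_def by (rule filterlim_compose[OF gumbel_level_sqrt Jreal])
  have iJ: "(\<lambda>n. 1 / real (J n)) \<longlonglongrightarrow> 0"
    by (rule tendsto_divide_0[OF tendsto_const filterlim_at_top_imp_at_infinity[OF Jreal]])
  have "(\<lambda>n. (real (J n) * r n) * (1 / real (J n))) \<longlonglongrightarrow> 0" using tendsto_mult[OF Jr iJ] by simp
  then have r0: "r \<longlonglongrightarrow> 0"
    by (rule Lim_transform_eventually) (use evJ in \<open>eventually_elim, simp\<close>)
  have "\<forall>\<^sub>F n in sequentially. 0 < real (J n) ^ 3 / l n"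
    using evJ by eventually_elim (simp add: lpos)
  from filterlim_inverse_at_top[OF Jl this]
  have "filterlim (\<lambda>n. 1 / (real (J n) ^ 3 / l n)) at_top sequentially" by (simp add: divide_inverse)
  moreover have "\<forall>\<^sub>F n in sequentially. 1 / (real (J n) ^ 3 / l n) \<le> l n"
    using evJ
  proof eventually_elim
    case (elim n)
    have "l n * 1 \<le> l n * real (J n) ^ 3" using elim lpos[of n] by (intro mult_left_mono) auto
    then show ?case using elim by (simp add: pos_divide_le_eq)
  qed
  ultimately have l: "filterlim l at_top sequentially"
    by (rule filterlim_at_top_mono)
  have ul: "(\<lambda>n. u n ^ 3 / sqrt (l n)) \<longlonglongrightarrow> 0"
  proof (rule Lim_transform_eventually)
    have "(\<lambda>n. (u n / sqrt (real (J n))) ^ 3 * sqrt (real (J n) ^ 3 / l n)) \<longlonglongrightarrow> sqrt (2 * ln 2) ^ 3 * sqrt 0"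
      by (intro tendsto_intros q Jl)
    then show "(\<lambda>n. (u n / sqrt (real (J n))) ^ 3 * sqrt (real (J n) ^ 3 / l n)) \<longlonglongrightarrow> 0" by simp
    show "\<forall>\<^sub>F n in sequentially. (u n / sqrt (real (J n))) ^ 3 * sqrt (real (J n) ^ 3 / l n) = u n ^ 3 / sqrt (l n)"
      using evJ
    proof eventually_elim
      case (elim n)
      have "sqrt (real (J n) ^ 3 / l n) = sqrt (real (J n)) ^ 3 / sqrt (l n)"
        by (simp only: real_sqrt_divide real_sqrt_power)
      then show ?case using elim by (simp add: power_divide)
    qed
  qed
  have ur: "(\<lambda>n. u n ^ 2 * r n) \<longlonglongrightarrow> 0"
  proof (rule Lim_transform_eventually)
    have "(\<lambda>n. (u n / sqrt (real (J n))) ^ 2 * (real (J n) * r n)) \<longlonglongrightarrow> sqrt (2 * ln 2) ^ 2 * 0"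
      by (intro tendsto_intros q Jr)
    then show "(\<lambda>n. (u n / sqrt (real (J n))) ^ 2 * (real (J n) * r n)) \<longlonglongrightarrow> 0" by simp
    show "\<forall>\<^sub>F n in sequentially. (u n / sqrt (real (J n))) ^ 2 * (real (J n) * r n) = u n ^ 2 * r n"
      using evJ by eventually_elim (simp add: power_divide)
  qed
  have conv: "(\<lambda>n. a n * u n) \<longlonglongrightarrow> 0" if "(\<lambda>n. a n * sqrt (real (J n))) \<longlonglongrightarrow> 0" for a :: "nat \<Rightarrow> real"
  proof (rule Lim_transform_eventually)
    show "(\<lambda>n. (a n * sqrt (real (J n))) * (u n / sqrt (real (J n)))) \<longlonglongrightarrow> 0"
      using tendsto_mult[OF that q] by simp
    show "\<forall>\<^sub>F n in sequentially. (a n * sqrt (real (J n))) * (u n / sqrt (real (J n))) = a n * u n"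
      using evJ by eventually_elim simp
  qed
  have T: "(\<lambda>n. (\<Sum>k | k \<le> m n \<and> \<bar>real k - t n\<bar> > w n. binom_prob (m n) (r n) k) * u n * sqrt (2 * pi) * exp (u n ^ 2 / 2)) \<longlonglongrightarrow> 2"
    unfolding l_def
    by (rule binomial_two_sided_tail[OF r r0 l[unfolded l_def] u ul[unfolded l_def] ur
          conv[OF w, unfolded l_def] conv[OF t, unfolded l_def]])
  have M: "(\<lambda>n. 2 powr real (J n) / (u n * sqrt (2 * pi) * exp (u n ^ 2 / 2))) \<longlonglongrightarrow> exp (- x) / 2"
    unfolding u_def by (rule filterlim_compose[OF gumbel_level_mills Jreal])
  have "(\<lambda>n. ((\<Sum>k | k \<le> m n \<and> \<bar>real k - t n\<bar> > w n. binom_prob (m n) (r n) k) * u n * sqrt (2 * pi) * exp (u n ^ 2 / 2))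
     * (2 powr real (J n) / (u n * sqrt (2 * pi) * exp (u n ^ 2 / 2)))) \<longlonglongrightarrow> 2 * (exp (- x) / 2)"
    by (rule tendsto_mult[OF T M])
  then have "(\<lambda>n. ((\<Sum>k | k \<le> m n \<and> \<bar>real k - t n\<bar> > w n. binom_prob (m n) (r n) k) * u n * sqrt (2 * pi) * exp (u n ^ 2 / 2))
     * (2 powr real (J n) / (u n * sqrt (2 * pi) * exp (u n ^ 2 / 2)))) \<longlonglongrightarrow> exp (- x)" by simp
  then show ?thesis
  proof (rule Lim_transform_eventually)
    have cancel: "(S * u * s * e) * (p / (u * s * e)) = p * S"
      if "u \<noteq> 0" "s \<noteq> 0" "e \<noteq> 0" for S u s e p :: real using that by simp
    show "\<forall>\<^sub>F n in sequentially. ((\<Sum>k | k \<le> m n \<and> \<bar>real k - t n\<bar> > w n. binom_prob (m n) (r n) k) * u n * sqrt (2 * pi) * exp (u n ^ 2 / 2))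
       * (2 powr real (J n) / (u n * sqrt (2 * pi) * exp (u n ^ 2 / 2)))
       = 2 ^ J n * (\<Sum>k | k \<le> m n \<and> \<bar>real k - t n\<bar> > w n. binom_prob (m n) (r n) k)"
      using evu
    proof eventually_elim
      case (elim n)
      have p: "(2::real) powr real (J n) = 2 ^ J n" by (rule powr_realpow) simp
      show ?case unfolding p by (rule cancel) (use elim in auto)
    qed
  qed
qed

section \<open>Uniformity of the tail asymptotics\<close>

text \<open>Choose near-maximisers of the error: convergence along them is uniform convergence.\<close>

lemma uniform_limit_by_sequences:
  fixes F :: "nat \<Rightarrow> 'p \<Rightarrow> real"
  assumes ne: "\<forall>\<^sub>F n in sequentially. S n \<noteq> {}"
    and lim: "\<And>g. \<forall>\<^sub>F n in sequentially. g n \<in> S n \<Longrightarrow> (\<lambda>n. F n (g n)) \<longlonglongrightarrow> L"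
    and e: "e > 0"
  shows "\<forall>\<^sub>F n in sequentially. \<forall>z\<in>S n. \<bar>F n z - L\<bar> < e"
proof -
  define g where "g = (\<lambda>n. if \<exists>z\<in>S n. e \<le> \<bar>F n z - L\<bar> then SOME z. z \<in> S n \<and> e \<le> \<bar>F n z - L\<bar> else SOME z. z \<in> S n)"
  have g: "g n \<in> S n \<and> ((\<exists>z\<in>S n. e \<le> \<bar>F n z - L\<bar>) \<longrightarrow> e \<le> \<bar>F n (g n) - L\<bar>)" if "S n \<noteq> {}" for n
  proof (cases "\<exists>z\<in>S n. e \<le> \<bar>F n z - L\<bar>")
    case True
    then have "\<exists>z. z \<in> S n \<and> e \<le> \<bar>F n z - L\<bar>" by blast
    from someI_ex[OF this] show ?thesis using True by (simp add: g_def)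
  next
    case False
    have "\<exists>z. z \<in> S n" using that by blast
    from someI_ex[OF this] show ?thesis using False unfolding g_def by (simp only: if_False) blast
  qed
  have "(\<lambda>n. F n (g n)) \<longlonglongrightarrow> L"
    using ne by (intro lim, eventually_elim) (use g in blast)
  then have "\<forall>\<^sub>F n in sequentially. \<bar>F n (g n) - L\<bar> < e"
    using e by (simp add: tendsto_iff dist_real_def)
  then show ?thesis using ne
  proof eventually_elim
    case (elim n)
    then show ?case using g[of n] by (meson not_less)
  qed
qed

lemma sqrt_near_one: "x \<ge> 0 \<Longrightarrow> \<bar>sqrt x - 1\<bar> \<le> \<bar>x - 1\<bar>"
proof -
  assume x: "x \<ge> 0"
  have "x - 1 = (sqrt x - 1) * (sqrt x + 1)" using x by (simp add: algebra_simps)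
  then have "\<bar>x - 1\<bar> = \<bar>sqrt x - 1\<bar> * (sqrt x + 1)" using x by (simp add: abs_mult)
  also have "\<dots> \<ge> \<bar>sqrt x - 1\<bar> * 1" using x by (intro mult_left_mono) auto
  finally show ?thesis by simp
qed

text \<open>The parameters of a bin count when the \<open>n\<close> sample points are revealed bin by bin: \<open>m\<close> points are
  left, each falls into the bin with conditional probability \<open>r\<close>, the unconditional mean is \<open>t\<close> and
  the threshold is \<open>w\<close>. The relative error $C\sqrt{J/n}$ of the conditional mean is the one caused by
  partial sums that deviate by $\sqrt{Jn}$.\<close>

definition bin_regime :: "real \<Rightarrow> real \<Rightarrow> (nat \<Rightarrow> real) \<Rightarrow> (nat \<Rightarrow> nat) \<Rightarrow> real \<Rightarrow> nat \<Rightarrow> (nat \<times> real \<times> real \<times> real) set" where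
  "bin_regime c C \<theta> J x n = {(m, r, t, w). 0 < r \<and> r < 1 \<and> r \<le> C / 2 ^ J n \<and>
     c * real n / 2 ^ J n \<le> t \<and> t \<le> C * real n / 2 ^ J n \<and>
     \<bar>real m * r - t\<bar> \<le> C * t * sqrt (real (J n) / real n) \<and>
     \<bar>w - gumbel_level x (real (J n)) * sqrt t\<bar> \<le> gumbel_level x (real (J n)) * sqrt t * \<theta> n}"

text \<open>Uniformity follows from \<open>uniform_limit_by_sequences\<close>. Along a sequence in the regime the conditional mean
  \<open>l\<close> and the centre \<open>t\<close> agree up to a factor $1 + O(\sqrt{J/n})$, which is $1 + o(1/J)$, the accuracy needed
  at a level of order $\sqrt J$.\<close>

lemma uniform_gumbel_tail:
  fixes J :: "nat \<Rightarrow> nat"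
  assumes J: "filterlim J at_top sequentially"
    and Jn: "(\<lambda>n. real (J n) ^ 3 * 2 ^ J n / real n) \<longlonglongrightarrow> 0"
    and cC: "0 < c" "c \<le> C"
    and \<theta>: "(\<lambda>n. \<theta> n * real (J n)) \<longlonglongrightarrow> 0" "\<And>n. \<theta> n \<ge> 0"
    and e: "e > 0"
  shows "\<forall>\<^sub>F n in sequentially. \<forall>(m, r, t, w) \<in> bin_regime c C \<theta> J x n.
    \<bar>2 ^ J n * (\<Sum>k | k \<le> m \<and> \<bar>real k - t\<bar> > w. binom_prob m r k) - exp (- x)\<bar> < e"
proof -
  have Jreal: "filterlim (\<lambda>n. real (J n)) at_top sequentially"
    by (rule filterlim_compose[OF filterlim_real_sequentially J])
  have evJ: "\<forall>\<^sub>F n in sequentially. real (J n) > 1" using Jreal unfolding filterlim_at_top_dense by blast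
  define u where "u = (\<lambda>n. gumbel_level x (real (J n)))"
  have u: "filterlim u at_top sequentially"
    unfolding u_def by (rule filterlim_compose[OF gumbel_level_at_top Jreal])
  have evu: "\<forall>\<^sub>F n in sequentially. u n > 1" using u unfolding filterlim_at_top_dense by blast
  have q: "(\<lambda>n. u n / sqrt (real (J n))) \<longlonglongrightarrow> sqrt (2 * ln 2)"
    unfolding u_def by (rule filterlim_compose[OF gumbel_level_sqrt Jreal])
  have iJ: "(\<lambda>n. 1 / real (J n)) \<longlonglongrightarrow> 0"
    by (rule tendsto_divide_0[OF tendsto_const filterlim_at_top_imp_at_infinity[OF Jreal]])
  have J2: "(\<lambda>n. real (J n) / 2 ^ J n) \<longlonglongrightarrow> 0"
  proof (rule filterlim_compose[OF _ J])
    show "(\<lambda>k. real k / 2 ^ k) \<longlonglongrightarrow> 0" by real_asymp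
  qed
  have J2': "(\<lambda>n. real (J n) / sqrt (2 ^ J n)) \<longlonglongrightarrow> 0"
  proof (rule filterlim_compose[OF _ J])
    have "(\<lambda>k. real k / 2 powr (real k / 2)) \<longlonglongrightarrow> 0" by real_asymp
    then show "(\<lambda>k. real k / sqrt (2 ^ k)) \<longlonglongrightarrow> 0" by (simp add: powr_half_sqrt_powr powr_realpow)
  qed
  have evn: "\<forall>\<^sub>F n in sequentially. real n > 0" using eventually_gt_at_top[of 0] by eventually_elim simp
  have J3: "(\<lambda>n. real (J n) ^ 3 / real n) \<longlonglongrightarrow> 0"
  proof (rule tendsto_sandwich[OF _ _ tendsto_const Jn])
    show "\<forall>\<^sub>F n in sequentially. real (J n) ^ 3 / real n \<le> real (J n) ^ 3 * 2 ^ J n / real n"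
      by (intro always_eventually allI divide_right_mono) (auto simp: mult_le_cancel_left1)
  qed simp
  have J3': "(\<lambda>n. real (J n) * sqrt (real (J n) / real n)) \<longlonglongrightarrow> 0"
  proof (rule Lim_transform_eventually)
    show "(\<lambda>n. sqrt (real (J n) ^ 3 / real n)) \<longlonglongrightarrow> 0" using tendsto_real_sqrt[OF J3] by simp
    show "\<forall>\<^sub>F n in sequentially. sqrt (real (J n) ^ 3 / real n) = real (J n) * sqrt (real (J n) / real n)"
      by (intro always_eventually allI) (simp add: real_sqrt_divide real_sqrt_mult power3_eq_cube)
  qed
  have J1: "(\<lambda>n. sqrt (real (J n) / real n)) \<longlonglongrightarrow> 0"
  proof (rule Lim_transform_eventually)
    show "(\<lambda>n. (real (J n) * sqrt (real (J n) / real n)) * (1 / real (J n))) \<longlonglongrightarrow> 0" using tendsto_mult[OF J3' iJ] by simp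
    show "\<forall>\<^sub>F n in sequentially. (real (J n) * sqrt (real (J n) / real n)) * (1 / real (J n)) = sqrt (real (J n) / real n)"
      using evJ by eventually_elim simp
  qed
  have "\<forall>\<^sub>F n in sequentially. \<forall>z\<in>bin_regime c C \<theta> J x n.
    \<bar>(case z of (m, r, t, w) \<Rightarrow> 2 ^ J n * (\<Sum>k | k \<le> m \<and> \<bar>real k - t\<bar> > w. binom_prob m r k)) - exp (- x)\<bar> < e"
  proof (rule uniform_limit_by_sequences[OF _ _ e])
    have "(\<lambda>n. C * (1 / real (J n) * (real (J n) / 2 ^ J n))) \<longlonglongrightarrow> C * (0 * 0)" by (intro tendsto_intros iJ J2)
    then have "\<forall>\<^sub>F n in sequentially. C * (1 / real (J n) * (real (J n) / 2 ^ J n)) < 1" by (rule order_tendstoD) simp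
    then show "\<forall>\<^sub>F n in sequentially. bin_regime c C \<theta> J x n \<noteq> {}"
      using evJ evu evn
    proof eventually_elim
      case (elim n)
      define r where "r = c / 2 ^ J n"
      have "C / 2 ^ J n < 1" using elim by simp
      moreover have rC: "r \<le> C / 2 ^ J n" unfolding r_def using cC by (intro divide_right_mono) auto
      ultimately have "r < 1" by linarith
      moreover note rC
      moreover have "r > 0" using cC by (simp add: r_def)
      moreover have "c * real n / 2 ^ J n \<le> real n * r" "real n * r \<le> C * real n / 2 ^ J n"
        using cC elim by (auto simp: r_def field_simps)
      moreover have "0 \<le> u n * sqrt (real n * r) * \<theta> n" using elim \<theta>(2)[of n] cC by (auto simp: r_def)
      ultimately have "(n, r, real n * r, u n * sqrt (real n * r)) \<in> bin_regime c C \<theta> J x n"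
        using cC elim unfolding bin_regime_def u_def by (auto intro!: mult_nonneg_nonneg)
      then show ?case by blast
    qed
  next
    fix g :: "nat \<Rightarrow> nat \<times> real \<times> real \<times> real"
    assume gS: "\<forall>\<^sub>F n in sequentially. g n \<in> bin_regime c C \<theta> J x n"
    define B where "B = (\<lambda>n. g n \<in> bin_regime c C \<theta> J x n \<and> real (J n) > 1 \<and> u n > 1 \<and> real n > 0 \<and> C * sqrt (real (J n) / real n) < 1/2)"
    have "(\<lambda>n. C * sqrt (real (J n) / real n)) \<longlonglongrightarrow> C * 0" by (intro tendsto_intros J1)
    then have evC: "\<forall>\<^sub>F n in sequentially. C * sqrt (real (J n) / real n) < 1/2" by (rule order_tendstoD) simp
    have evB: "\<forall>\<^sub>F n in sequentially. B n"
      using gS evJ evu evn evC unfolding B_def by eventually_elim blast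
    \<comment> \<open>The finitely many indices outside the regime get harmless values, since the limit theorem
    requires \<open>0 < r n < 1\<close> for all \<open>n\<close>.\<close>
    define h where "h = (\<lambda>n. if B n then g n else (1::nat, 1/2::real, 1::real, 1::real))"
    define m where "m = (\<lambda>n. fst (h n))"
    define r where "r = (\<lambda>n. fst (snd (h n)))"
    define t where "t = (\<lambda>n. fst (snd (snd (h n))))"
    define w where "w = (\<lambda>n. snd (snd (snd (h n))))"
    have h: "h n = (m n, r n, t n, w n)" for n by (simp add: m_def r_def t_def w_def)
    define l where "l = (\<lambda>n. real (m n) * r n)"
    have facts: "0 < r n" "r n < 1" "0 < l n" "0 < t n" for n
    proof -
      have "0 < r n \<and> r n < 1 \<and> 0 < l n \<and> 0 < t n"
      proof (cases "B n")
        case True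
        then have "(m n, r n, t n, w n) \<in> bin_regime c C \<theta> J x n" using h[of n] by (simp add: h_def B_def)
        then have *: "0 < r n" "r n < 1" "c * real n / 2 ^ J n \<le> t n" "\<bar>l n - t n\<bar> \<le> C * t n * sqrt (real (J n) / real n)"
          by (auto simp: bin_regime_def l_def)
        have "0 < c * real n / 2 ^ J n" using True cC by (simp add: B_def)
        then have tp: "t n > 0" using * by linarith
        have "C * t n * sqrt (real (J n) / real n) = t n * (C * sqrt (real (J n) / real n))" by simp
        also have "\<dots> < t n * (1/2)" using True tp by (intro mult_strict_left_mono) (auto simp: B_def)
        finally have "l n > 0" using *(4) tp by linarith
        then show ?thesis using * tp by simp
      next
        case False
        then show ?thesis by (simp add: l_def m_def r_def t_def w_def h_def)
      qed
      then show "0 < r n" "r n < 1" "0 < l n" "0 < t n" by auto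
    qed
    have reg: "\<forall>\<^sub>F n in sequentially. r n \<le> C / 2 ^ J n \<and> c * real n / 2 ^ J n \<le> t n \<and> t n \<le> C * real n / 2 ^ J n \<and>
       \<bar>l n - t n\<bar> \<le> C * t n * sqrt (real (J n) / real n) \<and> \<bar>w n - u n * sqrt (t n)\<bar> \<le> u n * sqrt (t n) * \<theta> n"
      using evB
    proof eventually_elim
      case (elim n)
      then have "(m n, r n, t n, w n) \<in> bin_regime c C \<theta> J x n" using h[of n] by (simp add: h_def B_def)
      then show ?case by (auto simp: bin_regime_def l_def u_def)
    qed
    have lt: "(\<lambda>n. l n / t n - 1) \<longlonglongrightarrow> 0"
    proof (rule Lim_null_comparison)
      show "\<forall>\<^sub>F n in sequentially. norm (l n / t n - 1) \<le> C * sqrt (real (J n) / real n)"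
        using reg
      proof eventually_elim
        case (elim n)
        have "l n / t n - 1 = (l n - t n) / t n" using facts(4)[of n] by (simp add: field_simps)
        then show ?case using elim facts(4)[of n] by (simp add: abs_divide pos_divide_le_eq mult_ac)
      qed
      show "(\<lambda>n. C * sqrt (real (J n) / real n)) \<longlonglongrightarrow> 0" using tendsto_mult[OF tendsto_const J1] by simp
    qed
    then have "(\<lambda>n. 1 + (l n / t n - 1)) \<longlonglongrightarrow> 1 + 0" by (intro tendsto_intros)
    then have lt1: "(\<lambda>n. l n / t n) \<longlonglongrightarrow> 1" by simp
    have "(\<lambda>n. inverse (l n / t n)) \<longlonglongrightarrow> inverse 1" by (intro tendsto_intros lt1) auto
    then have tl1: "(\<lambda>n. t n / l n) \<longlonglongrightarrow> 1" by simp
    have Jtl: "(\<lambda>n. real (J n) * (t n / l n - 1)) \<longlonglongrightarrow> 0"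
    proof (rule Lim_null_comparison)
      show "\<forall>\<^sub>F n in sequentially. norm (real (J n) * (t n / l n - 1)) \<le> C * (real (J n) * sqrt (real (J n) / real n)) * (t n / l n)"
        using reg
      proof eventually_elim
        case (elim n)
        have "real (J n) * (t n / l n - 1) = real (J n) * ((t n - l n) / l n)" using facts(3)[of n] by (simp add: field_simps)
        also have "\<bar>\<dots>\<bar> = real (J n) * \<bar>l n - t n\<bar> / l n" using facts(3)[of n] by (simp add: abs_mult abs_divide abs_minus_commute)
        also have "\<dots> \<le> real (J n) * (C * t n * sqrt (real (J n) / real n)) / l n"
          using elim facts(3)[of n] by (intro divide_right_mono mult_left_mono) auto
        finally show ?case by (simp add: mult_ac)
      qed
      have "(\<lambda>n. C * (real (J n) * sqrt (real (J n) / real n)) * (t n / l n)) \<longlonglongrightarrow> C * 0 * 1" by (intro tendsto_intros J3' tl1)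
      then show "(\<lambda>n. C * (real (J n) * sqrt (real (J n) / real n)) * (t n / l n)) \<longlonglongrightarrow> 0" by simp
    qed
    have Jl: "(\<lambda>n. real (J n) ^ 3 / l n) \<longlonglongrightarrow> 0"
    proof (rule Lim_null_comparison)
      show "\<forall>\<^sub>F n in sequentially. norm (real (J n) ^ 3 / l n) \<le> 1 / c * (real (J n) ^ 3 * 2 ^ J n / real n) * (t n / l n)"
        using reg evn
      proof eventually_elim
        case (elim n)
        have "1 \<le> t n * 2 ^ J n / (c * real n)" using elim cC by (simp add: field_simps)
        then have "real (J n) ^ 3 / l n * 1 \<le> real (J n) ^ 3 / l n * (t n * 2 ^ J n / (c * real n))"
          using facts(3)[of n] by (intro mult_left_mono) auto
        then show ?case using facts(3)[of n] by (simp add: mult_ac)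
      qed
      have "(\<lambda>n. 1 / c * (real (J n) ^ 3 * 2 ^ J n / real n) * (t n / l n)) \<longlonglongrightarrow> 1 / c * 0 * 1" by (intro tendsto_intros Jn tl1)
      then show "(\<lambda>n. 1 / c * (real (J n) ^ 3 * 2 ^ J n / real n) * (t n / l n)) \<longlonglongrightarrow> 0" by simp
    qed
    have Jr: "(\<lambda>n. real (J n) * r n) \<longlonglongrightarrow> 0"
    proof (rule Lim_null_comparison)
      show "\<forall>\<^sub>F n in sequentially. norm (real (J n) * r n) \<le> C * (real (J n) / 2 ^ J n)"
        using reg
      proof eventually_elim
        case (elim n)
        then have "real (J n) * r n \<le> real (J n) * (C / 2 ^ J n)" by (intro mult_left_mono) auto
        then show ?case using facts(1)[of n] by (simp add: abs_mult mult_ac)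
      qed
      show "(\<lambda>n. C * (real (J n) / 2 ^ J n)) \<longlonglongrightarrow> 0" using tendsto_mult[OF tendsto_const J2] by simp
    qed
    have W: "(\<lambda>n. (w n / sqrt (l n) - u n) * sqrt (real (J n))) \<longlonglongrightarrow> 0"
    proof (rule Lim_null_comparison)
      show "\<forall>\<^sub>F n in sequentially. norm ((w n / sqrt (l n) - u n) * sqrt (real (J n))) \<le>
         (u n / sqrt (real (J n))) * (sqrt (t n / l n) * (\<theta> n * real (J n)) + \<bar>real (J n) * (t n / l n - 1)\<bar>)"
        using reg evu evJ
      proof eventually_elim
        case (elim n)
        have l: "sqrt (l n) > 0" using facts(3)[of n] by simp
        have sJ: "sqrt (real (J n)) = real (J n) / sqrt (real (J n))" by (simp add: real_div_sqrt)
        have "w n / sqrt (l n) - u n = (w n - u n * sqrt (t n)) / sqrt (l n) + u n * (sqrt (t n / l n) - 1)"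
          using l by (simp add: real_sqrt_divide field_simps)
        also have "\<bar>\<dots>\<bar> \<le> \<bar>(w n - u n * sqrt (t n)) / sqrt (l n)\<bar> + \<bar>u n * (sqrt (t n / l n) - 1)\<bar>" by (rule abs_triangle_ineq)
        also have "\<dots> \<le> u n * sqrt (t n) * \<theta> n / sqrt (l n) + u n * \<bar>t n / l n - 1\<bar>"
        proof (rule add_mono)
          show "\<bar>(w n - u n * sqrt (t n)) / sqrt (l n)\<bar> \<le> u n * sqrt (t n) * \<theta> n / sqrt (l n)"
            using elim l by (simp add: abs_divide divide_right_mono)
          have "\<bar>sqrt (t n / l n) - 1\<bar> \<le> \<bar>t n / l n - 1\<bar>" by (rule sqrt_near_one) (use facts(3,4)[of n] in simp)
          then show "\<bar>u n * (sqrt (t n / l n) - 1)\<bar> \<le> u n * \<bar>t n / l n - 1\<bar>" using elim by (simp add: abs_mult)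
        qed
        also have "\<dots> = u n * (sqrt (t n / l n) * \<theta> n + \<bar>t n / l n - 1\<bar>)"
          by (simp add: real_sqrt_divide algebra_simps)
        finally have "norm ((w n / sqrt (l n) - u n) * sqrt (real (J n))) \<le> u n * (sqrt (t n / l n) * \<theta> n + \<bar>t n / l n - 1\<bar>) * sqrt (real (J n))"
          by (simp add: abs_mult mult_right_mono)
        also have "\<dots> = u n * (sqrt (t n / l n) * \<theta> n + \<bar>t n / l n - 1\<bar>) * (real (J n) / sqrt (real (J n)))"
          by (subst sJ) (rule refl)
        also have "\<dots> = (u n / sqrt (real (J n))) * (sqrt (t n / l n) * (\<theta> n * real (J n)) + \<bar>real (J n) * (t n / l n - 1)\<bar>)"
        proof -
          have "a * (b * th + d) * (j / s) = a / s * (b * (th * j) + j * d)" for a b th d j s :: real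
            by (simp add: algebra_simps add_divide_distrib)
          then show ?thesis by (simp only: abs_mult abs_of_nat)
        qed
        finally show ?case .
      qed
      have "(\<lambda>n. (u n / sqrt (real (J n))) * (sqrt (t n / l n) * (\<theta> n * real (J n)) + \<bar>real (J n) * (t n / l n - 1)\<bar>))
         \<longlonglongrightarrow> sqrt (2 * ln 2) * (sqrt 1 * 0 + \<bar>0\<bar>)"
        by (intro tendsto_intros q tl1 \<theta> Jtl)
      then show "(\<lambda>n. (u n / sqrt (real (J n))) * (sqrt (t n / l n) * (\<theta> n * real (J n)) + \<bar>real (J n) * (t n / l n - 1)\<bar>)) \<longlonglongrightarrow> 0" by simp
    qed
    have T: "(\<lambda>n. (t n - l n) / sqrt (l n) * sqrt (real (J n))) \<longlonglongrightarrow> 0"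
    proof (rule Lim_null_comparison)
      show "\<forall>\<^sub>F n in sequentially. norm ((t n - l n) / sqrt (l n) * sqrt (real (J n))) \<le>
         C * sqrt C * (sqrt (t n / l n) * (real (J n) / sqrt (2 ^ J n)))"
        using reg evn
      proof eventually_elim
        case (elim n)
        have l: "sqrt (l n) > 0" using facts(3)[of n] by simp
        have "norm ((t n - l n) / sqrt (l n) * sqrt (real (J n))) = \<bar>l n - t n\<bar> / sqrt (l n) * sqrt (real (J n))"
          using facts(3)[of n] by (simp add: abs_mult abs_divide abs_minus_commute)
        also have "\<dots> \<le> (C * t n * sqrt (real (J n) / real n)) / sqrt (l n) * sqrt (real (J n))"
          using elim l by (intro mult_right_mono divide_right_mono) auto
        also have "\<dots> = C * sqrt (t n) * (sqrt (t n / l n) * (sqrt (real (J n) / real n) * sqrt (real (J n))))"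
        proof -
          have "t n = sqrt (t n) * sqrt (t n)" using facts(4)[of n] by simp
          then have "C * t n = C * (sqrt (t n) * sqrt (t n))" by simp
          then show ?thesis by (simp only: real_sqrt_divide) (simp add: mult_ac)
        qed
        also have "\<dots> \<le> C * sqrt (C * real n / 2 ^ J n) * (sqrt (t n / l n) * (sqrt (real (J n) / real n) * sqrt (real (J n))))"
          using elim cC facts(3,4)[of n] by (intro mult_right_mono mult_left_mono) auto
        also have "\<dots> = C * sqrt C * (sqrt (t n / l n) * (real (J n) / sqrt (2 ^ J n)))"
        proof -
          have "sqrt (real n) > 0" using elim by simp
          then have "sqrt (C * real n / 2 ^ J n) * (sqrt (real (J n) / real n) * sqrt (real (J n))) = sqrt C * (real (J n) / sqrt (2 ^ J n))"
            by (simp add: real_sqrt_divide real_sqrt_mult)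
          moreover have "C * a * (q * (b * d)) = C * z * (q * y)" if "a * (b * d) = z * y" for a b d q y z
          proof -
            have "C * a * (q * (b * d)) = C * q * (a * (b * d))" by (simp only: mult_ac)
            then show ?thesis unfolding that by (simp only: mult_ac)
          qed
          ultimately show ?thesis by blast
        qed
        finally show ?case .
      qed
      have "(\<lambda>n. C * sqrt C * (sqrt (t n / l n) * (real (J n) / sqrt (2 ^ J n)))) \<longlonglongrightarrow> C * sqrt C * (sqrt 1 * 0)"
        by (intro tendsto_intros tl1 J2')
      then show "(\<lambda>n. C * sqrt C * (sqrt (t n / l n) * (real (J n) / sqrt (2 ^ J n)))) \<longlonglongrightarrow> 0" by simp
    qed
    have "(\<lambda>n. 2 ^ J n * (\<Sum>k | k \<le> m n \<and> \<bar>real k - t n\<bar> > w n. binom_prob (m n) (r n) k)) \<longlonglongrightarrow> exp (- x)"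
      by (rule binomial_gumbel_tail[OF facts(1,2) J])
         (use Jl Jr facts(3) W T in \<open>simp_all only: l_def u_def\<close>)
    then show "(\<lambda>n. case g n of (m, r, t, w) \<Rightarrow> 2 ^ J n * (\<Sum>k | k \<le> m \<and> \<bar>real k - t\<bar> > w. binom_prob m r k)) \<longlonglongrightarrow> exp (- x)"
    proof (rule Lim_transform_eventually)
      show "\<forall>\<^sub>F n in sequentially. 2 ^ J n * (\<Sum>k | k \<le> m n \<and> \<bar>real k - t n\<bar> > w n. binom_prob (m n) (r n) k) =
        (case g n of (m, r, t, w) \<Rightarrow> 2 ^ J n * (\<Sum>k | k \<le> m \<and> \<bar>real k - t\<bar> > w. binom_prob m r k))"
        using evB
      proof eventually_elim
        case (elim n)
        then have "g n = (m n, r n, t n, w n)" using h[of n] by (simp add: h_def)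
        then show ?case by simp
      qed
    qed
  qed
  then show ?thesis by (simp add: case_prod_beta')
qed

section \<open>Sequential occupancy of bins\<close>

text \<open>Points sampled independently from \<open>\<mu>\<close> at the indices in \<open>I\<close>, each with a label in \<open>\<nat>\<close>.\<close>

locale labelled_sample = prob_space \<mu> for \<mu> :: "'a measure" +
  fixes b :: "'a \<Rightarrow> nat" and I :: "nat set"
  assumes b [measurable]: "b \<in> measurable \<mu> (count_space UNIV)" and finite_I [simp, intro]: "finite I"
begin

abbreviation "M \<equiv> PiM UNIV (\<lambda>_::nat. \<mu>)"

definition p :: "nat \<Rightarrow> real" where "p k = prob {x \<in> space \<mu>. b x = k}"

definition P :: "nat \<Rightarrow> real" where "P k = prob {x \<in> space \<mu>. b x < k}"

definition count :: "nat \<Rightarrow> (nat \<Rightarrow> 'a) \<Rightarrow> nat" where "count k \<omega> = card {i \<in> I. b (\<omega> i) = k}"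

definition below :: "nat \<Rightarrow> (nat \<Rightarrow> 'a) \<Rightarrow> nat" where "below k \<omega> = card {i \<in> I. b (\<omega> i) < k}"

text \<open>What is known once the bins \<open>< k\<close> have been inspected: the label of a point if it is \<open>< k\<close>, and
  \<open>k\<close> otherwise. There are only finitely many histories, which keeps conditioning elementary.\<close>

definition history :: "nat \<Rightarrow> (nat \<Rightarrow> 'a) \<Rightarrow> nat \<Rightarrow> nat" where "history k \<omega> = (\<lambda>i\<in>I. min (b (\<omega> i)) k)"

lemma P_Suc: "P (Suc k) = P k + p k"
proof -
  have "{x \<in> space \<mu>. b x < Suc k} = {x \<in> space \<mu>. b x < k} \<union> {x \<in> space \<mu>. b x = k}" by auto
  moreover have "prob ({x \<in> space \<mu>. b x < k} \<union> {x \<in> space \<mu>. b x = k}) = P k + p k"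
    unfolding P_def p_def by (rule finite_measure_Union) auto
  ultimately show ?thesis by (simp add: P_def)
qed


sublocale S: product_prob_space "\<lambda>_::nat. \<mu>" UNIV
  by unfold_locales

lemma cylinder_sets [measurable]: "{\<omega> \<in> space M. \<forall>i\<in>I. b (\<omega> i) \<in> C i} \<in> sets M"
  by measurable

lemma cylinder_prob:
  "measure M {\<omega> \<in> space M. \<forall>i\<in>I. b (\<omega> i) \<in> C i} = (\<Prod>i\<in>I. prob {x \<in> space \<mu>. b x \<in> C i})"
proof -
  have "emeasure M {\<omega> \<in> space M. \<forall>i\<in>I. \<omega> i \<in> {x \<in> space \<mu>. b x \<in> C i}} = (\<Prod>i\<in>I. emeasure \<mu> {x \<in> space \<mu>. b x \<in> C i})"
    by (rule S.emeasure_PiM_Collect) auto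
  also have "{\<omega> \<in> space M. \<forall>i\<in>I. \<omega> i \<in> {x \<in> space \<mu>. b x \<in> C i}} = {\<omega> \<in> space M. \<forall>i\<in>I. b (\<omega> i) \<in> C i}"
    by (auto simp: space_PiM PiE_iff)
  finally have "ennreal (measure M {\<omega> \<in> space M. \<forall>i\<in>I. b (\<omega> i) \<in> C i}) = ennreal (\<Prod>i\<in>I. prob {x \<in> space \<mu>. b x \<in> C i})"
    unfolding S.emeasure_eq_measure emeasure_eq_measure by (simp only: prod_ennreal measure_nonneg)
  then show ?thesis
    by (simp only: ennreal_inj measure_nonneg prod_nonneg)
qed

lemma history_PiE: "history k \<omega> \<in> PiE I (\<lambda>_. {..k})"
  by (auto simp: history_def)

lemma finite_historys: "finite (PiE I (\<lambda>_. {..k}) :: (nat \<Rightarrow> nat) set)"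
  by (intro finite_PiE) auto

lemma history_eq_iff:
  assumes "\<tau> \<in> PiE I (\<lambda>_. {..k})"
  shows "history k \<omega> = \<tau> \<longleftrightarrow> (\<forall>i\<in>I. b (\<omega> i) \<in> (if \<tau> i = k then {k..} else {\<tau> i}))"
proof
  assume "history k \<omega> = \<tau>"
  then show "\<forall>i\<in>I. b (\<omega> i) \<in> (if \<tau> i = k then {k..} else {\<tau> i})"
    by (auto simp: history_def min_def split: if_splits)
next
  assume *: "\<forall>i\<in>I. b (\<omega> i) \<in> (if \<tau> i = k then {k..} else {\<tau> i})"
  show "history k \<omega> = \<tau>"
  proof (rule PiE_ext[OF history_PiE assms])
    fix i assume "i \<in> I"
    then show "history k \<omega> i = \<tau> i" using * assms by (fastforce simp: history_def min_def PiE_iff split: if_splits)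
  qed
qed

text \<open>Given the history, the points not yet located fall into bin \<open>k\<close> independently with probability
  \<open>p k / (1 - P k)\<close>. Each set of indices for these points determines a cylinder, and the cylinders
  for sets of size \<open>a\<close> have equal probability.\<close>

lemma count_fiber_prob:
  assumes \<tau>: "\<tau> \<in> PiE I (\<lambda>_. {..k})" and Pk: "P k < 1"
  defines "R \<equiv> {i \<in> I. \<tau> i = k}"
  shows "measure M {\<omega> \<in> space M. history k \<omega> = \<tau> \<and> count k \<omega> = a} =
     measure M {\<omega> \<in> space M. history k \<omega> = \<tau>} * binom_prob (card R) (p k / (1 - P k)) a"
proof -
  define q where "q = p k / (1 - P k)"
  have R: "R \<subseteq> I" "finite R" by (auto simp: R_def)
  define w where "w = (\<Prod>i\<in>I - R. p (\<tau> i))"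
  have prob_ge: "prob {x \<in> space \<mu>. b x \<in> {k..}} = 1 - P k"
  proof -
    have "{x \<in> space \<mu>. b x \<in> {k..}} = space \<mu> - {x \<in> space \<mu>. b x < k}" by auto
    then show ?thesis by (simp add: P_def prob_compl)
  qed
  have prob_gt: "prob {x \<in> space \<mu>. b x \<in> {k<..}} = 1 - P (Suc k)"
  proof -
    have "{x \<in> space \<mu>. b x \<in> {k<..}} = space \<mu> - {x \<in> space \<mu>. b x < Suc k}" by auto
    then show ?thesis by (simp add: P_def prob_compl)
  qed
  have qs: "p k = (1 - P k) * q" "1 - P (Suc k) = (1 - P k) * (1 - q)"
    using Pk by (auto simp: q_def P_Suc field_simps)
  have tr: "measure M {\<omega> \<in> space M. history k \<omega> = \<tau>} = w * (1 - P k) ^ card R"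
  proof -
    have "measure M {\<omega> \<in> space M. history k \<omega> = \<tau>} = (\<Prod>i\<in>I. prob {x \<in> space \<mu>. b x \<in> (if \<tau> i = k then {k..} else {\<tau> i})})"
      unfolding history_eq_iff[OF \<tau>] by (rule cylinder_prob)
    also have "\<dots> = (\<Prod>i\<in>I - R. prob {x \<in> space \<mu>. b x \<in> (if \<tau> i = k then {k..} else {\<tau> i})})
       * (\<Prod>i\<in>R. prob {x \<in> space \<mu>. b x \<in> (if \<tau> i = k then {k..} else {\<tau> i})})"
      using R by (intro prod.subset_diff) auto
    also have "(\<Prod>i\<in>I - R. prob {x \<in> space \<mu>. b x \<in> (if \<tau> i = k then {k..} else {\<tau> i})}) = w"
      unfolding w_def by (intro prod.cong refl) (auto simp: R_def p_def)
    also have "(\<Prod>i\<in>R. prob {x \<in> space \<mu>. b x \<in> (if \<tau> i = k then {k..} else {\<tau> i})}) = (\<Prod>i\<in>R. 1 - P k)"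
      by (intro prod.cong refl) (use prob_ge in \<open>auto simp: R_def\<close>)
    finally show ?thesis by simp
  qed
  define C where "C = (\<lambda>A i. if i \<in> R then (if i \<in> A then {k} else {k<..}) else {\<tau> i})"
  define \<A> where "\<A> = {A. A \<subseteq> R \<and> card A = a}"
  have fin: "finite \<A>" using R by (simp add: \<A>_def)
  have cell: "measure M {\<omega> \<in> space M. \<forall>i\<in>I. b (\<omega> i) \<in> C A i} = w * ((1 - P k) ^ card R * (q ^ a * (1 - q) ^ (card R - a)))"
    if "A \<in> \<A>" for A
  proof -
    have A: "A \<subseteq> R" "card A = a" "finite A" using that R by (auto simp: \<A>_def intro: finite_subset)
    have aR: "a \<le> card R" using A R card_mono by blast
    have "measure M {\<omega> \<in> space M. \<forall>i\<in>I. b (\<omega> i) \<in> C A i} = (\<Prod>i\<in>I. prob {x \<in> space \<mu>. b x \<in> C A i})"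
      by (rule cylinder_prob)
    also have "\<dots> = (\<Prod>i\<in>I - R. prob {x \<in> space \<mu>. b x \<in> C A i}) * (\<Prod>i\<in>R. prob {x \<in> space \<mu>. b x \<in> C A i})"
      using R by (intro prod.subset_diff) auto
    also have "(\<Prod>i\<in>I - R. prob {x \<in> space \<mu>. b x \<in> C A i}) = w"
      unfolding w_def by (intro prod.cong refl) (auto simp: C_def p_def)
    also have "(\<Prod>i\<in>R. prob {x \<in> space \<mu>. b x \<in> C A i}) = (\<Prod>i\<in>R - A. prob {x \<in> space \<mu>. b x \<in> C A i}) * (\<Prod>i\<in>A. prob {x \<in> space \<mu>. b x \<in> C A i})"
      using A R by (intro prod.subset_diff) auto
    also have "(\<Prod>i\<in>R - A. prob {x \<in> space \<mu>. b x \<in> C A i}) = (\<Prod>i\<in>R - A. 1 - P (Suc k))"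
      by (intro prod.cong refl) (use prob_gt in \<open>auto simp: C_def\<close>)
    also have "(\<Prod>i\<in>A. prob {x \<in> space \<mu>. b x \<in> C A i}) = (\<Prod>i\<in>A. p k)"
      by (intro prod.cong refl) (use A in \<open>auto simp: C_def p_def\<close>)
    also have "(\<Prod>i\<in>R - A. 1 - P (Suc k)) * (\<Prod>i\<in>A. p k) = ((1 - P k) * (1 - q)) ^ (card R - a) * ((1 - P k) * q) ^ a"
      using A R by (simp add: card_Diff_subset qs)
    also have "\<dots> = (1 - P k) ^ (card R - a + a) * (q ^ a * (1 - q) ^ (card R - a))"
      by (simp add: power_mult_distrib power_add mult_ac)
    also have "card R - a + a = card R" using aR by simp
    finally show ?thesis .
  qed
  have "{\<omega> \<in> space M. history k \<omega> = \<tau> \<and> count k \<omega> = a} = (\<Union>A\<in>\<A>. {\<omega> \<in> space M. \<forall>i\<in>I. b (\<omega> i) \<in> C A i})"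
    (is "?L = ?U")
  proof (intro set_eqI iffI)
    fix \<omega> assume "\<omega> \<in> ?L"
    then have \<omega>: "\<omega> \<in> space M" "\<forall>i\<in>I. b (\<omega> i) \<in> (if \<tau> i = k then {k..} else {\<tau> i})" "count k \<omega> = a"
      using history_eq_iff[OF \<tau>] by auto
    define A where "A = {i \<in> I. b (\<omega> i) = k}"
    have "A \<subseteq> R" using \<omega>(2) by (auto simp: A_def R_def split: if_splits)
    then have "A \<in> \<A>" using \<omega>(3) by (simp add: \<A>_def A_def count_def)
    moreover have "\<forall>i\<in>I. b (\<omega> i) \<in> C A i"
      using \<omega>(2) by (auto simp: C_def A_def R_def less_le split: if_splits)
    ultimately show "\<omega> \<in> ?U" using \<omega>(1) by blast
  next
    fix \<omega> assume "\<omega> \<in> ?U"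
    then obtain A where A: "A \<subseteq> R" "card A = a" "\<omega> \<in> space M" "\<forall>i\<in>I. b (\<omega> i) \<in> C A i"
      by (auto simp: \<A>_def)
    have "history k \<omega> = \<tau>"
      unfolding history_eq_iff[OF \<tau>] using A(4) by (auto simp: C_def R_def split: if_splits)
    moreover have "{i \<in> I. b (\<omega> i) = k} = A"
    proof (intro set_eqI iffI)
      fix i assume "i \<in> {i \<in> I. b (\<omega> i) = k}"
      then show "i \<in> A" using A(4) by (auto simp: C_def R_def split: if_splits)
    next
      fix i assume "i \<in> A"
      then have "i \<in> R" "i \<in> I" using A(1) R by auto
      then show "i \<in> {i \<in> I. b (\<omega> i) = k}" using A(4)[rule_format, of i] \<open>i \<in> A\<close> by (simp add: C_def)
    qed
    ultimately show "\<omega> \<in> ?L" using A by (simp add: count_def)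
  qed
  also have "measure M \<dots> = (\<Sum>A\<in>\<A>. measure M {\<omega> \<in> space M. \<forall>i\<in>I. b (\<omega> i) \<in> C A i})"
  proof (rule S.finite_measure_finite_Union[OF fin])
    show "(\<lambda>A. {\<omega> \<in> space M. \<forall>i\<in>I. b (\<omega> i) \<in> C A i}) ` \<A> \<subseteq> sets M" by auto
    show "disjoint_family_on (\<lambda>A. {\<omega> \<in> space M. \<forall>i\<in>I. b (\<omega> i) \<in> C A i}) \<A>"
      unfolding disjoint_family_on_def
    proof (intro ballI impI)
      fix A B assume AB: "A \<in> \<A>" "B \<in> \<A>" "A \<noteq> B"
      have sub: "A' \<subseteq> B'" if "A' \<in> \<A>" "\<omega> \<in> {\<omega> \<in> space M. \<forall>i\<in>I. b (\<omega> i) \<in> C A' i}" "\<omega> \<in> {\<omega> \<in> space M. \<forall>i\<in>I. b (\<omega> i) \<in> C B' i}" for A' B' \<omega>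
      proof
        fix i assume "i \<in> A'"
        then have "i \<in> R" "i \<in> I" using that R by (auto simp: \<A>_def)
        then have "b (\<omega> i) \<in> C A' i" "b (\<omega> i) \<in> C B' i" using that by auto
        then show "i \<in> B'" using \<open>i \<in> R\<close> \<open>i \<in> A'\<close> by (auto simp: C_def split: if_splits)
      qed
      show "{\<omega> \<in> space M. \<forall>i\<in>I. b (\<omega> i) \<in> C A i} \<inter> {\<omega> \<in> space M. \<forall>i\<in>I. b (\<omega> i) \<in> C B i} = {}"
        using sub[of A _ B] sub[of B _ A] AB by blast
    qed
  qed
  also have "\<dots> = (\<Sum>A\<in>\<A>. w * ((1 - P k) ^ card R * (q ^ a * (1 - q) ^ (card R - a))))"
    by (intro sum.cong refl cell)
  also have "\<dots> = real (card \<A>) * (w * ((1 - P k) ^ card R * (q ^ a * (1 - q) ^ (card R - a))))" by simp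
  also have "card \<A> = card R choose a" unfolding \<A>_def using R by (simp add: n_subsets)
  also have "real (card R choose a) * (w * ((1 - P k) ^ card R * (q ^ a * (1 - q) ^ (card R - a)))) =
     measure M {\<omega> \<in> space M. history k \<omega> = \<tau>} * binom_prob (card R) q a"
    unfolding tr binom_prob_def by (simp add: mult_ac)
  finally show ?thesis unfolding q_def .
qed

lemma history_sets [measurable]: "{\<omega> \<in> space M. history k \<omega> = \<tau>} \<in> sets M"
proof (cases "\<tau> \<in> PiE I (\<lambda>_. {..k})")
  case True
  show ?thesis unfolding history_eq_iff[OF True] by (rule cylinder_sets)
next
  case False
  then have "{\<omega> \<in> space M. history k \<omega> = \<tau>} = {}" using history_PiE by blast
  then show ?thesis by (simp only: sets.empty_sets)
qed

lemma history_pred_sets: "{\<omega> \<in> space M. Q (history k \<omega>)} \<in> sets M"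
proof -
  have "{\<omega> \<in> space M. Q (history k \<omega>)} = (\<Union>\<tau>\<in>{\<tau> \<in> PiE I (\<lambda>_. {..k}). Q \<tau>}. {\<omega> \<in> space M. history k \<omega> = \<tau>})"
    using history_PiE by auto
  moreover have "\<dots> \<in> sets M"
    using finite_historys by (intro sets.finite_UN) auto
  ultimately show ?thesis by simp
qed

lemma count_eq_history: "i < k \<Longrightarrow> count i \<omega> = card {l \<in> I. history k \<omega> l = i}"
  unfolding count_def by (rule arg_cong[where f = card]) (auto simp: history_def)

lemma below_eq_history: "i \<le> k \<Longrightarrow> below i \<omega> = card {l \<in> I. history k \<omega> l < i}"
  unfolding below_def by (rule arg_cong[where f = card]) (auto simp: history_def)

lemma card_fiber: "card {l \<in> I. history k \<omega> l = k} = card I - below k \<omega>"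
proof -
  have "{l \<in> I. history k \<omega> l = k} = I - {i \<in> I. b (\<omega> i) < k}" by (auto simp: history_def)
  then show ?thesis by (simp add: below_def card_Diff_subset)
qed

lemma history_count_prob:
  assumes Pk: "P k < 1"
  shows "measure M {\<omega> \<in> space M. Q (history k \<omega>) \<and> X (count k \<omega>)} =
    (\<Sum>\<tau> | \<tau> \<in> PiE I (\<lambda>_. {..k}) \<and> Q \<tau>. measure M {\<omega> \<in> space M. history k \<omega> = \<tau>} *
       (\<Sum>a | a \<le> card {i \<in> I. \<tau> i = k} \<and> X a. binom_prob (card {i \<in> I. \<tau> i = k}) (p k / (1 - P k)) a))"
proof -
  define T where "T = {\<tau> \<in> PiE I (\<lambda>_. {..k}). Q \<tau>}"
  have finT: "finite T" using finite_historys by (simp add: T_def)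
  define W where "W = Sigma T (\<lambda>\<tau>. {a. a \<le> card {i \<in> I. \<tau> i = k} \<and> X a})"
  have finW: "finite W" unfolding W_def using finT by (intro finite_SigmaI) auto
  have sets: "{\<omega> \<in> space M. history k \<omega> = \<tau> \<and> count k \<omega> = a} \<in> sets M" for \<tau> a
  proof -
    have "{\<omega> \<in> space M. history k \<omega> = \<tau> \<and> count k \<omega> = a} =
      {\<omega> \<in> space M. history k \<omega> = \<tau>} \<inter> {\<omega> \<in> space M. card {l \<in> I. history (Suc k) \<omega> l = k} = a}"
      using count_eq_history[of k "Suc k"] by auto
    then show ?thesis using history_pred_sets[of "\<lambda>\<tau>. card {l \<in> I. \<tau> l = k} = a" "Suc k"] by auto
  qed
  have "{\<omega> \<in> space M. Q (history k \<omega>) \<and> X (count k \<omega>)} = (\<Union>(\<tau>, a)\<in>W. {\<omega> \<in> space M. history k \<omega> = \<tau> \<and> count k \<omega> = a})"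
  proof (intro set_eqI iffI)
    fix \<omega> assume *: "\<omega> \<in> {\<omega> \<in> space M. Q (history k \<omega>) \<and> X (count k \<omega>)}"
    have "count k \<omega> \<le> card {i \<in> I. history k \<omega> i = k}"
      unfolding count_def by (rule card_mono) (auto simp: history_def)
    then have "(history k \<omega>, count k \<omega>) \<in> W" using * history_PiE by (auto simp: W_def T_def)
    then show "\<omega> \<in> (\<Union>(\<tau>, a)\<in>W. {\<omega> \<in> space M. history k \<omega> = \<tau> \<and> count k \<omega> = a})" using * by blast
  qed (auto simp: W_def T_def)
  also have "measure M \<dots> = (\<Sum>x\<in>W. measure M (case x of (\<tau>, a) \<Rightarrow> {\<omega> \<in> space M. history k \<omega> = \<tau> \<and> count k \<omega> = a}))"
  proof (rule S.finite_measure_finite_Union[OF finW])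
    show "(\<lambda>x. case x of (\<tau>, a) \<Rightarrow> {\<omega> \<in> space M. history k \<omega> = \<tau> \<and> count k \<omega> = a}) ` W \<subseteq> sets M" using sets by auto
    show "disjoint_family_on (\<lambda>x. case x of (\<tau>, a) \<Rightarrow> {\<omega> \<in> space M. history k \<omega> = \<tau> \<and> count k \<omega> = a}) W"
      by (auto simp: disjoint_family_on_def)
  qed
  also have "\<dots> = (\<Sum>(\<tau>, a)\<in>W. measure M {\<omega> \<in> space M. history k \<omega> = \<tau> \<and> count k \<omega> = a})"
    by (intro sum.cong refl) auto
  also have "\<dots> = (\<Sum>\<tau>\<in>T. \<Sum>a | a \<le> card {i \<in> I. \<tau> i = k} \<and> X a. measure M {\<omega> \<in> space M. history k \<omega> = \<tau> \<and> count k \<omega> = a})"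
    unfolding W_def using finT by (subst sum.Sigma[symmetric]) auto
  also have "\<dots> = (\<Sum>\<tau>\<in>T. measure M {\<omega> \<in> space M. history k \<omega> = \<tau>} *
       (\<Sum>a | a \<le> card {i \<in> I. \<tau> i = k} \<and> X a. binom_prob (card {i \<in> I. \<tau> i = k}) (p k / (1 - P k)) a))"
  proof (rule sum.cong[OF refl])
    fix \<tau> assume "\<tau> \<in> T"
    then have \<tau>: "\<tau> \<in> PiE I (\<lambda>_. {..k})" by (simp add: T_def)
    show "(\<Sum>a | a \<le> card {i \<in> I. \<tau> i = k} \<and> X a. measure M {\<omega> \<in> space M. history k \<omega> = \<tau> \<and> count k \<omega> = a}) =
      measure M {\<omega> \<in> space M. history k \<omega> = \<tau>} *
       (\<Sum>a | a \<le> card {i \<in> I. \<tau> i = k} \<and> X a. binom_prob (card {i \<in> I. \<tau> i = k}) (p k / (1 - P k)) a)"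
      unfolding count_fiber_prob[OF \<tau> Pk] by (rule sum_distrib_left[symmetric])
  qed
  finally show ?thesis by (simp add: T_def)
qed

lemma history_prob:
  "measure M {\<omega> \<in> space M. Q (history k \<omega>)} = (\<Sum>\<tau> | \<tau> \<in> PiE I (\<lambda>_. {..k}) \<and> Q \<tau>. measure M {\<omega> \<in> space M. history k \<omega> = \<tau>})"
proof -
  define T where "T = {\<tau> \<in> PiE I (\<lambda>_. {..k}). Q \<tau>}"
  have finT: "finite T" using finite_historys by (simp add: T_def)
  have "{\<omega> \<in> space M. Q (history k \<omega>)} = (\<Union>\<tau>\<in>T. {\<omega> \<in> space M. history k \<omega> = \<tau>})"
    using history_PiE by (auto simp: T_def)
  also have "measure M \<dots> = (\<Sum>\<tau>\<in>T. measure M {\<omega> \<in> space M. history k \<omega> = \<tau>})"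
    by (rule S.finite_measure_finite_Union[OF finT]) (auto simp: disjoint_family_on_def)
  finally show ?thesis by (simp add: T_def)
qed

text \<open>A bound that holds for every history consistent with \<open>H\<close> holds after averaging over \<open>H\<close>.\<close>

lemma conditional_exceedance_bounds:
  assumes Pk: "P k < 1"
    and Q: "\<And>\<omega>. \<omega> \<in> space M \<Longrightarrow> H \<omega> \<longleftrightarrow> Q (history k \<omega>)"
    and bd: "\<And>\<omega>. \<omega> \<in> space M \<Longrightarrow> H \<omega> \<Longrightarrow>
       (\<Sum>a | a \<le> card I - below k \<omega> \<and> X a. binom_prob (card I - below k \<omega>) (p k / (1 - P k)) a) \<in> {lo..hi}"
  shows "measure M {\<omega> \<in> space M. H \<omega> \<and> X (count k \<omega>)} \<in> {lo * measure M {\<omega> \<in> space M. H \<omega>} .. hi * measure M {\<omega> \<in> space M. H \<omega>}}"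
proof -
  define g where "g = (\<lambda>c. \<Sum>a | a \<le> c \<and> X a. binom_prob c (p k / (1 - P k)) a)"
  define T where "T = {\<tau> \<in> PiE I (\<lambda>_. {..k}). Q \<tau>}"
  define W where "W = (\<lambda>\<tau>. measure M {\<omega> \<in> space M. history k \<omega> = \<tau>})"
  have e1: "{\<omega> \<in> space M. H \<omega> \<and> X (count k \<omega>)} = {\<omega> \<in> space M. Q (history k \<omega>) \<and> X (count k \<omega>)}" using Q by auto
  have e2: "{\<omega> \<in> space M. H \<omega>} = {\<omega> \<in> space M. Q (history k \<omega>)}" using Q by auto
  have m1: "measure M {\<omega> \<in> space M. H \<omega> \<and> X (count k \<omega>)} = (\<Sum>\<tau>\<in>T. W \<tau> * g (card {i \<in> I. \<tau> i = k}))"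
    unfolding e1 by (subst history_count_prob[OF Pk]) (simp add: T_def W_def g_def)
  have m2: "measure M {\<omega> \<in> space M. H \<omega>} = (\<Sum>\<tau>\<in>T. W \<tau>)"
    unfolding e2 by (subst history_prob) (simp add: T_def W_def)
  have bnd: "lo * W \<tau> \<le> W \<tau> * g (card {i \<in> I. \<tau> i = k}) \<and> W \<tau> * g (card {i \<in> I. \<tau> i = k}) \<le> hi * W \<tau>" if "\<tau> \<in> T" for \<tau>
  proof (cases "{\<omega> \<in> space M. history k \<omega> = \<tau>} = {}")
    case True
    then show ?thesis by (simp only: W_def) simp
  next
    case False
    then obtain \<omega> where \<omega>: "\<omega> \<in> space M" "history k \<omega> = \<tau>" by auto
    then have "H \<omega>" using that Q by (auto simp: T_def)
    then have "g (card {i \<in> I. \<tau> i = k}) \<in> {lo..hi}"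
      using bd[OF \<omega>(1)] card_fiber[of k \<omega>] \<omega> by (simp add: g_def)
    moreover have "W \<tau> \<ge> 0" by (simp add: W_def)
    ultimately show ?thesis unfolding mult.commute[of _ "W \<tau>"] by (auto intro: mult_left_mono)
  qed
  show ?thesis unfolding m1 m2 using bnd
    by (auto simp: sum_distrib_left intro!: sum_mono)
qed

text \<open>Inspect the bins in order, stopping when a count is not \<open>ok\<close> or a partial sum is not \<open>good\<close>.
  Each inspection preserves a fraction between \<open>1 - hi\<close> and \<open>1 - lo\<close> of the surviving probability.
  Losses through partial sums are losses to the lower bound only, and they add up to at most the
  probability that some partial sum is not good.\<close>

theorem sequential_occupancy:
  fixes good ok :: "nat \<Rightarrow> nat \<Rightarrow> bool"
  assumes P: "\<And>k. k < K \<Longrightarrow> P k < 1"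
    and bd: "\<And>k s. k < K \<Longrightarrow> s \<le> card I \<Longrightarrow> good k s \<Longrightarrow>
       (\<Sum>a | a \<le> card I - s \<and> \<not> ok k a. binom_prob (card I - s) (p k / (1 - P k)) a) \<in> {lo..hi}"
    and lohi: "lo \<le> 1" "0 \<le> hi" "hi \<le> 1"
  shows "measure M {\<omega> \<in> space M. \<forall>k<K. ok k (count k \<omega>)} \<in>
    {(1 - hi) ^ K - measure M {\<omega> \<in> space M. \<exists>k<K. \<not> good k (below k \<omega>)} ..
     (1 - lo) ^ K + measure M {\<omega> \<in> space M. \<exists>k<K. \<not> good k (below k \<omega>)}}"
proof -
  define G where "G = (\<lambda>k \<omega>. \<forall>i<k. good i (below i \<omega>))"
  define E where "E = (\<lambda>k \<omega>. \<forall>i<k. ok i (count i \<omega>) \<and> good i (below i \<omega>))"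
  define H where "H = (\<lambda>k \<omega>. E k \<omega> \<and> good k (below k \<omega>))"
  have below_le: "below k \<omega> \<le> card I" for k \<omega> unfolding below_def by (rule card_mono) auto
  have H_history: "H k \<omega> \<longleftrightarrow> (\<forall>i<k. ok i (card {l \<in> I. history k \<omega> l = i}) \<and> good i (card {l \<in> I. history k \<omega> l < i})) \<and> good k (card {l \<in> I. history k \<omega> l < k})" for k \<omega>
    unfolding H_def E_def using count_eq_history[of _ k \<omega>] below_eq_history[of _ k \<omega>] by auto
  have E_history: "E k \<omega> \<longleftrightarrow> (\<forall>i<k. ok i (card {l \<in> I. history k \<omega> l = i}) \<and> good i (card {l \<in> I. history k \<omega> l < i}))" for k \<omega>
    unfolding E_def using count_eq_history[of _ k \<omega>] below_eq_history[of _ k \<omega>] by auto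
  have G_history: "G k \<omega> \<longleftrightarrow> (\<forall>i<k. good i (card {l \<in> I. history k \<omega> l < i}))" for k \<omega>
    unfolding G_def using below_eq_history[of _ k \<omega>] by auto
  have O_history: "(\<forall>i<k. ok i (count i \<omega>)) \<longleftrightarrow> (\<forall>i<k. ok i (card {l \<in> I. history k \<omega> l = i}))" for k \<omega>
    using count_eq_history[of _ k \<omega>] by auto
  have sE[measurable]: "{\<omega> \<in> space M. E k \<omega>} \<in> sets M" for k unfolding E_history by (rule history_pred_sets)
  have sH[measurable]: "{\<omega> \<in> space M. H k \<omega>} \<in> sets M" for k unfolding H_history by (rule history_pred_sets)
  have sO[measurable]: "{\<omega> \<in> space M. \<forall>i<k. ok i (count i \<omega>)} \<in> sets M" for k unfolding O_history by (rule history_pred_sets)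
  have nG[measurable]: "{\<omega> \<in> space M. \<not> G k \<omega>} \<in> sets M" for k unfolding G_history by (rule history_pred_sets)
  define e where "e = (\<lambda>k. measure M {\<omega> \<in> space M. E k \<omega>})"
  define h where "h = (\<lambda>k. measure M {\<omega> \<in> space M. H k \<omega>})"
  define g where "g = (\<lambda>k. measure M {\<omega> \<in> space M. \<not> G k \<omega>})"
  have step: "e (Suc k) \<in> {(1 - hi) * h k .. (1 - lo) * h k}" if "k < K" for k
  proof -
    have x: "measure M {\<omega> \<in> space M. H k \<omega> \<and> \<not> ok k (count k \<omega>)} \<in> {lo * h k .. hi * h k}"
      unfolding h_def
    proof (rule conditional_exceedance_bounds[where Q = "\<lambda>\<tau>. (\<forall>i<k. ok i (card {l \<in> I. \<tau> l = i}) \<and> good i (card {l \<in> I. \<tau> l < i})) \<and> good k (card {l \<in> I. \<tau> l < k})"])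
      show "P k < 1" using P that .
      show "H k \<omega> \<longleftrightarrow> (\<forall>i<k. ok i (card {l \<in> I. history k \<omega> l = i}) \<and> good i (card {l \<in> I. history k \<omega> l < i})) \<and> good k (card {l \<in> I. history k \<omega> l < k})" for \<omega>
        by (rule H_history)
      show "(\<Sum>a | a \<le> card I - below k \<omega> \<and> \<not> ok k a. binom_prob (card I - below k \<omega>) (p k / (1 - P k)) a) \<in> {lo..hi}"
        if "H k \<omega>" for \<omega> using bd[OF \<open>k < K\<close> below_le] that by (simp add: H_def)
    qed
    have ES: "E (Suc k) \<omega> \<longleftrightarrow> H k \<omega> \<and> ok k (count k \<omega>)" for \<omega>
      unfolding H_def E_def by (auto simp: less_Suc_eq)
    have "{\<omega> \<in> space M. H k \<omega> \<and> \<not> ok k (count k \<omega>)} = {\<omega> \<in> space M. H k \<omega>} - {\<omega> \<in> space M. E (Suc k) \<omega>}"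
      using ES by auto
    moreover have "{\<omega> \<in> space M. E (Suc k) \<omega>} \<subseteq> {\<omega> \<in> space M. H k \<omega>}" using ES by auto
    ultimately have "measure M {\<omega> \<in> space M. H k \<omega> \<and> \<not> ok k (count k \<omega>)} = h k - e (Suc k)"
      unfolding h_def e_def by (simp add: S.finite_measure_Diff)
    with x show ?thesis by (auto simp: algebra_simps)
  qed
  have hle: "h k \<le> e k" for k
    unfolding h_def e_def by (rule S.finite_measure_mono[OF _ sE]) (auto simp: H_def)
  have hge: "e k - (g (Suc k) - g k) \<le> h k" for k
  proof -
    have "{\<omega> \<in> space M. E k \<omega>} \<union> {\<omega> \<in> space M. \<not> G k \<omega>} \<subseteq> {\<omega> \<in> space M. H k \<omega>} \<union> {\<omega> \<in> space M. \<not> G (Suc k) \<omega>}"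
      by (auto simp: G_def H_def less_Suc_eq)
    then have "measure M ({\<omega> \<in> space M. E k \<omega>} \<union> {\<omega> \<in> space M. \<not> G k \<omega>}) \<le> measure M ({\<omega> \<in> space M. H k \<omega>} \<union> {\<omega> \<in> space M. \<not> G (Suc k) \<omega>})"
      by (rule S.finite_measure_mono) auto
    also have "\<dots> \<le> h k + g (Suc k)" unfolding h_def g_def by (rule measure_Un_le) auto
    also have "measure M ({\<omega> \<in> space M. E k \<omega>} \<union> {\<omega> \<in> space M. \<not> G k \<omega>}) = e k + g k"
      unfolding e_def g_def
      by (rule S.finite_measure_Union[OF sE nG]) (auto simp: E_def G_def)
    finally show ?thesis by simp
  qed
  have e0: "e 0 = 1" unfolding e_def E_def using S.P.prob_space by simp
  have up: "k \<le> K \<Longrightarrow> e k \<le> (1 - lo) ^ k" for k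
  proof (induction k)
    case (Suc k)
    have "e (Suc k) \<le> (1 - lo) * h k" using step[of k] Suc.prems by auto
    also have "\<dots> \<le> (1 - lo) * (1 - lo) ^ k" using Suc hle[of k] lohi by (intro mult_left_mono) auto
    finally show ?case by simp
  qed (simp add: e0)
  have low: "k \<le> K \<Longrightarrow> (1 - hi) ^ k - g k \<le> e k" for k
  proof (induction k)
    case 0
    have "g 0 \<ge> 0" by (simp add: g_def)
    then show ?case by (simp add: e0)
  next
    case (Suc k)
    have gS: "g k \<le> g (Suc k)" unfolding g_def by (rule S.finite_measure_mono[OF _ nG]) (auto simp: G_def intro: less_SucI)
    have "0 \<le> g k" by (simp add: g_def)
    then have "(1 - hi) ^ Suc k - g (Suc k) \<le> (1 - hi) * (1 - hi) ^ k - (1 - hi) * g (Suc k)"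
      using lohi gS mult_left_mono[of "1 - hi" 1 "g (Suc k)"] by (simp add: mult.commute)
    also have "\<dots> = (1 - hi) * (((1 - hi) ^ k - g k) - (g (Suc k) - g k))" by (simp add: algebra_simps)
    also have "\<dots> \<le> (1 - hi) * (e k - (g (Suc k) - g k))" using Suc lohi by (intro mult_left_mono) auto
    also have "\<dots> \<le> (1 - hi) * h k" using hge[of k] lohi by (intro mult_left_mono) auto
    also have "\<dots> \<le> e (Suc k)" using step[of k] Suc.prems by auto
    finally show ?case .
  qed
  have bad: "{\<omega> \<in> space M. \<exists>k<K. \<not> good k (below k \<omega>)} = {\<omega> \<in> space M. \<not> G K \<omega>}" by (auto simp: G_def)
  have 1: "e K \<le> measure M {\<omega> \<in> space M. \<forall>k<K. ok k (count k \<omega>)}"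
    unfolding e_def by (rule S.finite_measure_mono[OF _ sO]) (auto simp: E_def)
  have "measure M {\<omega> \<in> space M. \<forall>k<K. ok k (count k \<omega>)} \<le> measure M ({\<omega> \<in> space M. E K \<omega>} \<union> {\<omega> \<in> space M. \<not> G K \<omega>})"
    by (rule S.finite_measure_mono[OF _ sets.Un[OF sE nG]]) (auto simp: E_def G_def)
  also have "\<dots> \<le> e K + g K" unfolding e_def g_def by (rule measure_Un_le) auto
  finally show ?thesis using 1 up[of K] low[of K] unfolding bad g_def by auto
qed

lemma below_pred_sets: "{\<omega> \<in> space M. Q (below k \<omega>)} \<in> sets M"
  unfolding below_eq_history[OF order_refl] by (rule history_pred_sets)

text \<open>Relabelling the points by whether their label is \<open>< k\<close> makes the partial sum the count of a
  single bin, so it is binomial by the case of an empty history.\<close>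

lemma below_hoeffding:
  assumes I: "I \<noteq> {}" and \<epsilon>: "\<epsilon> \<ge> 0"
  shows "measure M {\<omega> \<in> space M. \<epsilon> \<le> \<bar>real (below k \<omega>) - real (card I) * P k\<bar>} \<le> 2 * exp (- 2 * \<epsilon>\<^sup>2 / real (card I))"
proof -
  interpret L: labelled_sample \<mu> "\<lambda>x. if b x < k then 0 else (1::nat)" I
    by unfold_locales (simp_all)
  define n where "n = card I"
  have n: "n > 0" using I by (simp add: n_def card_gt_0_iff)
  define X where "X = (\<lambda>a. \<epsilon> \<le> \<bar>real a - real n * P k\<bar>)"
  have L: "L.P 0 = 0" "L.below 0 \<omega> = 0" for \<omega>
    by (simp_all add: L.P_def L.below_def)
  have Lp: "L.p 0 = P k"
    unfolding L.p_def P_def by (rule arg_cong[where f = prob]) (auto split: if_splits)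
  have Lc: "L.count 0 \<omega> = below k \<omega>" for \<omega>
    unfolding L.count_def below_def by (rule arg_cong[where f = card]) (auto split: if_splits)
  define v where "v = (\<Sum>a | a \<le> n \<and> X a. binom_prob n (P k) a)"
  have "measure M {\<omega> \<in> space M. True \<and> X (L.count 0 \<omega>)} \<in> {v * measure M {\<omega> \<in> space M. True} .. v * measure M {\<omega> \<in> space M. True}}"
    by (rule L.conditional_exceedance_bounds[where Q = "\<lambda>_. True"]) (simp_all add: L Lp v_def n_def)
  then have "measure M {\<omega> \<in> space M. X (below k \<omega>)} = v"
    by (simp add: Lc S.P.prob_space)
  also have "v = measure_pmf.prob (binomial_pmf n (P k)) {a. X a}"
  proof -
    have Pk: "P k \<in> {0..1}" by (simp add: P_def)
    have "measure_pmf.prob (binomial_pmf n (P k)) {a. X a} = measure_pmf.prob (binomial_pmf n (P k)) {a. a \<le> n \<and> X a}"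
    proof (rule measure_prob_cong_0)
      show "pmf (binomial_pmf n (P k)) a = 0" if "a \<in> {a. X a} - {a. a \<le> n \<and> X a}" for a
        using that Pk by (auto simp: not_le binomial_eq_0)
    qed auto
    also have "\<dots> = (\<Sum>a | a \<le> n \<and> X a. pmf (binomial_pmf n (P k)) a)"
      by (rule measure_measure_pmf_finite) simp
    also have "\<dots> = v" unfolding v_def using Pk by (intro sum.cong refl) (simp add: binom_prob_def)
    finally show ?thesis by simp
  qed
  also have "\<dots> \<le> 2 * exp (- 2 * \<epsilon>\<^sup>2 / real n)"
    unfolding X_def using binomial_distribution.prob_abs_ge[of "P k" n \<epsilon>] n \<epsilon>
    by (simp add: binomial_distribution_def P_def)
  finally show ?thesis by (simp add: X_def n_def)
qed

end

section \<open>The Haar estimator in terms of bin counts\<close>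

lemma haar_kernel_eq: "haar_kernel x y = (if \<lfloor>x\<rfloor> = \<lfloor>y\<rfloor> then 1 else 0)"
proof -
  have ind: "indicator {0..<1} (z - of_int k) = (if k = \<lfloor>z\<rfloor> then 1 else 0 :: real)" for z :: real and k :: int
  proof -
    have "z - of_int k \<in> {0..<1} \<longleftrightarrow> k = \<lfloor>z\<rfloor>" by (auto simp: floor_eq_iff eq_commute[of k])
    then show ?thesis by (simp add: indicator_def)
  qed
  have "haar_kernel x y = (\<Sum>\<^sub>\<infinity>k\<in>{\<lfloor>x\<rfloor>}. if k = \<lfloor>x\<rfloor> \<and> k = \<lfloor>y\<rfloor> then 1 else 0)"
    unfolding haar_kernel_def ind by (rule infsum_cong_neutral) auto
  also have "\<dots> = (if \<lfloor>x\<rfloor> = \<lfloor>y\<rfloor> then 1 else 0)" by (subst infsum_finite) auto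
  finally show ?thesis .
qed

text \<open>The dyadic intervals that meet $[0,1]$ are numbered from 0 to $2^J$; the last one meets it
  only in the point 1. All remaining points share the label $2^J + 1$.\<close>

definition haar_bin :: "nat \<Rightarrow> real \<Rightarrow> nat" where
  "haar_bin J y = (if 0 \<le> \<lfloor>2 ^ J * y\<rfloor> \<and> \<lfloor>2 ^ J * y\<rfloor> \<le> 2 ^ J then nat \<lfloor>2 ^ J * y\<rfloor> else 2 ^ J + 1)"

lemma haar_bin_measurable [measurable]: "haar_bin J \<in> measurable borel (count_space UNIV)"
  unfolding haar_bin_def by measurable

lemma haar_bin_eq_iff:
  assumes "k \<le> 2 ^ J"
  shows "haar_bin J y = k \<longleftrightarrow> y \<in> {real k / 2 ^ J ..< (real k + 1) / 2 ^ J}"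
proof -
  have "haar_bin J y = k \<longleftrightarrow> \<lfloor>2 ^ J * y\<rfloor> = int k"
  proof (cases "0 \<le> \<lfloor>2 ^ J * y\<rfloor> \<and> \<lfloor>2 ^ J * y\<rfloor> \<le> 2 ^ J")
    case True
    then have "haar_bin J y = nat \<lfloor>2 ^ J * y\<rfloor>" unfolding haar_bin_def by (rule if_P)
    then show ?thesis using True by linarith
  next
    case False
    then have "haar_bin J y = 2 ^ J + 1" unfolding haar_bin_def by (rule if_not_P)
    then have "haar_bin J y \<noteq> k" using assms by simp
    moreover have "int k \<le> 2 ^ J" using assms by (metis of_nat_le_iff of_nat_numeral of_nat_power)
    then have "\<lfloor>2 ^ J * y\<rfloor> \<noteq> int k" using False by (metis of_nat_0_le_iff)
    ultimately show ?thesis by blast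
  qed
  also have "\<dots> \<longleftrightarrow> real k \<le> 2 ^ J * y \<and> 2 ^ J * y < real k + 1"
    by (simp add: floor_eq_iff)
  also have "\<dots> \<longleftrightarrow> y \<in> {real k / 2 ^ J ..< (real k + 1) / 2 ^ J}"
    by (auto simp: field_simps)
  finally show ?thesis .
qed

lemma haar_bin_unit:
  assumes "y \<in> {0..1}"
  shows "haar_bin J y \<le> 2 ^ J" and "haar_bin J z = haar_bin J y \<longleftrightarrow> \<lfloor>2 ^ J * z\<rfloor> = \<lfloor>2 ^ J * y\<rfloor>"
proof -
  have "0 \<le> \<lfloor>2 ^ J * y\<rfloor>" using assms by simp
  moreover have "2 ^ J * y \<le> 2 ^ J" using assms by simp
  then have "\<lfloor>2 ^ J * y\<rfloor> \<le> \<lfloor>(2::real) ^ J\<rfloor>" by (rule floor_mono)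
  then have "\<lfloor>2 ^ J * y\<rfloor> \<le> 2 ^ J" by simp
  ultimately have r: "0 \<le> \<lfloor>2 ^ J * y\<rfloor>" "\<lfloor>2 ^ J * y\<rfloor> \<le> 2 ^ J" by auto
  then show "haar_bin J y \<le> 2 ^ J" by (simp add: haar_bin_def nat_le_iff)
  have y: "haar_bin J y = nat \<lfloor>2 ^ J * y\<rfloor>" "nat \<lfloor>2 ^ J * y\<rfloor> \<le> 2 ^ J"
    using r by (auto simp: haar_bin_def nat_le_iff)
  show "haar_bin J z = haar_bin J y \<longleftrightarrow> \<lfloor>2 ^ J * z\<rfloor> = \<lfloor>2 ^ J * y\<rfloor>"
  proof (cases "0 \<le> \<lfloor>2 ^ J * z\<rfloor> \<and> \<lfloor>2 ^ J * z\<rfloor> \<le> 2 ^ J")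
    case True
    then have "haar_bin J z = nat \<lfloor>2 ^ J * z\<rfloor>" unfolding haar_bin_def by (rule if_P)
    then show ?thesis using True r(1) unfolding y(1) by (simp only: eq_nat_nat_iff)
  next
    case False
    then have "haar_bin J z = 2 ^ J + 1" unfolding haar_bin_def by (rule if_not_P)
    moreover have "haar_bin J y \<le> 2 ^ J" unfolding y(1) by (rule y(2))
    ultimately have "haar_bin J z \<noteq> haar_bin J y" by linarith
    moreover have "\<lfloor>2 ^ J * z\<rfloor> \<noteq> \<lfloor>2 ^ J * y\<rfloor>" using False r by metis
    ultimately show ?thesis by blast
  qed
qed

lemma haar_bin_less_iff: "haar_bin J y < 2 ^ J + 1 \<longleftrightarrow> y \<in> {0 ..< 1 + 1 / 2 ^ J}"
proof -
  have "haar_bin J y < 2 ^ J + 1 \<longleftrightarrow> 0 \<le> \<lfloor>2 ^ J * y\<rfloor> \<and> \<lfloor>2 ^ J * y\<rfloor> \<le> 2 ^ J"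
    by (auto simp: haar_bin_def nat_less_iff)
  also have "\<dots> \<longleftrightarrow> 0 \<le> 2 ^ J * y \<and> 2 ^ J * y < 2 ^ J + 1"
    by (simp add: floor_le_iff)
  also have "\<dots> \<longleftrightarrow> y \<in> {0 ..< 1 + 1 / 2 ^ J}"
  proof -
    have p: "(0::real) < 2 ^ J" by simp
    have "0 \<le> 2 ^ J * y \<longleftrightarrow> 0 \<le> y" using mult_le_cancel_left_pos[OF p, of 0 y] by simp
    moreover have "2 ^ J * y < 2 ^ J + 1 \<longleftrightarrow> y < 1 + 1 / 2 ^ J" using p by (simp add: field_simps)
    ultimately show ?thesis by simp
  qed
  finally show ?thesis .
qed

locale haar_sample =
  fixes f :: "real \<Rightarrow> real" and J n :: nat
  assumes f_cont: "continuous_on UNIV f" and f_int: "has_bochner_integral lborel f 1" and f_nonneg: "\<And>x. 0 \<le> f x"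
    and n_pos: "0 < n"
begin

abbreviation "\<mu> \<equiv> density lborel (\<lambda>x. ennreal (f x))"

lemma f_measurable [measurable]: "f \<in> borel_measurable borel"
  using f_cont by (rule borel_measurable_continuous_onI)

lemma prob_space_density: "prob_space \<mu>"
proof
  have "emeasure \<mu> (space \<mu>) = (\<integral>\<^sup>+x. ennreal (f x) \<partial>lborel)" by (simp add: emeasure_density)
  also have "\<dots> = ennreal (integral\<^sup>L lborel f)"
    by (rule nn_integral_eq_integral) (use f_int f_nonneg in \<open>auto simp: has_bochner_integral_iff\<close>)
  also have "\<dots> = 1" using f_int by (simp add: has_bochner_integral_iff)
  finally show "emeasure \<mu> (space \<mu>) = 1" .
qed

sublocale labelled_sample \<mu> "haar_bin J" "{1..n}"
proof -
  interpret prob_space \<mu> by (rule prob_space_density)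
  show "labelled_sample \<mu> (haar_bin J) {1..n}"
    by unfold_locales (simp_all add: measurable_cong_sets[OF sets_density refl])
qed

lemma sample_measure_eq: "sample_measure f = M"
  by (simp add: sample_measure_def)

lemma interval_prob_bounds:
  assumes "a \<le> b" "0 \<le> lo" "\<And>z. z \<in> {a..<b} \<Longrightarrow> lo \<le> f z \<and> f z \<le> hi"
  shows "lo * (b - a) \<le> prob {a..<b}" and "prob {a..<b} \<le> hi * (b - a)"
proof -
  have em: "ennreal (prob {a..<b}) = (\<integral>\<^sup>+x. ennreal (f x) * indicator {a..<b} x \<partial>lborel)"
    by (simp add: emeasure_eq_measure[symmetric] emeasure_density)
  have "ennreal (lo * (b - a)) = (\<integral>\<^sup>+x. ennreal lo * indicator {a..<b} x \<partial>lborel)"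
    using assms by (simp add: nn_integral_cmult_indicator ennreal_mult)
  also have "\<dots> \<le> ennreal (prob {a..<b})"
    unfolding em using assms(3) by (intro nn_integral_mono) (auto simp: indicator_def ennreal_leI)
  finally show "lo * (b - a) \<le> prob {a..<b}" by simp
  show "prob {a..<b} \<le> hi * (b - a)"
  proof (cases "a < b")
    case True
    have hi: "0 \<le> hi" using assms(3)[of a] f_nonneg[of a] True by auto
    have "ennreal (prob {a..<b}) \<le> (\<integral>\<^sup>+x. ennreal hi * indicator {a..<b} x \<partial>lborel)"
      unfolding em using assms(3) by (intro nn_integral_mono) (auto simp: indicator_def ennreal_leI)
    also have "\<dots> = ennreal (hi * (b - a))"
      using assms(1) hi by (simp add: nn_integral_cmult_indicator ennreal_mult)
    finally show ?thesis using hi True by (simp add: ennreal_le_iff)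
  qed (use assms(1) in simp)
qed

lemma p_eq: "k \<le> 2 ^ J \<Longrightarrow> p k = prob {real k / 2 ^ J ..< (real k + 1) / 2 ^ J}"
  unfolding p_def by (rule arg_cong[where f = prob]) (auto simp: haar_bin_eq_iff simp del: atLeastLessThan_iff)

lemma p_bounds:
  assumes k: "k \<le> 2 ^ J" and bd: "0 \<le> lo" "\<And>z. haar_bin J z = k \<Longrightarrow> lo \<le> f z \<and> f z \<le> hi"
  shows "lo \<le> 2 ^ J * p k" "2 ^ J * p k \<le> hi"
proof -
  have len: "(real k + 1) / 2 ^ J - real k / 2 ^ J = 1 / 2 ^ J" by (simp add: diff_divide_distrib[symmetric])
  have "lo * (1 / 2 ^ J) \<le> p k" "p k \<le> hi * (1 / 2 ^ J)"
    using interval_prob_bounds[of "real k / 2 ^ J" "(real k + 1) / 2 ^ J" lo hi] bd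
    unfolding p_eq[OF k] len haar_bin_eq_iff[OF k] by (auto simp: divide_right_mono)
  then show "lo \<le> 2 ^ J * p k" "2 ^ J * p k \<le> hi" by (auto simp: field_simps)
qed

text \<open>Mass to the left of 0 is never in one of the bins, so the conditional probabilities
  \<open>p k / (1 - P k)\<close> have denominators bounded away from 0.\<close>

lemma P_le:
  assumes "F1 < 0" "0 \<le> d" "\<And>z. F1 \<le> z \<Longrightarrow> z \<le> 0 \<Longrightarrow> d \<le> f z" "k \<le> 2 ^ J + 1"
  shows "P k \<le> 1 - d * (- F1)"
proof -
  have "compact (f ` {F1..0})" using f_cont by (intro compact_continuous_image) (auto intro: continuous_on_subset)
  then obtain B where B: "\<And>z. z \<in> {F1..0} \<Longrightarrow> f z \<le> B"
    by (meson bdd_above.E bounded_imp_bdd_above compact_imp_bounded image_eqI)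
  have "d * (0 - F1) \<le> prob {F1..<0}"
    by (rule interval_prob_bounds(1)[where hi = B]) (use assms B in auto)
  moreover have "P k + prob {F1..<0} \<le> 1"
  proof -
    have "{x \<in> space \<mu>. haar_bin J x < k} \<inter> {F1..<0} = {}"
    proof -
      have "0 \<le> x" if "haar_bin J x < k" for x
      proof -
        have "haar_bin J x < 2 ^ J + 1" using that assms(4) by linarith
        then show ?thesis unfolding haar_bin_less_iff by simp
      qed
      then show ?thesis by force
    qed
    then have "P k + prob {F1..<0} = prob ({x \<in> space \<mu>. haar_bin J x < k} \<union> {F1..<0})"
      unfolding P_def by (subst finite_measure_Union) auto
    then show ?thesis by simp
  qed
  ultimately show ?thesis by simp
qed

lemma haar_estimator_count:
  assumes "y \<in> {0..1}"
  shows "haar_estimator J n \<omega> y = 2 ^ J / real n * real (count (haar_bin J y) \<omega>)"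
proof -
  have "(\<Sum>i=1..n. haar_kernel (2 ^ J * y) (2 ^ J * \<omega> i)) = (\<Sum>i\<in>{1..n}. if haar_bin J (\<omega> i) = haar_bin J y then 1 else 0)"
    using haar_bin_unit(2)[OF assms] by (intro sum.cong refl) (auto simp: haar_kernel_eq)
  also have "\<dots> = real (count (haar_bin J y) \<omega>)"
    unfolding count_def by (subst sum.inter_filter[symmetric]) (simp, simp only: sum_constant mult_1_right of_nat_mult of_nat_1)
  finally show ?thesis by (simp add: haar_estimator_def)
qed

lemma mean_haar_estimator_eq:
  assumes "y \<in> {0..1}"
  shows "mean_haar_estimator f J n y = 2 ^ J * p (haar_bin J y)"
proof -
  define k where "k = haar_bin J y"
  define A where "A = (\<lambda>i::nat. {\<omega> \<in> space M. haar_bin J (\<omega> i) = k})"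
  have A: "A i \<in> sets M" for i unfolding A_def by measurable
  have mA: "measure M (A i) = p k" for i
  proof -
    have "emeasure M {\<omega> \<in> space M. \<omega> i \<in> {x \<in> space \<mu>. haar_bin J x = k}} = emeasure \<mu> {x \<in> space \<mu>. haar_bin J x = k}"
      by (rule S.emeasure_PiM_Collect_single) auto
    moreover have "{\<omega> \<in> space M. \<omega> i \<in> {x \<in> space \<mu>. haar_bin J x = k}} = A i"
      by (auto simp: A_def space_PiM)
    ultimately show ?thesis by (simp add: measure_def p_def)
  qed
  have "mean_haar_estimator f J n y = (LINT \<omega>|M. 2 ^ J / real n * (\<Sum>i\<in>{1..n}. indicator (A i) \<omega>))"
    unfolding mean_haar_estimator_def sample_measure_eq
  proof (rule Bochner_Integration.integral_cong[OF refl])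
    fix \<omega> assume "\<omega> \<in> space M"
    then have "(\<Sum>i\<in>{1..n}. indicator (A i) \<omega>) = (\<Sum>i\<in>{1..n}. if haar_bin J (\<omega> i) = k then 1 else (0::real))"
      by (intro sum.cong refl) (simp add: A_def)
    also have "\<dots> = real (count k \<omega>)"
      unfolding count_def by (subst sum.inter_filter[symmetric]) (simp, simp only: sum_constant mult_1_right of_nat_mult of_nat_1)
    finally have "real (count k \<omega>) = (\<Sum>i\<in>{1..n}. indicator (A i) \<omega>)" ..
    then show "haar_estimator J n \<omega> y = 2 ^ J / real n * (\<Sum>i\<in>{1..n}. indicator (A i) \<omega>)"
      using haar_estimator_count[OF assms, of \<omega>] by (simp add: k_def)
  qed
  also have "\<dots> = 2 ^ J / real n * (\<Sum>i\<in>{1..n}. LINT \<omega>|M. indicator (A i) \<omega>)"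
    using A by (subst integral_mult_right_zero, subst Bochner_Integration.integral_sum) (auto simp: S.emeasure_eq_measure)
  also have "\<dots> = 2 ^ J / real n * (\<Sum>i\<in>{1..n}. p k)"
    using A mA by (simp add: S.emeasure_eq_measure)
  also have "\<dots> = 2 ^ J * p k" using n_pos by simp
  finally show ?thesis by (simp add: k_def)
qed

text \<open>On a bin the deviation is constant in \<open>y\<close> while the standardisation $\sqrt{f(y)}$ varies, so the
  most restrictive \<open>y\<close> counts.\<close>

definition threshold :: "real \<Rightarrow> nat \<Rightarrow> real" where
  "threshold u k = (INF y\<in>{y \<in> {0..1}. haar_bin J y = k}. u * sqrt (real n / 2 ^ J) * sqrt (f y))"

lemma bin_nonempty: "k \<le> 2 ^ J \<Longrightarrow> {y \<in> {0..1}. haar_bin J y = k} \<noteq> {}"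
proof -
  assume k: "k \<le> 2 ^ J"
  then have "real k \<le> 2 ^ J" by (metis of_nat_le_iff of_nat_numeral of_nat_power)
  then have "real k / 2 ^ J \<in> {y \<in> {0..1}. haar_bin J y = k}"
    using haar_bin_eq_iff[OF k, of "real k / 2 ^ J"] by (auto simp: divide_right_mono divide_strict_right_mono)
  then show ?thesis by blast
qed

lemma bdd_below_bin: "0 \<le> u \<Longrightarrow> bdd_below ((\<lambda>y. u * sqrt (real n / 2 ^ J) * sqrt (f y)) ` X)"
  by (rule bdd_belowI2[where m = 0]) (simp add: f_nonneg)

lemma sup_deviation_event:
  assumes d: "0 < d" "\<And>y. y \<in> {0..1} \<Longrightarrow> d \<le> f y" and A: "A > 0" and u: "u = B + x / A" "u \<ge> 0"
  shows "A * (sqrt (real n / 2 ^ J) * (SUP y\<in>{0..1}. \<bar>(haar_estimator J n \<omega> y - mean_haar_estimator f J n y) / sqrt (f y)\<bar>) - B) \<le> x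
    \<longleftrightarrow> (\<forall>k<2 ^ J + 1. \<bar>real (count k \<omega>) - real n * p k\<bar> \<le> threshold u k)"
proof -
  define c where "c = sqrt (real n / 2 ^ J)"
  have c: "c > 0" "c * c = real n / 2 ^ J" using n_pos by (auto simp: c_def)
  define g where "g = (\<lambda>y. \<bar>(haar_estimator J n \<omega> y - mean_haar_estimator f J n y) / sqrt (f y)\<bar>)"
  define D where "D = (\<lambda>k. \<bar>real (count k \<omega>) - real n * p k\<bar>)"
  have geq: "g y = D (haar_bin J y) / (c * c * sqrt (f y))" and fpos: "f y > 0" if y: "y \<in> {0..1}" for y
  proof -
    show fp: "f y > 0" using d y by force
    have "haar_estimator J n \<omega> y - mean_haar_estimator f J n y = (real (count (haar_bin J y) \<omega>) - real n * p (haar_bin J y)) / (c * c)"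
      unfolding haar_estimator_count[OF y] mean_haar_estimator_eq[OF y] c(2) using n_pos by (simp add: field_simps)
    then show "g y = D (haar_bin J y) / (c * c * sqrt (f y))"
      unfolding g_def D_def using c fp by (simp add: abs_divide abs_mult)
  qed
  have bdd: "bdd_above (g ` {0..1})"
  proof (rule bdd_aboveI2)
    fix y :: real assume y: "y \<in> {0..1}"
    have "D (haar_bin J y) \<le> Max (D ` {..2 ^ J})" using haar_bin_unit(1)[OF y] by (intro Max_ge) auto
    moreover have "0 \<le> D (haar_bin J y)" by (simp add: D_def)
    moreover have "c * c * sqrt d \<le> c * c * sqrt (f y)" using d(2)[OF y] c by (intro mult_left_mono) auto
    moreover have "0 < c * c * sqrt d" using c(1) d(1) by simp
    ultimately show "g y \<le> Max (D ` {..2 ^ J}) / (c * c * sqrt d)"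
      unfolding geq[OF y] by (intro frac_le) linarith+
  qed
  have "A * (c * (SUP y\<in>{0..1}. g y) - B) \<le> x \<longleftrightarrow> (SUP y\<in>{0..1}. g y) \<le> u / c"
  proof -
    have "A * (c * (SUP y\<in>{0..1}. g y) - B) \<le> x \<longleftrightarrow> c * (SUP y\<in>{0..1}. g y) - B \<le> x / A" using A by (simp add: pos_le_divide_eq mult.commute)
    also have "\<dots> \<longleftrightarrow> (SUP y\<in>{0..1}. g y) * c \<le> u" using u by (auto simp: mult.commute)
    also have "\<dots> \<longleftrightarrow> (SUP y\<in>{0..1}. g y) \<le> u / c" using c by (simp add: pos_le_divide_eq)
    finally show ?thesis .
  qed
  also have "\<dots> \<longleftrightarrow> (\<forall>y\<in>{0..1}. g y \<le> u / c)" using bdd by (intro cSUP_le_iff) auto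
  also have "\<dots> \<longleftrightarrow> (\<forall>y\<in>{0..1}. D (haar_bin J y) \<le> u * c * sqrt (f y))"
  proof (intro ball_cong refl)
    fix y :: real assume y: "y \<in> {0..1}"
    have "g y \<le> u / c \<longleftrightarrow> D (haar_bin J y) \<le> u / c * (c * c * sqrt (f y))"
      unfolding geq[OF y] using c(1) fpos[OF y] by (subst pos_divide_le_eq) auto
    also have "u / c * (c * c * sqrt (f y)) = u * c * sqrt (f y)" using c(1) by simp
    finally show "g y \<le> u / c \<longleftrightarrow> D (haar_bin J y) \<le> u * c * sqrt (f y)" .
  qed
  also have "\<dots> \<longleftrightarrow> (\<forall>k<2 ^ J + 1. D k \<le> threshold u k)"
  proof -
    have "D k \<le> threshold u k \<longleftrightarrow> (\<forall>y\<in>{y \<in> {0..1}. haar_bin J y = k}. D k \<le> u * c * sqrt (f y))" if "k < 2 ^ J + 1" for k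
      unfolding threshold_def c_def using that u by (intro le_cINF_iff bin_nonempty bdd_below_bin) auto
    then have "(\<forall>k<2 ^ J + 1. D k \<le> threshold u k) \<longleftrightarrow> (\<forall>k<2 ^ J + 1. \<forall>y\<in>{y \<in> {0..1}. haar_bin J y = k}. D k \<le> u * c * sqrt (f y))" by blast
    also have "\<dots> \<longleftrightarrow> (\<forall>y\<in>{0..1}. D (haar_bin J y) \<le> u * c * sqrt (f y))"
      using haar_bin_unit(1)[of _ J] by (auto simp: less_Suc_eq_le)
    finally show ?thesis by blast
  qed
  finally show ?thesis by (simp add: g_def c_def D_def)
qed

lemma threshold_bounds:
  assumes k: "k \<le> 2 ^ J" and u: "0 \<le> u" and th: "0 \<le> \<theta>"
    and bd: "\<And>y. y \<in> {0..1} \<Longrightarrow> haar_bin J y = k \<Longrightarrow> \<bar>f y - 2 ^ J * p k\<bar> \<le> \<theta> * (2 ^ J * p k)" and p: "p k > 0"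
  shows "\<bar>threshold u k - u * sqrt (real n * p k)\<bar> \<le> u * sqrt (real n * p k) * \<theta>"
proof -
  define t where "t = real n * p k"
  have t: "t > 0" using p n_pos by (simp add: t_def)
  have val: "\<bar>u * sqrt (real n / 2 ^ J) * sqrt (f y) - u * sqrt t\<bar> \<le> u * sqrt t * \<theta>"
    if y: "y \<in> {0..1}" "haar_bin J y = k" for y
  proof -
    define a where "a = f y / (2 ^ J * p k)"
    have a0: "a \<ge> 0" using f_nonneg p by (simp add: a_def)
    have "\<bar>a - 1\<bar> \<le> \<theta>"
    proof -
      have "a - 1 = (f y - 2 ^ J * p k) / (2 ^ J * p k)" using p by (simp add: a_def diff_divide_distrib)
      then show ?thesis using bd[OF y] p by (simp add: abs_divide abs_mult pos_divide_le_eq)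
    qed
    then have s: "\<bar>sqrt a - 1\<bar> \<le> \<theta>" using sqrt_near_one[OF a0] by linarith
    have "real n / 2 ^ J * f y = t * a" using p by (simp add: a_def t_def)
    then have "sqrt (real n / 2 ^ J) * sqrt (f y) = sqrt t * sqrt a" by (simp add: real_sqrt_mult[symmetric])
    then have "u * sqrt (real n / 2 ^ J) * sqrt (f y) - u * sqrt t = u * sqrt t * (sqrt a - 1)"
      by (simp add: algebra_simps)
    also have "\<bar>\<dots>\<bar> = u * sqrt t * \<bar>sqrt a - 1\<bar>" using u t by (simp add: abs_mult)
    also have "\<dots> \<le> u * sqrt t * \<theta>" using s u t by (intro mult_left_mono) auto
    finally show ?thesis .
  qed
  have lower: "u * sqrt t - u * sqrt t * \<theta> \<le> threshold u k"
    unfolding threshold_def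
  proof (rule cINF_greatest[OF bin_nonempty[OF k]])
    fix y assume "y \<in> {y \<in> {0..1}. haar_bin J y = k}"
    then show "u * sqrt t - u * sqrt t * \<theta> \<le> u * sqrt (real n / 2 ^ J) * sqrt (f y)"
      using val[of y] unfolding abs_le_iff by auto
  qed
  obtain y where y: "y \<in> {y \<in> {0..1}. haar_bin J y = k}" using bin_nonempty[OF k] by blast
  have "threshold u k \<le> u * sqrt (real n / 2 ^ J) * sqrt (f y)"
    unfolding threshold_def by (rule cINF_lower[OF bdd_below_bin[OF u] y])
  then have "threshold u k \<le> u * sqrt t + u * sqrt t * \<theta>" using val[of y] y unfolding abs_le_iff by auto
  with lower show ?thesis unfolding t_def[symmetric] by (simp add: abs_le_iff)
qed

end

section \<open>The extreme value limit\<close>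

text \<open>The hypothesis forces $2^J \le n$ and hence $J = O(\log n)$, which allows the two logarithms in it
  to be traded for two further factors $J$.\<close>

lemma growth_condition:
  fixes J :: "nat \<Rightarrow> nat"
  assumes J: "filterlim J at_top sequentially"
    and o: "(\<lambda>n. real (J n) * 2 ^ J n) \<in> o(\<lambda>n. real n / (ln (real n))\<^sup>2)"
  shows "(\<lambda>n. real (J n) ^ 3 * 2 ^ J n / real n) \<longlonglongrightarrow> 0"
proof (rule Lim_null_comparison)
  define Y where "Y = (\<lambda>n. real (J n) * 2 ^ J n / (real n / (ln (real n))\<^sup>2))"
  have Y: "Y \<longlonglongrightarrow> 0" unfolding Y_def by (rule smalloD_tendsto[OF o])
  have "\<forall>\<^sub>F n in sequentially. Y n < 1" using Y by (rule order_tendstoD) simp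
  moreover have "\<forall>\<^sub>F n in sequentially. ln (real n) > 1" by real_asymp
  moreover have "\<forall>\<^sub>F n in sequentially. J n > 0" by (rule eventually_compose_filterlim[OF eventually_gt_at_top J])
  moreover have "\<forall>\<^sub>F n in sequentially. n > (0::nat)" by (rule eventually_gt_at_top)
  ultimately show "\<forall>\<^sub>F n in sequentially. norm (real (J n) ^ 3 * 2 ^ J n / real n) \<le> 1 / (ln 2)\<^sup>2 * Y n"
  proof eventually_elim
    case (elim n)
    have Yeq: "Y n = real (J n) * 2 ^ J n / real n * (ln (real n))\<^sup>2" using elim by (simp add: Y_def)
    have Jle: "2 ^ J n \<le> real (J n) * 2 ^ J n" using elim by simp
    have "real (J n) * 2 ^ J n / real n * 1 \<le> Y n"
      unfolding Yeq using elim by (intro mult_left_mono one_le_power) auto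
    then have "real (J n) * 2 ^ J n \<le> real n" using elim by (simp add: pos_divide_le_eq) (smt (verit) mult_less_cancel_right2 of_nat_0_less_iff)
    with Jle have "2 ^ J n \<le> real n" by linarith
    then have "ln (2 ^ J n) \<le> ln (real n)" using elim by simp
    then have "real (J n) * ln 2 \<le> ln (real n)" by (simp add: ln_realpow)
    then have "(real (J n) * ln 2)\<^sup>2 \<le> (ln (real n))\<^sup>2" by (intro power_mono) auto
    then have Jsq: "real (J n) ^ 2 \<le> 1 / (ln 2)\<^sup>2 * (ln (real n))\<^sup>2" by (simp add: power_mult_distrib field_simps)
    have "norm (real (J n) ^ 3 * 2 ^ J n / real n) = (real (J n) * 2 ^ J n / real n) * real (J n) ^ 2"
      by (simp add: power3_eq_cube power2_eq_square)
    also have "\<dots> \<le> (real (J n) * 2 ^ J n / real n) * (1 / (ln 2)\<^sup>2 * (ln (real n))\<^sup>2)"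
      by (intro mult_left_mono Jsq) auto
    finally show ?case by (simp add: Yeq mult_ac)
  qed
  show "(\<lambda>n. 1 / (ln 2)\<^sup>2 * Y n) \<longlonglongrightarrow> 0" by (rule tendsto_mult_right_zero[OF Y])
qed

lemma one_minus_power_exp: "((\<lambda>J. (1 - a / 2 ^ J) ^ (2 ^ J + 1)) \<longlongrightarrow> exp (- a)) sequentially" for a :: real
proof -
  have 1: "(\<lambda>m. (1 + (- a) / real m) ^ m) \<longlonglongrightarrow> exp (- a)" by (rule tendsto_exp_limit_sequentially)
  have 2: "filterlim (\<lambda>J::nat. 2 ^ J :: nat) at_top sequentially"
    by (rule filterlim_subseq) (simp add: strict_mono_def)
  have "(\<lambda>J::nat. (1 + (- a) / real (2 ^ J)) ^ (2 ^ J)) \<longlonglongrightarrow> exp (- a)"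
    by (rule filterlim_compose[OF 1 2])
  moreover have "(\<lambda>J::nat. 1 + (- a) / 2 ^ J) \<longlonglongrightarrow> 1" by real_asymp
  ultimately have "(\<lambda>J::nat. (1 + (- a) / real (2 ^ J)) ^ (2 ^ J) * (1 + (- a) / 2 ^ J)) \<longlonglongrightarrow> exp (- a) * 1"
    by (rule tendsto_mult)
  then show ?thesis by (simp add: mult.commute)
qed

text \<open>The limit theorem for an arbitrary class of densities that are bounded below on an interval
  reaching to the left of 0 and share a modulus of continuity of order $o(1/J)$ at distance $2^{-J}$.\<close>

theorem gumbel_limit_uniform:
  fixes J :: "nat \<Rightarrow> nat" and \<omega>0 :: "nat \<Rightarrow> real" and \<D> :: "(real \<Rightarrow> real) set"
  assumes D: "\<And>f. f \<in> \<D> \<Longrightarrow> continuous_on UNIV f" "\<And>f. f \<in> \<D> \<Longrightarrow> has_bochner_integral lborel f 1" "\<And>f x. f \<in> \<D> \<Longrightarrow> 0 \<le> f x"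
    and d: "0 < d" "F1 < 0" "\<And>f z. f \<in> \<D> \<Longrightarrow> F1 \<le> z \<Longrightarrow> z \<le> 1 \<Longrightarrow> d \<le> f z"
    and mod: "\<And>f J x y. f \<in> \<D> \<Longrightarrow> \<bar>x - y\<bar> \<le> 1 / 2 ^ J \<Longrightarrow> \<bar>f x - f y\<bar> \<le> \<omega>0 J"
    and om: "(\<lambda>J. \<omega>0 J * real J) \<longlonglongrightarrow> 0" "\<And>J. \<omega>0 J \<ge> 0"
    and J: "filterlim J at_top sequentially"
    and Jn: "(\<lambda>n. real (J n) ^ 3 * 2 ^ J n / real n) \<longlonglongrightarrow> 0"
    and e: "e > 0"
  shows "\<forall>\<^sub>F n in sequentially. \<forall>f\<in>\<D>.
    \<bar>measure (sample_measure f) {\<omega> \<in> space (sample_measure f).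
        A_norming (J n) * (sqrt (real n / 2 ^ J n) *
           (SUP y\<in>{0..1}. \<bar>(haar_estimator (J n) n \<omega> y - mean_haar_estimator f (J n) n y) / sqrt (f y)\<bar>) - B_norming (J n)) \<le> x}
      - exp (- exp (- x))\<bar> \<le> e"
proof -
  define \<tau> where "\<tau> = exp (- x)"
  have Jreal: "filterlim (\<lambda>n. real (J n)) at_top sequentially"
    by (rule filterlim_compose[OF filterlim_real_sequentially J])
  obtain \<epsilon> where \<epsilon>: "\<epsilon> > 0" "exp (- (\<tau> - \<epsilon>)) < exp (- \<tau>) + e / 3" "exp (- (\<tau> + \<epsilon>)) > exp (- \<tau>) - e / 3"
  proof -
    have "((\<lambda>\<epsilon>. exp (- (\<tau> - \<epsilon>))) \<longlongrightarrow> exp (- (\<tau> - 0))) (at_right 0)" "((\<lambda>\<epsilon>. exp (- (\<tau> + \<epsilon>))) \<longlongrightarrow> exp (- (\<tau> + 0))) (at_right 0)"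
      by (intro tendsto_intros)+
    then have "\<forall>\<^sub>F \<epsilon> in at_right 0. exp (- (\<tau> - \<epsilon>)) < exp (- \<tau>) + e / 3" "\<forall>\<^sub>F \<epsilon> in at_right 0. exp (- (\<tau> + \<epsilon>)) > exp (- \<tau>) - e / 3"
      using e by (auto intro: order_tendstoD)
    moreover have "\<forall>\<^sub>F \<epsilon> in at_right (0::real). \<epsilon> > 0" by (rule eventually_at_right_less)
    ultimately have "\<forall>\<^sub>F \<epsilon> in at_right 0. exp (- (\<tau> - \<epsilon>)) < exp (- \<tau>) + e / 3 \<and> exp (- (\<tau> + \<epsilon>)) > exp (- \<tau>) - e / 3 \<and> \<epsilon> > 0"
      by eventually_elim blast
    then show ?thesis using that eventually_happens'[OF trivial_limit_at_right_real] by blast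
  qed
  define q where "q = d * (- F1)"
  have q: "q > 0" unfolding q_def using d by (intro mult_pos_pos) auto
  \<comment> \<open>An upper bound for $2^J p$: a density with this modulus is at most \<open>1 + \<omega>0 0\<close>, and \<open>\<omega>0 (J n)\<close> is
    eventually below 1.\<close>
  define b where "b = 2 + \<omega>0 0"
  define c where "c = d / 2"
  define C where "C = b / q + b + 1 / q + c"
  have bpos: "b > 0" using om(2)[of 0] by (simp add: b_def)
  have c: "0 < c" "c \<le> C" "b \<le> C" "b / q \<le> C" "1 / q \<le> C" "C > 0" using d q bpos by (auto simp: c_def C_def intro!: add_pos_pos)
  \<comment> \<open>The relative error of the threshold: \<open>\<omega>0\<close> bounds the oscillation of \<open>f\<close> on a bin, and
    \<open>d / 2\<close> is a lower bound for $2^J p$.\<close>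
  define \<theta> where "\<theta> = (\<lambda>n. \<omega>0 (J n) * (2 / d))"
  have "(\<lambda>n. (\<omega>0 (J n) * real (J n)) * (2 / d)) \<longlonglongrightarrow> 0 * (2 / d)"
    by (intro tendsto_intros filterlim_compose[OF om(1) J])
  then have th: "(\<lambda>n. \<theta> n * real (J n)) \<longlonglongrightarrow> 0" by (simp add: \<theta>_def mult_ac)
  have thn: "\<theta> n \<ge> 0" for n using om(2) d by (simp add: \<theta>_def)
  note tail = uniform_gumbel_tail[OF J Jn c(1,2) th thn \<epsilon>(1), of x, folded \<tau>_def]
  have evJ: "\<forall>\<^sub>F n in sequentially. real (J n) > 1" using Jreal unfolding filterlim_at_top_dense by blast
  have "\<forall>\<^sub>F n in sequentially. \<omega>0 (J n) * real (J n) < min 1 (d / 2)"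
    using filterlim_compose[OF om(1) J] by (rule order_tendstoD) (use d in auto)
  then have evom: "\<forall>\<^sub>F n in sequentially. \<omega>0 (J n) < 1 \<and> \<omega>0 (J n) < d / 2"
    using evJ
  proof eventually_elim
    case (elim n)
    have "\<omega>0 (J n) * 1 \<le> \<omega>0 (J n) * real (J n)" using om(2)[of "J n"] elim by (intro mult_left_mono) auto
    then show ?case using elim by linarith
  qed
  have evu: "\<forall>\<^sub>F n in sequentially. gumbel_level x (real (J n)) > 0"
    using filterlim_compose[OF gumbel_level_at_top Jreal] unfolding filterlim_at_top_dense by blast
  have evn: "\<forall>\<^sub>F n in sequentially. n > (0::nat)" by (rule eventually_gt_at_top)
  have p0: "(\<lambda>k. a / 2 ^ k) \<longlonglongrightarrow> 0" for a :: real
  proof -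
    have "(\<lambda>k. a * (1/2) ^ k) \<longlonglongrightarrow> 0" by (rule tendsto_mult_right_zero[OF LIMSEQ_realpow_zero]) auto
    then show ?thesis by (simp add: power_one_over)
  qed
  have evp: "\<forall>\<^sub>F n in sequentially. a / 2 ^ J n < 1" for a :: real
    using filterlim_compose[OF p0 J] by (rule order_tendstoD) simp
  have bad0: "(\<lambda>k. (2 ^ k + 1) * (2 * exp (- 2 * real k))) \<longlonglongrightarrow> 0" by real_asymp
  have ev_bad: "\<forall>\<^sub>F n in sequentially. (2 ^ J n + 1) * (2 * exp (- 2 * real (J n))) < e / 3"
    using filterlim_compose[OF bad0 J] by (rule order_tendstoD) (use e in simp)
  have ev_up: "\<forall>\<^sub>F n in sequentially. (1 - (\<tau> - \<epsilon>) / 2 ^ J n) ^ (2 ^ J n + 1) < exp (- \<tau>) + e / 3"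
    using filterlim_compose[OF one_minus_power_exp J] \<epsilon>(2) by (rule order_tendstoD)
  have ev_lo: "\<forall>\<^sub>F n in sequentially. (1 - (\<tau> + \<epsilon>) / 2 ^ J n) ^ (2 ^ J n + 1) > exp (- \<tau>) - e / 3"
    using filterlim_compose[OF one_minus_power_exp J] \<epsilon>(3) by (rule order_tendstoD)
  have ev_hi: "\<forall>\<^sub>F n in sequentially. (\<tau> + \<epsilon>) / 2 ^ J n < 1" by (rule evp)
  show ?thesis
    using tail evJ evom evu evn evp[of C] ev_bad ev_up ev_lo ev_hi
  proof eventually_elim
    case (elim n)
    show ?case
    proof
      fix f assume f: "f \<in> \<D>"
      interpret haar_sample f "J n" n
        by unfold_locales (use D f elim in auto)
      define K :: nat where "K = 2 ^ J n + 1"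
      define u where "u = gumbel_level x (real (J n))"
      define \<omega>1 where "\<omega>1 = \<omega>0 (J n)"
      have om1: "0 \<le> \<omega>1" "\<omega>1 < 1" "\<omega>1 < d / 2" using om(2) elim by (auto simp: \<omega>1_def)
      have near: "\<bar>f y - f z\<bar> \<le> \<omega>1" if "haar_bin (J n) y = k" "haar_bin (J n) z = k" "k \<le> 2 ^ J n" for y z k
      proof -
        have "(real k + 1) / 2 ^ J n = real k / 2 ^ J n + 1 / 2 ^ J n" by (simp add: add_divide_distrib)
        then have "\<bar>y - z\<bar> \<le> 1 / 2 ^ J n" using that haar_bin_eq_iff[of k "J n" y] haar_bin_eq_iff[of k "J n" z] by auto
        then show ?thesis unfolding \<omega>1_def by (rule mod[OF f])
      qed
      have fle: "f y \<le> 1 + \<omega>0 0" for y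
      proof (cases "f y \<ge> \<omega>0 0")
        case True
        have "compact (f ` {y..y+1})" using f_cont by (intro compact_continuous_image) (auto intro: continuous_on_subset)
        then obtain B where B: "\<And>z. z \<in> {y..y+1} \<Longrightarrow> f z \<le> B"
          by (meson bdd_above.E bounded_imp_bdd_above compact_imp_bounded image_eqI)
        have "(f y - \<omega>0 0) * (y + 1 - y) \<le> prob {y..<y + 1}"
        proof (rule interval_prob_bounds(1)[where hi = B])
          fix z assume "z \<in> {y..<y + 1}"
          then have "\<bar>y - z\<bar> \<le> 1 / 2 ^ 0" by auto
          from mod[OF f this] show "f y - \<omega>0 0 \<le> f z \<and> f z \<le> B" using B[of z] \<open>z \<in> {y..<y + 1}\<close> by auto
        qed (use True in auto)
        then have "f y - \<omega>0 0 \<le> prob {y..<y + 1}" by simp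
        also have "\<dots> \<le> 1" by (rule prob_le_1)
        finally show ?thesis by simp
      qed simp
      have pb: "\<bar>f y - 2 ^ J n * p k\<bar> \<le> \<omega>1" if y: "y \<in> {0..1}" "haar_bin (J n) y = k" and k: "k \<le> 2 ^ J n" for y k
      proof -
        have fy: "d \<le> f y" using d(2) d(3)[OF f, of y] y by auto
        have "f y - \<omega>1 \<le> 2 ^ J n * p k" "2 ^ J n * p k \<le> f y + \<omega>1"
        proof -
          have *: "f y - \<omega>1 \<le> f z \<and> f z \<le> f y + \<omega>1" if "haar_bin (J n) z = k" for z
            using near[OF y(2) that k] by (auto simp: abs_le_iff)
          have 0: "0 \<le> f y - \<omega>1" using fy om1 d(1) by linarith
          show "f y - \<omega>1 \<le> 2 ^ J n * p k" "2 ^ J n * p k \<le> f y + \<omega>1"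
            using p_bounds[OF k 0 *] by auto
        qed
        then show ?thesis by (simp add: abs_le_iff)
      qed
      have pk: "d / 2 \<le> 2 ^ J n * p k" "2 ^ J n * p k \<le> b" "p k > 0" if k: "k \<le> 2 ^ J n" for k
      proof -
        obtain y where y: "y \<in> {0..1}" "haar_bin (J n) y = k" using bin_nonempty[OF k] by auto
        have fy: "d \<le> f y" using d(2) d(3)[OF f, of y] y by auto
        show 1: "d / 2 \<le> 2 ^ J n * p k" "2 ^ J n * p k \<le> b"
          using pb[OF y k] fy om1 fle[of y] by (auto simp: b_def abs_le_iff)
        have "0 < 2 ^ J n * p k" using 1 d(1) by linarith
        then show "p k > 0" by (simp add: zero_less_mult_iff)
      qed
      have Pk: "P k \<le> 1 - q" if "k \<le> K" for k
        unfolding q_def by (rule P_le[OF d(2)]) (use d f that in \<open>auto simp: K_def\<close>)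
      have bd: "(\<Sum>a | a \<le> n - s \<and> \<not> \<bar>real a - real n * p k\<bar> \<le> threshold u k. binom_prob (n - s) (p k / (1 - P k)) a)
          \<in> {(\<tau> - \<epsilon>) / 2 ^ J n .. (\<tau> + \<epsilon>) / 2 ^ J n}"
        if k: "k < K" and s: "s \<le> n" and good: "\<bar>real s - real n * P k\<bar> < sqrt (real (J n) * real n)" for k s
      proof -
        have k': "k \<le> 2 ^ J n" using k by (simp add: K_def)
        have P1: "1 - P k \<ge> q" using Pk[of k] k by simp
        then have P1': "1 - P k > 0" using q by linarith
        have r0: "p k / (1 - P k) > 0" using pk(3)[OF k'] P1' by simp
        have rC: "p k / (1 - P k) \<le> C / 2 ^ J n"
        proof -
          have "p k / (1 - P k) \<le> p k / q" using pk(3)[OF k'] P1 q by (intro divide_left_mono) auto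
          also have "\<dots> = (2 ^ J n * p k) / q / 2 ^ J n" by simp
          also have "\<dots> \<le> b / q / 2 ^ J n" using pk(2)[OF k'] q by (intro divide_right_mono) auto
          also have "\<dots> \<le> C / 2 ^ J n" using c by (intro divide_right_mono) auto
          finally show ?thesis .
        qed
        have r1: "p k / (1 - P k) < 1" using rC elim by linarith
        have t1: "c * real n / 2 ^ J n \<le> real n * p k" "real n * p k \<le> C * real n / 2 ^ J n"
        proof -
          have "real n * c \<le> real n * (2 ^ J n * p k)" using pk(1)[OF k'] by (intro mult_left_mono) (auto simp: c_def)
          then show "c * real n / 2 ^ J n \<le> real n * p k" by (simp add: field_simps)
          have "real n * (2 ^ J n * p k) \<le> real n * C" using pk(2)[OF k'] c by (intro mult_left_mono) auto
          then show "real n * p k \<le> C * real n / 2 ^ J n" by (simp add: field_simps)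
        qed
        have m1: "\<bar>real (n - s) * (p k / (1 - P k)) - real n * p k\<bar> \<le> C * (real n * p k) * sqrt (real (J n) / real n)"
        proof -
          have "real (n - s) * (p k / (1 - P k)) - real n * p k = p k * (- (real s - real n * P k)) / (1 - P k)"
            using s P1' by (simp add: of_nat_diff field_simps)
          also have "\<bar>\<dots>\<bar> = p k * \<bar>real s - real n * P k\<bar> / (1 - P k)"
            using P1' pk(3)[OF k'] by (simp add: abs_mult abs_divide)
          also have "\<dots> \<le> p k * sqrt (real (J n) * real n) / q"
            using P1 P1' q pk(3)[OF k'] good by (intro frac_le mult_left_mono mult_nonneg_nonneg) auto
          also have "\<dots> = 1 / q * (p k * sqrt (real (J n) * real n))" by simp
          also have "\<dots> \<le> C * (p k * sqrt (real (J n) * real n))"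
            using c pk(3)[OF k'] by (intro mult_right_mono) auto
          also have "sqrt (real (J n) * real n) = real n * sqrt (real (J n) / real n)"
          proof -
            have "real (J n) * real n = (real n)\<^sup>2 * (real (J n) / real n)"
              using n_pos by (simp add: power2_eq_square)
            then have "sqrt (real (J n) * real n) = sqrt ((real n)\<^sup>2) * sqrt (real (J n) / real n)"
              by (simp only: real_sqrt_mult)
            then show ?thesis by simp
          qed
          finally show ?thesis by (simp add: mult_ac)
        qed
        have w1: "\<bar>threshold u k - u * sqrt (real n * p k)\<bar> \<le> u * sqrt (real n * p k) * \<theta> n"
        proof (rule threshold_bounds[OF k' _ thn _ pk(3)[OF k']])
          show "0 \<le> u" using elim by (simp add: u_def)
          fix y assume y: "y \<in> {0..1}" "haar_bin (J n) y = k"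
          have "\<bar>f y - 2 ^ J n * p k\<bar> \<le> \<omega>1" by (rule pb[OF y k'])
          also have "\<omega>1 = \<theta> n * (d / 2)" using d by (simp add: \<theta>_def \<omega>1_def)
          also have "\<dots> \<le> \<theta> n * (2 ^ J n * p k)" using pk(1)[OF k'] thn by (intro mult_left_mono) auto
          finally show "\<bar>f y - 2 ^ J n * p k\<bar> \<le> \<theta> n * (2 ^ J n * p k)" .
        qed
        have "(n - s, p k / (1 - P k), real n * p k, threshold u k) \<in> bin_regime c C \<theta> J x n"
          using r0 r1 rC t1 m1 w1 unfolding bin_regime_def u_def by auto
        with elim(1) have "\<bar>2 ^ J n * (\<Sum>a | a \<le> n - s \<and> \<bar>real a - real n * p k\<bar> > threshold u k. binom_prob (n - s) (p k / (1 - P k)) a) - \<tau>\<bar> < \<epsilon>"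
          by fastforce
        then have "\<tau> - \<epsilon> \<le> 2 ^ J n * (\<Sum>a | a \<le> n - s \<and> \<bar>real a - real n * p k\<bar> > threshold u k. binom_prob (n - s) (p k / (1 - P k)) a)"
          "2 ^ J n * (\<Sum>a | a \<le> n - s \<and> \<bar>real a - real n * p k\<bar> > threshold u k. binom_prob (n - s) (p k / (1 - P k)) a) \<le> \<tau> + \<epsilon>"
          by linarith+
        then show ?thesis by (simp add: not_le pos_divide_le_eq pos_le_divide_eq mult.commute)
      qed
      define good where "good = (\<lambda>k s. \<bar>real s - real n * P k\<bar> < sqrt (real (J n) * real n))"
      define bad where "bad = measure M {\<omega> \<in> space M. \<exists>k<K. \<not> good k (below k \<omega>)}"
      define E where "E = measure M {\<omega> \<in> space M. \<forall>k<K. \<bar>real (count k \<omega>) - real n * p k\<bar> \<le> threshold u k}"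
      have occ: "E \<in> {(1 - (\<tau> + \<epsilon>) / 2 ^ J n) ^ K - bad .. (1 - (\<tau> - \<epsilon>) / 2 ^ J n) ^ K + bad}"
        unfolding E_def bad_def
      proof (rule sequential_occupancy)
        show "P k < 1" if "k < K" for k using Pk[of k] q that by simp
        show "(\<Sum>a | a \<le> card {1..n} - s \<and> \<not> \<bar>real a - real n * p k\<bar> \<le> threshold u k. binom_prob (card {1..n} - s) (p k / (1 - P k)) a)
          \<in> {(\<tau> - \<epsilon>) / 2 ^ J n .. (\<tau> + \<epsilon>) / 2 ^ J n}" if "k < K" "s \<le> card {1..n}" "good k s" for k s
          using bd[of k s] that by (simp add: good_def)
        have tpos: "\<tau> > 0" by (simp add: \<tau>_def)
        have "(\<tau> - \<epsilon>) / 2 ^ J n \<le> (\<tau> + \<epsilon>) / 2 ^ J n" using \<epsilon>(1) by (intro divide_right_mono) auto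
        then show "(\<tau> - \<epsilon>) / 2 ^ J n \<le> 1" using elim by linarith
        show "0 \<le> (\<tau> + \<epsilon>) / 2 ^ J n" using tpos \<epsilon>(1) by simp
        show "(\<tau> + \<epsilon>) / 2 ^ J n \<le> 1" using elim by linarith
      qed
      have "bad \<le> e / 3"
      proof -
        have I: "{1..n} \<noteq> {}" using elim by auto
        have "bad = measure M (\<Union>k\<in>{..<K}. {\<omega> \<in> space M. \<not> good k (below k \<omega>)})"
          unfolding bad_def by (rule arg_cong[where f = "measure M"]) auto
        also have "\<dots> \<le> (\<Sum>k\<in>{..<K}. measure M {\<omega> \<in> space M. \<not> good k (below k \<omega>)})"
          by (rule measure_UNION_le[OF finite_lessThan below_pred_sets])
        also have "\<dots> \<le> (\<Sum>k\<in>{..<K}. 2 * exp (- 2 * real (J n)))"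
        proof (rule sum_mono)
          fix k
          have "measure M {\<omega> \<in> space M. sqrt (real (J n) * real n) \<le> \<bar>real (below k \<omega>) - real (card {1..n}) * P k\<bar>}
            \<le> 2 * exp (- 2 * (sqrt (real (J n) * real n))\<^sup>2 / real (card {1..n}))"
            by (rule below_hoeffding[OF I]) simp
          then show "measure M {\<omega> \<in> space M. \<not> good k (below k \<omega>)} \<le> 2 * exp (- 2 * real (J n))"
            using elim by (simp add: good_def not_less)
        qed
        also have "\<dots> = (2 ^ J n + 1) * (2 * exp (- 2 * real (J n)))" by (simp add: K_def)
        finally show ?thesis using elim by linarith
      qed
      then have "\<bar>E - exp (- \<tau>)\<bar> \<le> e"
        using occ elim e unfolding K_def by (auto simp: abs_le_iff)
      moreover have "measure (sample_measure f) {\<omega> \<in> space (sample_measure f).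
        A_norming (J n) * (sqrt (real n / 2 ^ J n) *
           (SUP y\<in>{0..1}. \<bar>(haar_estimator (J n) n \<omega> y - mean_haar_estimator f (J n) n y) / sqrt (f y)\<bar>) - B_norming (J n)) \<le> x} = E"
      proof -
        have A: "A_norming (real (J n)) > 0" using elim by (simp add: A_norming_def)
        have fd: "d \<le> f y" if "y \<in> {0..1}" for y using d(2) d(3)[OF f, of y] that by auto
        have u: "u = B_norming (real (J n)) + x / A_norming (real (J n))" "u \<ge> 0"
          using elim by (auto simp: u_def gumbel_level_def)
        show ?thesis
          unfolding sample_measure_eq E_def K_def
          by (rule arg_cong[where f = "measure M"], rule Collect_cong, rule conj_cong[OF refl],
              rule sup_deviation_event[OF d(1) fd A u])
      qed
      ultimately show "\<bar>measure (sample_measure f) {\<omega> \<in> space (sample_measure f).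
        A_norming (J n) * (sqrt (real n / 2 ^ J n) *
           (SUP y\<in>{0..1}. \<bar>(haar_estimator (J n) n \<omega> y - mean_haar_estimator f (J n) n y) / sqrt (f y)\<bar>) - B_norming (J n)) \<le> x}
      - exp (- exp (- x))\<bar> \<le> e" by (simp add: \<tau>_def)
    qed
  qed
qed

theorem proposition6:
  fixes \<phi> \<psi> :: "real \<Rightarrow> real" and s :: nat
    and \<alpha> D \<delta> F1 F2 :: real and j :: "nat \<Rightarrow> nat"
  assumes "scaling_function \<phi>" and "associated_wavelet \<phi> \<psi>"
    and "s_regular s \<phi>" and "real s > \<alpha>"
    and "0 < \<alpha>" and "\<alpha> \<le> 1" and "0 < D" and "0 < \<delta>"
    and "F1 < 0" and "1 < F2"
    and "density_class \<phi> \<psi> \<alpha> D \<delta> {F1..F2} \<noteq> {}"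
    and "filterlim j at_top sequentially"
    and "(\<lambda>n. real (j n) * 2 ^ j n) \<in> o(\<lambda>n. real n / (ln (real n))\<^sup>2)"
  shows "\<forall>x::real.
    (\<lambda>n. SUP f\<in>density_class \<phi> \<psi> \<alpha> D \<delta> {F1..F2}.
       \<bar>measure (sample_measure f)
          {\<omega> \<in> space (sample_measure f).
             A_norming (j n) *
               (sqrt (real n / 2 ^ j n) *
                  (SUP y\<in>{0..1}.
                     \<bar>(haar_estimator (j n) n \<omega> y - mean_haar_estimator f (j n) n y) / sqrt (f y)\<bar>)
                - B_norming (j n)) \<le> x}
        - exp (- exp (- x))\<bar>) \<longlonglongrightarrow> 0"
proof
  fix x :: real
  let ?D = "density_class \<phi> \<psi> \<alpha> D \<delta> {F1..F2}"
  let ?dev = "\<lambda>n f. \<bar>measure (sample_measure f)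
          {\<omega> \<in> space (sample_measure f).
             A_norming (j n) *
               (sqrt (real n / 2 ^ j n) *
                  (SUP y\<in>{0..1}.
                     \<bar>(haar_estimator (j n) n \<omega> y - mean_haar_estimator f (j n) n y) / sqrt (f y)\<bar>)
                - B_norming (j n)) \<le> x}
        - exp (- exp (- x))\<bar>"
  obtain C where C: "C \<ge> 0" "\<And>f J x y. f \<in> ?D \<Longrightarrow> \<bar>x - y\<bar> \<le> 1 / 2 ^ J \<Longrightarrow>
     \<bar>f x - f y\<bar> \<le> C * ((real J + 1) * 2 powr (- (real J * \<alpha>)))"
    using density_class_modulus[OF assms(2-7)] by blast
  define \<omega> where "\<omega> = (\<lambda>J. C * ((real J + 1) * 2 powr (- (real J * \<alpha>))))"
  have "(\<lambda>J. (real J + 1) * 2 powr (- (real J * \<alpha>)) * real J) \<longlonglongrightarrow> 0"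
    using assms(5) by real_asymp
  then have "(\<lambda>J. C * ((real J + 1) * 2 powr (- (real J * \<alpha>)) * real J)) \<longlonglongrightarrow> 0"
    by (rule tendsto_mult_right_zero)
  then have om: "(\<lambda>J. \<omega> J * real J) \<longlonglongrightarrow> 0" by (simp add: \<omega>_def mult.assoc)
  have om0: "\<omega> J \<ge> 0" for J using C(1) by (simp add: \<omega>_def)
  have dens: "continuous_on UNIV f" "has_bochner_integral lborel f 1" "0 \<le> f z" "z \<in> {F1..F2} \<Longrightarrow> \<delta> \<le> f z" if "f \<in> ?D" for f z
    using that by (auto simp: density_class_def)
  have unif: "\<forall>\<^sub>F n in sequentially. \<forall>f\<in>?D. ?dev n f \<le> e" if "e > 0" for e
  proof (rule gumbel_limit_uniform[where d = \<delta> and ?F1.0 = F1 and ?\<omega>0.0 = \<omega>])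
    show "\<delta> \<le> f z" if "f \<in> ?D" "F1 \<le> z" "z \<le> 1" for f z
      using dens(4)[OF that(1), of z] that assms(10) by auto
    show "\<bar>f x - f y\<bar> \<le> \<omega> J" if "f \<in> ?D" "\<bar>x - y\<bar> \<le> 1 / 2 ^ J" for f J x y
      unfolding \<omega>_def by (rule C(2)[OF that])
    show "(\<lambda>n. real (j n) ^ 3 * 2 ^ j n / real n) \<longlonglongrightarrow> 0"
      by (rule growth_condition[OF assms(12,13)])
    show "continuous_on UNIV f" "has_bochner_integral lborel f 1" "0 \<le> f z" if "f \<in> ?D" for f z
      using dens(1-3)[OF that] by blast+
    show "0 < \<delta>" "F1 < 0" "filterlim j at_top sequentially" by (fact assms)+
    show "(\<lambda>J. \<omega> J * real J) \<longlonglongrightarrow> 0" "\<omega> J \<ge> 0" for J by (fact om, fact om0)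
    show "e > 0" by (fact that)
  qed
  show "(\<lambda>n. SUP f\<in>?D. ?dev n f) \<longlonglongrightarrow> 0"
  proof (rule LIMSEQ_I)
    fix e :: real assume e: "e > 0"
    have "\<forall>\<^sub>F n in sequentially. norm ((SUP f\<in>?D. ?dev n f) - 0) < e"
      using unif[OF half_gt_zero[OF e]]
    proof eventually_elim
      case (elim n)
      then have *: "?dev n f \<le> e / 2" if "f \<in> ?D" for f using that by blast
      obtain f0 where f0: "f0 \<in> ?D" using assms(11) by blast
      have "(SUP f\<in>?D. ?dev n f) \<le> e / 2" by (rule cSUP_least[OF assms(11) *])
      moreover have "bdd_above (?dev n ` ?D)" by (rule bdd_aboveI2[OF *])
      then have "?dev n f0 \<le> (SUP f\<in>?D. ?dev n f)" by (rule cSUP_upper[OF f0])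
      then have "0 \<le> (SUP f\<in>?D. ?dev n f)" using abs_ge_zero order_trans by blast
      ultimately show "norm ((SUP f\<in>?D. ?dev n f) - 0) < e" using e by simp
    qed
    then show "\<exists>no. \<forall>n\<ge>no. norm ((SUP f\<in>?D. ?dev n f) - 0) < e"
      by (simp only: eventually_sequentially)
  qed
qed

end
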